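(* Let $M$ be a Riemannian manifold, let $\varphi\in\Omega^k(M)$ be a calibration on $M$, let $E$ be a Riemannian vector bundle over $M$, and let $\Psi\in\Omega^k(M,E)$ be an $E$-valued $k$-form such that $\varphi$ and $\Psi$ satisfy Harvey-Lawson's identity: for all $x\in M$, $$[\varphi(\xi)]^2+|\Psi(\xi)|^2=|\xi|^2\quad\text{for all } \xi\in Gr_k(T_xM).$$ Let $L\subset M$ be a compact oriented $\varphi$-calibrated submanifold and let $V$ be a normal vector field on $L$. Then the second variation of the volume of $L$ with variation field $V$ is given by $$\frac{d^2}{dt^2}\Big|_{t=0}\mathrm{vol}(L_t)=\int_L\big|\nabla_{\partial t}|_{t=0}\,\Psi\big((\exp tV)_*(\xi(x))\big)\big|^2\,dvol_x .$$ Here: - $\xi(x)$ is the unit decomposable $k$-vector associated to $T_xL$ (with its orientation). - $\exp tV$ denotes the flow, on a neighborhood of $L$, generated by a vector field whose value at each $x\in L$ is equal to $V(x)$, and $L_t=\exp tV(L)$. - $\Psi((\exp tV)_*(\xi(x)))\in E_{\exp tV(x)}$, and $\nabla_{\partial t}\Psi((\exp tV)_*(\xi(x)))$ denotes the covariant derivative of this section of the restriction of $E$ to the curve $[\exp tV(x)]\subset M$. - It is assumed that the covariant derivative $\nabla_{\partial t}$ of $E$ along the curve $[\exp tV(x)]$ preserves the metric on $E$.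
   Context: All objects are smooth, and compact submanifolds are without boundary. A calibration on a Riemannian manifold $M$ is a closed $k$-form $\varphi$ with $\varphi(\xi)\le|\xi|$ for every decomposable tangent $k$-vector $\xi$. An oriented $k$-dimensional submanifold $L\subset M$ is $\varphi$-calibrated if $\varphi|_L=vol_L$, the Riemannian volume form of $L$. $Gr_k(T_xM)$ denotes the set of oriented decomposable $k$-vectors in $T_xM$ (the oriented Grassmannian). The expression $|\xi|$ is the norm induced on $\Lambda^kT_xM$ by the metric. *)

theory Defs
  imports "HOL-Analysis.Analysis"
begin

text \<open>
  Conventions. The manifold \<open>M\<close> is a Hausdorff, second countable type \<open>'m\<close> with a smooth atlas \<open>A\<close>
  modelled on \<open>'b\<close>; it has no boundary. The degree \<open>k\<close> is \<open>CARD('k)\<close>, so a tuple of \<open>k\<close> tangent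
  vectors is a function \<open>'k \<Rightarrow> 'b\<close>. Fibres of a vector bundle are copies of the vector space \<open>'e\<close>.
  The inner products carried by the types \<open>'b\<close> and \<open>'e\<close> play no role: the metrics are \<open>g\<close> and \<open>h\<close>.
\<close>

subsection \<open>Smooth functions on open subsets of normed spaces\<close>

primrec Ck_on :: "nat \<Rightarrow> 'a set \<Rightarrow> ('a::real_normed_vector \<Rightarrow> 'c::real_normed_vector) \<Rightarrow> bool" where
  "Ck_on 0 S f \<longleftrightarrow> continuous_on S f"
| "Ck_on (Suc n) S f \<longleftrightarrow>
     (\<forall>x\<in>S. f differentiable (at x)) \<and> (\<forall>v. Ck_on n S (\<lambda>x. frechet_derivative f (at x) v))"

definition smooth_on :: "'a set \<Rightarrow> ('a::real_normed_vector \<Rightarrow> 'c::real_normed_vector) \<Rightarrow> bool" where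
  "smooth_on S f \<longleftrightarrow> (\<forall>n. Ck_on n S f)"

subsection \<open>Manifolds and tangent vectors\<close>

type_synonym ('m, 'b) chart = "'m set \<times> ('m \<Rightarrow> 'b)"

definition chart_img :: "('m, 'b) chart \<Rightarrow> 'b set" where
  "chart_img c = snd c ` fst c"

definition chart_inv :: "('m, 'b) chart \<Rightarrow> 'b \<Rightarrow> 'm" where
  "chart_inv c = inv_into (fst c) (snd c)"

definition smooth_manifold ::
  "('m::{t2_space, second_countable_topology}, 'b::euclidean_space) chart set \<Rightarrow> bool" where
  "smooth_manifold A \<longleftrightarrow>
     (\<forall>c\<in>A. open (fst c) \<and> open (chart_img c) \<and>
        homeomorphism (fst c) (chart_img c) (snd c) (chart_inv c)) \<and>
     (\<Union>c\<in>A. fst c) = UNIV \<and>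
     (\<forall>c\<in>A. \<forall>c'\<in>A. smooth_on (snd c ` (fst c \<inter> fst c')) (\<lambda>y. snd c' (chart_inv c y)))"

text \<open>
  The tangent space at \<open>p\<close> is identified with \<open>'b\<close> by means of one chart chosen once and for all at
  \<open>p\<close>. A tangent vector at \<open>p\<close> has coordinates \<open>tcoord A c p v\<close> in any other chart \<open>c\<close> around \<open>p\<close>, and
  \<open>tvec A c p\<close> is the inverse map, sending coordinates to tangent vectors.
\<close>

definition chart_at :: "('m, 'b) chart set \<Rightarrow> 'm \<Rightarrow> ('m, 'b) chart" where
  "chart_at A p = (SOME c. c \<in> A \<and> p \<in> fst c)"

definition tcoord ::
  "('m, 'b::euclidean_space) chart set \<Rightarrow> ('m, 'b) chart \<Rightarrow> 'm \<Rightarrow> 'b \<Rightarrow> 'b" where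
  "tcoord A c p v =
     frechet_derivative (\<lambda>y. snd c (chart_inv (chart_at A p) y)) (at (snd (chart_at A p) p)) v"

definition tvec ::
  "('m, 'b::euclidean_space) chart set \<Rightarrow> ('m, 'b) chart \<Rightarrow> 'm \<Rightarrow> 'b \<Rightarrow> 'b" where
  "tvec A c p u =
     frechet_derivative (\<lambda>y. snd (chart_at A p) (chart_inv c y)) (at (snd c p)) u"

text \<open>Maps from a normed space into \<open>M\<close>, and the differentials of such maps and of maps \<open>M \<rightarrow> M\<close>.\<close>

definition smooth_into ::
  "('m::topological_space, 'b::euclidean_space) chart set \<Rightarrow> 'a set \<Rightarrow>
     ('a::real_normed_vector \<Rightarrow> 'm) \<Rightarrow> bool" where
  "smooth_into A W f \<longleftrightarrow>
     continuous_on W f \<and> (\<forall>c\<in>A. smooth_on (W \<inter> f -` fst c) (\<lambda>y. snd c (f y)))"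

definition diff_into ::
  "('m, 'b::euclidean_space) chart set \<Rightarrow> ('a::real_normed_vector \<Rightarrow> 'm) \<Rightarrow> 'a \<Rightarrow> 'a \<Rightarrow> 'b" where
  "diff_into A f y u = frechet_derivative (\<lambda>z. snd (chart_at A (f y)) (f z)) (at y) u"

definition mdiff ::
  "('m, 'b::euclidean_space) chart set \<Rightarrow> ('m \<Rightarrow> 'm) \<Rightarrow> 'm \<Rightarrow> 'b \<Rightarrow> 'b" where
  "mdiff A f x v =
     frechet_derivative (\<lambda>y. snd (chart_at A (f x)) (f (chart_inv (chart_at A x) y)))
       (at (snd (chart_at A x) x)) v"

definition smooth_vector_field ::
  "('m, 'b::euclidean_space) chart set \<Rightarrow> 'm set \<Rightarrow> ('m \<Rightarrow> 'b) \<Rightarrow> bool" where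
  "smooth_vector_field A N X \<longleftrightarrow>
     (\<forall>c\<in>A. smooth_on (snd c ` (fst c \<inter> N)) (\<lambda>y. tcoord A c (chart_inv c y) (X (chart_inv c y))))"

text \<open>
  A local flow of \<open>X\<close>, defined for times \<open>\<bar>t\<bar> < \<epsilon>\<close> and starting points in \<open>N0\<close>, as a smooth local
  one-parameter group.
\<close>

definition local_flow ::
  "('m::topological_space, 'b::euclidean_space) chart set \<Rightarrow> 'm set \<Rightarrow> ('m \<Rightarrow> 'b) \<Rightarrow>
     'm set \<Rightarrow> real \<Rightarrow> (real \<Rightarrow> 'm \<Rightarrow> 'm) \<Rightarrow> bool" where
  "local_flow A N X N0 \<epsilon> F \<longleftrightarrow>
     0 < \<epsilon> \<and> open N0 \<and> N0 \<subseteq> N \<and>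
     (\<forall>c\<in>A. smooth_into A ({-\<epsilon><..<\<epsilon>} \<times> (snd c ` (fst c \<inter> N0))) (\<lambda>(t, y). F t (chart_inv c y))) \<and>
     (\<forall>x\<in>N0. F 0 x = x) \<and>
     (\<forall>x\<in>N0. \<forall>t\<in>{-\<epsilon><..<\<epsilon>}. F t x \<in> N \<and>
        ((\<lambda>s. snd (chart_at A (F t x)) (F s x)) has_vector_derivative X (F t x)) (at t)) \<and>
     (\<forall>x\<in>N0. \<forall>s t. \<bar>s\<bar> < \<epsilon> \<and> \<bar>t\<bar> < \<epsilon> \<and> \<bar>s + t\<bar> < \<epsilon> \<and> F s x \<in> N0 \<longrightarrow> F t (F s x) = F (s + t) x)"

subsection \<open>Metrics, forms, vector bundles\<close>

definition inner_product :: "('a::real_vector \<Rightarrow> 'a \<Rightarrow> real) \<Rightarrow> bool" where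
  "inner_product q \<longleftrightarrow> bilinear q \<and> (\<forall>u v. q u v = q v u) \<and> (\<forall>u. u \<noteq> 0 \<longrightarrow> 0 < q u u)"

definition riemannian_metric ::
  "('m, 'b::euclidean_space) chart set \<Rightarrow> ('m \<Rightarrow> 'b \<Rightarrow> 'b \<Rightarrow> real) \<Rightarrow> bool" where
  "riemannian_metric A g \<longleftrightarrow>
     (\<forall>p. inner_product (g p)) \<and>
     (\<forall>c\<in>A. \<forall>u v. smooth_on (chart_img c)
        (\<lambda>y. g (chart_inv c y) (tvec A c (chart_inv c y) u) (tvec A c (chart_inv c y) v)))"

text \<open>
  Alternating multilinear maps of \<open>k\<close> vectors. The tuple \<open>v\<close> represents the decomposable \<open>k\<close>-vector
  \<open>\<xi> = v\<^sub>1 \<and> \<dots> \<and> v\<^sub>k\<close>: every decomposable \<open>k\<close>-vector has this form, \<open>\<omega>(\<xi>) = \<omega> v\<close>, and the norm that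
  the metric induces on \<open>k\<close>-vectors satisfies \<open>\<bar>\<xi>\<bar>\<^sup>2 = det (g (v\<^sub>i, v\<^sub>j))\<close>.
\<close>

definition alternating_form :: "(('k::finite \<Rightarrow> 'b::real_vector) \<Rightarrow> 'z::real_vector) \<Rightarrow> bool" where
  "alternating_form \<omega> \<longleftrightarrow>
     (\<forall>v i. linear (\<lambda>u. \<omega> (v(i := u)))) \<and> (\<forall>v i j. i \<noteq> j \<and> v i = v j \<longrightarrow> \<omega> v = 0)"

definition kvec_norm :: "('b \<Rightarrow> 'b \<Rightarrow> real) \<Rightarrow> ('k::finite \<Rightarrow> 'b) \<Rightarrow> real" where
  "kvec_norm q v = sqrt (det (\<chi> i j. q (v i) (v j)))"

definition local_form ::
  "('m, 'b::euclidean_space) chart set \<Rightarrow> ('m, 'b) chart \<Rightarrow> ('m \<Rightarrow> ('k::finite \<Rightarrow> 'b) \<Rightarrow> 'z) \<Rightarrow>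
     'b \<Rightarrow> ('k \<Rightarrow> 'b) \<Rightarrow> 'z" where
  "local_form A c \<omega> y v = \<omega> (chart_inv c y) (\<lambda>i. tvec A c (chart_inv c y) (v i))"

definition smooth_form ::
  "('m, 'b::euclidean_space) chart set \<Rightarrow> ('m \<Rightarrow> ('k::finite \<Rightarrow> 'b) \<Rightarrow> real) \<Rightarrow> bool" where
  "smooth_form A \<omega> \<longleftrightarrow>
     (\<forall>p. alternating_form (\<omega> p)) \<and>
     (\<forall>c\<in>A. \<forall>v. smooth_on (chart_img c) (\<lambda>y. local_form A c \<omega> y v))"

text \<open>
  The coordinate expression of \<open>d\<omega>\<close> in the chart \<open>c\<close>, as a \<open>(k+1)\<close>-form with index type \<open>'k option\<close>.
  With \<open>None\<close> in position \<open>0\<close>, the usual formula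
  \<open>d\<omega>(v\<^sub>0, \<dots>, v\<^sub>k) = \<Sum>\<^sub>i (-1)^i D\<omega>(v\<^sub>i)(v\<^sub>0, \<dots>, omit v\<^sub>i, \<dots>, v\<^sub>k)\<close> takes the form below once \<open>v\<^sub>0\<close> is moved to the
  free position \<open>i\<close>, which costs the sign \<open>(-1)^(i-1)\<close>; no ordering of \<open>'k\<close> is then needed.
\<close>

definition ext_deriv ::
  "('m, 'b::euclidean_space) chart set \<Rightarrow> ('m, 'b) chart \<Rightarrow> ('m \<Rightarrow> ('k::finite \<Rightarrow> 'b) \<Rightarrow> real) \<Rightarrow>
     'b \<Rightarrow> ('k option \<Rightarrow> 'b) \<Rightarrow> real" where
  "ext_deriv A c \<omega> y v =
     frechet_derivative (\<lambda>z. local_form A c \<omega> z (\<lambda>j. v (Some j))) (at y) (v None) -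
     (\<Sum>i\<in>UNIV. frechet_derivative
        (\<lambda>z. local_form A c \<omega> z ((\<lambda>j. v (Some j))(i := v None))) (at y) (v (Some i)))"

definition closed_form ::
  "('m, 'b::euclidean_space) chart set \<Rightarrow> ('m \<Rightarrow> ('k::finite \<Rightarrow> 'b) \<Rightarrow> real) \<Rightarrow> bool" where
  "closed_form A \<omega> \<longleftrightarrow> (\<forall>c\<in>A. \<forall>y\<in>chart_img c. \<forall>v. ext_deriv A c \<omega> y v = 0)"

definition calibration ::
  "('m, 'b::euclidean_space) chart set \<Rightarrow> ('m \<Rightarrow> 'b \<Rightarrow> 'b \<Rightarrow> real) \<Rightarrow>
     ('m \<Rightarrow> ('k::finite \<Rightarrow> 'b) \<Rightarrow> real) \<Rightarrow> bool" where
  "calibration A g \<phi> \<longleftrightarrow>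
     smooth_form A \<phi> \<and> closed_form A \<phi> \<and> (\<forall>x v. \<phi> x v \<le> kvec_norm (g x) v)"

text \<open>
  A vector bundle over \<open>M\<close> is given by its set \<open>T\<close> of local trivializations \<open>(U, \<tau>)\<close>: the underlying
  set of the total space is \<open>M \<times> 'e\<close>, and \<open>\<tau> p\<close> is a linear isomorphism from the fibre \<open>E\<^sub>p\<close> to the
  model fibre. Topology and smooth structure come from \<open>T\<close> alone, so the bundle need not be trivial.
\<close>

type_synonym ('m, 'e) trivialization = "'m set \<times> ('m \<Rightarrow> 'e \<Rightarrow> 'e)"

definition vector_bundle ::
  "('m::topological_space, 'b::euclidean_space) chart set \<Rightarrow>
     ('m, 'e::euclidean_space) trivialization set \<Rightarrow> bool" where
  "vector_bundle A T \<longleftrightarrow>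
     (\<forall>\<tau>\<in>T. open (fst \<tau>) \<and> (\<forall>p\<in>fst \<tau>. linear (snd \<tau> p) \<and> bij (snd \<tau> p))) \<and>
     (\<Union>\<tau>\<in>T. fst \<tau>) = UNIV \<and>
     (\<forall>\<tau>\<in>T. \<forall>\<tau>'\<in>T. \<forall>c\<in>A. \<forall>w. smooth_on (snd c ` (fst c \<inter> fst \<tau> \<inter> fst \<tau>'))
        (\<lambda>y. snd \<tau>' (chart_inv c y) (inv (snd \<tau> (chart_inv c y)) w)))"

definition bundle_metric ::
  "('m, 'b::euclidean_space) chart set \<Rightarrow> ('m, 'e::euclidean_space) trivialization set \<Rightarrow>
     ('m \<Rightarrow> 'e \<Rightarrow> 'e \<Rightarrow> real) \<Rightarrow> bool" where
  "bundle_metric A T h \<longleftrightarrow>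
     (\<forall>p. inner_product (h p)) \<and>
     (\<forall>\<tau>\<in>T. \<forall>c\<in>A. \<forall>w w'. smooth_on (snd c ` (fst c \<inter> fst \<tau>))
        (\<lambda>y. h (chart_inv c y) (inv (snd \<tau> (chart_inv c y)) w) (inv (snd \<tau> (chart_inv c y)) w')))"

definition smooth_bundle_form ::
  "('m, 'b::euclidean_space) chart set \<Rightarrow> ('m, 'e::euclidean_space) trivialization set \<Rightarrow>
     ('m \<Rightarrow> ('k::finite \<Rightarrow> 'b) \<Rightarrow> 'e) \<Rightarrow> bool" where
  "smooth_bundle_form A T \<Psi> \<longleftrightarrow>
     (\<forall>p. alternating_form (\<Psi> p)) \<and>
     (\<forall>\<tau>\<in>T. \<forall>c\<in>A. \<forall>v. smooth_on (snd c ` (fst c \<inter> fst \<tau>))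
        (\<lambda>y. snd \<tau> (chart_inv c y) (local_form A c \<Psi> y v)))"

definition harvey_lawson_identity ::
  "('m \<Rightarrow> 'b \<Rightarrow> 'b \<Rightarrow> real) \<Rightarrow> ('m \<Rightarrow> 'e \<Rightarrow> 'e \<Rightarrow> real) \<Rightarrow>
     ('m \<Rightarrow> ('k::finite \<Rightarrow> 'b) \<Rightarrow> real) \<Rightarrow> ('m \<Rightarrow> ('k \<Rightarrow> 'b) \<Rightarrow> 'e) \<Rightarrow> bool" where
  "harvey_lawson_identity g h \<phi> \<Psi> \<longleftrightarrow>
     (\<forall>x v. (\<phi> x v)\<^sup>2 + h x (\<Psi> x v) (\<Psi> x v) = (kvec_norm (g x) v)\<^sup>2)"

text \<open>
  Sections of \<open>E\<close> along a curve \<open>\<gamma>\<close> defined on an open interval \<open>I\<close>, i.e. sections of the pull-back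
  bundle, so that \<open>s t\<close> lies in the fibre at \<open>\<gamma> t\<close>; and covariant derivatives acting on them.
\<close>

definition smooth_section_along ::
  "('m, 'e::euclidean_space) trivialization set \<Rightarrow> real set \<Rightarrow> (real \<Rightarrow> 'm) \<Rightarrow>
     (real \<Rightarrow> 'e) \<Rightarrow> bool" where
  "smooth_section_along T I \<gamma> s \<longleftrightarrow>
     (\<forall>\<tau>\<in>T. smooth_on (I \<inter> \<gamma> -` fst \<tau>) (\<lambda>t. snd \<tau> (\<gamma> t) (s t)))"

definition covariant_derivative_along ::
  "('m, 'e::euclidean_space) trivialization set \<Rightarrow> real set \<Rightarrow> (real \<Rightarrow> 'm) \<Rightarrow>
     ((real \<Rightarrow> 'e) \<Rightarrow> real \<Rightarrow> 'e) \<Rightarrow> bool" where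
  "covariant_derivative_along T I \<gamma> D \<longleftrightarrow>
     (\<forall>s. smooth_section_along T I \<gamma> s \<longrightarrow> smooth_section_along T I \<gamma> (D s)) \<and>
     (\<forall>s s'. smooth_section_along T I \<gamma> s \<longrightarrow> smooth_section_along T I \<gamma> s' \<longrightarrow>
        (\<forall>t\<in>I. D (\<lambda>r. s r + s' r) t = D s t + D s' t)) \<and>
     (\<forall>f s. smooth_on I f \<longrightarrow> smooth_section_along T I \<gamma> s \<longrightarrow>
        (\<forall>t\<in>I. D (\<lambda>r. f r *\<^sub>R s r) t = deriv f t *\<^sub>R s t + f t *\<^sub>R D s t))"

definition preserves_metric_along ::
  "('m, 'e::euclidean_space) trivialization set \<Rightarrow> ('m \<Rightarrow> 'e \<Rightarrow> 'e \<Rightarrow> real) \<Rightarrow> real set \<Rightarrow>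
     (real \<Rightarrow> 'm) \<Rightarrow> ((real \<Rightarrow> 'e) \<Rightarrow> real \<Rightarrow> 'e) \<Rightarrow> bool" where
  "preserves_metric_along T h I \<gamma> D \<longleftrightarrow>
     (\<forall>s s'. smooth_section_along T I \<gamma> s \<longrightarrow> smooth_section_along T I \<gamma> s' \<longrightarrow>
        (\<forall>t\<in>I. ((\<lambda>r. h (\<gamma> r) (s r) (s' r)) has_real_derivative
           h (\<gamma> t) (D s t) (s' t) + h (\<gamma> t) (s t) (D s' t)) (at t)))"

subsection \<open>Submanifolds and their volume\<close>

text \<open>
  Embedded submanifolds of dimension \<open>CARD('k)\<close>, described by their local parametrizations. Notions
  whose type does not mention \<open>'k\<close> take the dimension as an argument of type \<open>'k itself\<close>.
\<close>

definition local_param ::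
  "('m::topological_space, 'b::euclidean_space) chart set \<Rightarrow> 'm set \<Rightarrow> (real^'k) set \<Rightarrow>
     (real^'k \<Rightarrow> 'm) \<Rightarrow> bool" where
  "local_param A L W f \<longleftrightarrow>
     open W \<and> smooth_into A W f \<and> (\<forall>y\<in>W. inj (diff_into A f y)) \<and>
     homeomorphism W (f ` W) f (inv_into W f) \<and> openin (top_of_set L) (f ` W)"

definition submanifold ::
  "'k::finite itself \<Rightarrow> ('m::topological_space, 'b::euclidean_space) chart set \<Rightarrow> 'm set \<Rightarrow> bool" where
  "submanifold _ A L \<longleftrightarrow>
     (\<forall>p\<in>L. \<exists>W (f :: real^'k \<Rightarrow> 'm). local_param A L W f \<and> p \<in> f ` W)"

definition coord_frame ::
  "('m, 'b::euclidean_space) chart set \<Rightarrow> (real^'k \<Rightarrow> 'm) \<Rightarrow> real^'k \<Rightarrow> 'k::finite \<Rightarrow> 'b" where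
  "coord_frame A f y i = diff_into A f y (axis i 1)"

definition tangent_space ::
  "'k::finite itself \<Rightarrow> ('m::topological_space, 'b::euclidean_space) chart set \<Rightarrow> 'm set \<Rightarrow>
     'm \<Rightarrow> 'b set" where
  "tangent_space _ A L x =
     {w. \<exists>W (f :: real^'k \<Rightarrow> 'm) y u. local_param A L W f \<and> y \<in> W \<and> f y = x \<and> w = diff_into A f y u}"

text \<open>
  An orientation of \<open>L\<close> assigns to \<open>x \<in> L\<close> the set \<open>Or x\<close> of positively oriented bases of \<open>T\<^sub>xL\<close>; near
  each point it is the class of the coordinate frames of some local parametrization.
\<close>

definition orientation ::
  "('m::topological_space, 'b::euclidean_space) chart set \<Rightarrow> 'm set \<Rightarrow>
     ('m \<Rightarrow> ('k::finite \<Rightarrow> 'b) set) \<Rightarrow> bool" where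
  "orientation A L Or \<longleftrightarrow>
     (\<forall>p\<in>L. \<exists>W (f :: real^'k \<Rightarrow> 'm). local_param A L W f \<and> p \<in> f ` W \<and>
        (\<forall>y\<in>W. Or (f y) =
           {e. \<exists>B :: real^'k^'k. 0 < det B \<and> e = (\<lambda>i. \<Sum>j\<in>UNIV. B $ i $ j *\<^sub>R coord_frame A f y j)}))"

definition compact_oriented_submanifold ::
  "('m::topological_space, 'b::euclidean_space) chart set \<Rightarrow> 'm set \<Rightarrow>
     ('m \<Rightarrow> ('k::finite \<Rightarrow> 'b) set) \<Rightarrow> bool" where
  "compact_oriented_submanifold A L Or \<longleftrightarrow>
     compact L \<and> submanifold TYPE('k) A L \<and> orientation A L Or"

text \<open>
  The Riemannian volume form of an oriented submanifold, on tuples of vectors of \<open>T\<^sub>xL\<close>. Linearly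
  dependent tuples are not in \<open>Or x\<close> and have Gram determinant \<open>0\<close>, hence fall correctly into the
  second case.
\<close>

definition volume_form ::
  "('m \<Rightarrow> 'b \<Rightarrow> 'b \<Rightarrow> real) \<Rightarrow> ('m \<Rightarrow> ('k::finite \<Rightarrow> 'b) set) \<Rightarrow> 'm \<Rightarrow> ('k \<Rightarrow> 'b) \<Rightarrow> real" where
  "volume_form g Or x v = (if v \<in> Or x then kvec_norm (g x) v else - kvec_norm (g x) v)"

definition calibrated ::
  "('m::topological_space, 'b::euclidean_space) chart set \<Rightarrow> ('m \<Rightarrow> 'b \<Rightarrow> 'b \<Rightarrow> real) \<Rightarrow>
     ('m \<Rightarrow> ('k::finite \<Rightarrow> 'b) \<Rightarrow> real) \<Rightarrow> 'm set \<Rightarrow> ('m \<Rightarrow> ('k \<Rightarrow> 'b) set) \<Rightarrow> bool" where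
  "calibrated A g \<phi> L Or \<longleftrightarrow>
     (\<forall>x\<in>L. \<forall>v. (\<forall>i. v i \<in> tangent_space TYPE('k) A L x) \<longrightarrow> \<phi> x v = volume_form g Or x v)"

text \<open>The tuple \<open>e\<close> represents the unit \<open>k\<close>-vector \<open>\<xi>(x) = e\<^sub>1 \<and> \<dots> \<and> e\<^sub>k\<close> of the oriented space \<open>T\<^sub>xL\<close>.\<close>

definition unit_kvector ::
  "('m \<Rightarrow> 'b \<Rightarrow> 'b \<Rightarrow> real) \<Rightarrow> ('m \<Rightarrow> ('k::finite \<Rightarrow> 'b) set) \<Rightarrow> 'm \<Rightarrow> ('k \<Rightarrow> 'b) \<Rightarrow> bool" where
  "unit_kvector g Or x e \<longleftrightarrow> e \<in> Or x \<and> (\<forall>i j. g x (e i) (e j) = (if i = j then 1 else 0))"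

definition normal_vector_field ::
  "'k::finite itself \<Rightarrow> ('m::topological_space, 'b::euclidean_space) chart set \<Rightarrow>
     ('m \<Rightarrow> 'b \<Rightarrow> 'b \<Rightarrow> real) \<Rightarrow> 'm set \<Rightarrow> ('m \<Rightarrow> 'b) \<Rightarrow> bool" where
  "normal_vector_field _ A g L V \<longleftrightarrow>
     (\<forall>x\<in>L. \<forall>w\<in>tangent_space TYPE('k) A L x. g x (V x) w = 0) \<and>
     (\<forall>W (f :: real^'k \<Rightarrow> 'm). local_param A L W f \<longrightarrow>
        (\<forall>c\<in>A. smooth_on (W \<inter> f -` fst c) (\<lambda>y. tcoord A c (f y) (V (f y)))))"

text \<open>
  The Riemannian volume measure of \<open>L\<close>, as a Borel measure on \<open>M\<close> concentrated on \<open>L\<close>. It is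
  determined by its values inside the images of local parametrizations, where it has density
  \<open>sqrt (det g\<^sub>i\<^sub>j)\<close>, because countably many such images cover \<open>L\<close>.
\<close>

definition is_riemannian_volume ::
  "'k::finite itself \<Rightarrow> ('m::topological_space, 'b::euclidean_space) chart set \<Rightarrow>
     ('m \<Rightarrow> 'b \<Rightarrow> 'b \<Rightarrow> real) \<Rightarrow> 'm set \<Rightarrow> 'm measure \<Rightarrow> bool" where
  "is_riemannian_volume _ A g L \<mu> \<longleftrightarrow>
     sets \<mu> = sets borel \<and> emeasure \<mu> (- L) = 0 \<and>
     (\<forall>W (f :: real^'k \<Rightarrow> 'm) B. local_param A L W f \<longrightarrow> B \<in> sets borel \<longrightarrow> B \<subseteq> f ` W \<longrightarrow>
        emeasure \<mu> B =
          (\<integral>\<^sup>+ y. ennreal (kvec_norm (g (f y)) (coord_frame A f y)) * indicator (W \<inter> f -` B) y \<partial>lborel))"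

definition riemannian_volume ::
  "'k::finite itself \<Rightarrow> ('m::topological_space, 'b::euclidean_space) chart set \<Rightarrow>
     ('m \<Rightarrow> 'b \<Rightarrow> 'b \<Rightarrow> real) \<Rightarrow> 'm set \<Rightarrow> 'm measure" where
  "riemannian_volume k A g L = (SOME \<mu>. is_riemannian_volume k A g L \<mu>)"

definition submanifold_volume ::
  "'k::finite itself \<Rightarrow> ('m::topological_space, 'b::euclidean_space) chart set \<Rightarrow>
     ('m \<Rightarrow> 'b \<Rightarrow> 'b \<Rightarrow> real) \<Rightarrow> 'm set \<Rightarrow> real" where
  "submanifold_volume k A g L = measure (riemannian_volume k A g L) L"

definition has_second_derivative :: "(real \<Rightarrow> real) \<Rightarrow> real \<Rightarrow> real \<Rightarrow> bool" where
  "has_second_derivative f D t \<longleftrightarrow>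
     (\<exists>f'. (\<forall>\<^sub>F s in nhds t. (f has_real_derivative f' s) (at s)) \<and> (f' has_real_derivative D) (at t))"

end

theory Submission
  imports Defs
begin

text \<open>
  On \<open>L\<close> put \<open>J\<^sub>t = \<bar>(F\<^sub>t)\<^sub>* \<xi>\<bar>\<close> and \<open>P\<^sub>t = \<phi>((F\<^sub>t)\<^sub>* \<xi>)\<close>, so that \<open>vol(L\<^sub>t)\<close> is the integral of \<open>J\<^sub>t\<close> over \<open>L\<close>.
  Harvey-Lawson's identity reads \<open>J\<^sub>t\<^sup>2 = P\<^sub>t\<^sup>2 + \<bar>\<Psi>((F\<^sub>t)\<^sub>* \<xi>)\<bar>\<^sup>2\<close>. At \<open>t = 0\<close> the calibration condition gives
  \<open>J = P = 1\<close> and \<open>\<Psi> = 0\<close>, and differentiating twice yields \<open>J'' = P'' + \<bar>\<nabla>\<Psi>\<bar>\<^sup>2\<close>, because \<open>\<nabla>\<close> preserves the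
  metric. The integral of \<open>P\<^sub>t\<close> over \<open>L\<close> does not depend on \<open>t\<close>, since \<open>\<phi>\<close> is closed: in coordinates the
  time derivative of \<open>F\<^sub>t\<^sup>*\<phi>\<close> is the divergence of a contraction with the generator \<open>X\<close> of the flow, and
  a partition of unity reduces the claim to the divergence theorem for compactly supported fields.
\<close>

section \<open>Calculus of smooth functions\<close>

text \<open>The frame \<open>\<xi>\<close> is chosen point by point and \<open>nabla x\<close> is
  given separately for each \<open>x\<close>; no regularity along \<open>L\<close> is stated for
  either. Whatever must be continuous or differentiable in \<open>x\<close> is therefore computed in
  coordinate frames of oriented parametrizations. Passing from \<open>\<xi>\<close> to such a frame
  multiplies alternating forms and Gram norms by the volume density, so \<open>J\<close> and
  \<open>P\<close> become quotients of smooth functions of time and parameter. Integrability of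
  \<open>h x (\<sigma> x) (\<sigma> x)\<close> is read off from its pointwise expression as
  \<open>J'' - P''\<close>. The square root in \<open>J\<close> is smooth only where the Gram
  determinant is positive. Since \<open>J = 1\<close> at time \<open>0\<close>, compactness of
  \<open>L\<close> yields one interval of times on which \<open>J\<close> is positive everywhere.
  The Riemannian volume is specified by its values in parametrizations and selected by
  \<open>SOME\<close>, so its existence has to be proved; this rests on change of variables. The
  cut-off functions are differentiated only once, so C1 bump functions suffice.\<close>

lemma frechet_derivative_eqI:
  "(f has_derivative D) (at x) \<Longrightarrow> frechet_derivative f (at x) = D"
  using frechet_derivative_at by metis

lemma Ck_on_subset: "Ck_on n S f \<Longrightarrow> U \<subseteq> S \<Longrightarrow> Ck_on n U f"
  by (induction n arbitrary: f) (auto intro: continuous_on_subset)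

text \<open>Derivatives are taken in the whole space and not within \<open>S\<close>, so every
  clause of \<open>Ck_on\<close> is decided near single points, and \<open>S\<close> may be any
  set.\<close>

lemma Ck_on_local:
  "(\<And>x. x \<in> S \<Longrightarrow> \<exists>U. open U \<and> x \<in> U \<and> Ck_on n U f) \<Longrightarrow> Ck_on n S f"
proof (induction n arbitrary: f)
  case 0
  have "isCont f x" if "x \<in> S" for x
    using 0[OF that] by (auto simp: continuous_on_eq_continuous_at)
  then show ?case by (simp add: continuous_at_imp_continuous_on)
next
  case (Suc n)
  show ?case
  proof (simp, intro conjI ballI allI)
    fix x assume "x \<in> S"
    with Suc.prems show "f differentiable at x" by fastforce
  next
    fix v show "Ck_on n S (\<lambda>x. frechet_derivative f (at x) v)"
      by (rule Suc.IH) (use Suc.prems in fastforce)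
  qed
qed

lemma Ck_on_cong:
  assumes "open S" "Ck_on n S f" "\<And>x. x \<in> S \<Longrightarrow> f x = g x"
  shows "Ck_on n S g"
  using assms
proof (induction n arbitrary: f g)
  case 0
  then show ?case by (simp cong: continuous_on_cong)
next
  case (Suc n)
  have eq: "frechet_derivative f (at x) = frechet_derivative g (at x)" if "x \<in> S" for x
    using Suc.prems that by (intro frechet_derivative_transform_within_open[of f x S]) auto
  show ?case
  proof (simp, intro conjI ballI allI)
    fix x assume "x \<in> S"
    with Suc.prems show "g differentiable at x"
      using \<open>x \<in> S\<close> unfolding differentiable_def
      by simp (metis differentiable_def has_derivative_transform_within_open)
  next
    fix v show "Ck_on n S (\<lambda>x. frechet_derivative g (at x) v)"
      by (rule Suc.IH[of "\<lambda>x. frechet_derivative f (at x) v"]) (use Suc.prems eq in auto)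
  qed
qed

lemma Ck_on_SucD: "Ck_on (Suc n) S f \<Longrightarrow> Ck_on n S f"
proof (induction n arbitrary: f)
  case 0
  then show ?case
    by (auto simp: continuous_on_eq_continuous_within differentiable_imp_continuous_within
        continuous_at_imp_continuous_at_within)
next
  case (Suc n)
  from Suc.prems have d: "\<forall>x\<in>S. f differentiable at x"
    and "\<And>v. Ck_on (Suc n) S (\<lambda>x. frechet_derivative f (at x) v)" by auto
  then have "\<And>v. Ck_on n S (\<lambda>x. frechet_derivative f (at x) v)" using Suc.IH by blast
  with d show ?case by simp
qed

lemma Ck_on_mono: "m \<le> n \<Longrightarrow> Ck_on n S f \<Longrightarrow> Ck_on m S f"
  by (induction n) (auto simp: le_Suc_eq simp del: Ck_on.simps dest: Ck_on_SucD)

text \<open>The recursion in \<open>Ck_on\<close> runs through \<open>frechet_derivative\<close>,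
  which agrees with a formula \<open>D\<close> only at points of \<open>S\<close>; openness of
  \<open>S\<close> makes this agreement sufficient for all higher orders.\<close>

lemma Ck_on_SucI:
  assumes "open S" "\<And>x. x \<in> S \<Longrightarrow> (f has_derivative D x) (at x)"
    "\<And>v. Ck_on n S (\<lambda>x. D x v)"
  shows "Ck_on (Suc n) S f"
proof (simp, intro conjI ballI allI)
  fix x assume "x \<in> S" with assms show "f differentiable at x" by (auto simp: differentiable_def)
next
  fix v show "Ck_on n S (\<lambda>x. frechet_derivative f (at x) v)"
    by (rule Ck_on_cong[OF assms(1) assms(3)[of v]]) (simp add: frechet_derivative_eqI[OF assms(2)])
qed

lemma Ck_on_SucE:
  assumes "Ck_on (Suc n) S f"
  obtains "\<And>x. x \<in> S \<Longrightarrow> (f has_derivative frechet_derivative f (at x)) (at x)"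
    "\<And>v. Ck_on n S (\<lambda>x. frechet_derivative f (at x) v)"
  using assms by (simp add: frechet_derivative_works)

lemma Ck_on_const: "Ck_on n S (\<lambda>x. c)"
  by (induction n arbitrary: c) simp_all

lemma Ck_on_bounded_linear_comp:
  assumes "bounded_linear L" "open S" "Ck_on n S f"
  shows "Ck_on n S (\<lambda>x. L (f x))"
  using assms(3)
proof (induction n arbitrary: f)
  case 0
  then show ?case
    using assms(1) by (auto intro: bounded_linear.continuous_on)
next
  case (Suc n)
  show ?case
  proof (rule Ck_on_SucE[OF Suc.prems], rule Ck_on_SucI[OF assms(2)])
    fix x assume 1: "\<And>x. x \<in> S \<Longrightarrow> (f has_derivative frechet_derivative f (at x)) (at x)" "x \<in> S"
    show "((\<lambda>x. L (f x)) has_derivative (\<lambda>v. L (frechet_derivative f (at x) v))) (at x)"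
      by (rule bounded_linear.has_derivative[OF assms(1) 1(1)[OF 1(2)]])
  qed (rule Suc.IH)
qed

lemma Ck_on_ident: "open S \<Longrightarrow> Ck_on n S (\<lambda>x. x)"
  by (cases n) (auto intro!: Ck_on_SucI[where D = "\<lambda>x v. v"] Ck_on_const)

lemma Ck_on_bounded_linear: "bounded_linear L \<Longrightarrow> open S \<Longrightarrow> Ck_on n S L"
  using Ck_on_bounded_linear_comp[OF _ _ Ck_on_ident] by auto

lemma Ck_on_add:
  assumes "open S" "Ck_on n S f" "Ck_on n S g"
  shows "Ck_on n S (\<lambda>x. f x + g x)"
  using assms(2,3)
proof (induction n arbitrary: f g)
  case 0
  then show ?case by (auto intro: continuous_intros)
next
  case (Suc n)
  show ?case
    by (rule Ck_on_SucE[OF Suc.prems(1)], rule Ck_on_SucE[OF Suc.prems(2)],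
        rule Ck_on_SucI[OF assms(1), where D = "\<lambda>x v. frechet_derivative f (at x) v + frechet_derivative g (at x) v"])
      (auto intro: has_derivative_add Suc.IH)
qed

lemma (in bounded_bilinear) Ck_on:
  assumes "open S" "Ck_on n S f" "Ck_on n S g"
  shows "Ck_on n S (\<lambda>x. prod (f x) (g x))"
  using assms(2,3)
proof (induction n arbitrary: f g)
  case 0
  then show ?case by (auto intro: continuous_on)
next
  case (Suc n)
  have fg: "Ck_on n S f" "Ck_on n S g" using Suc.prems Ck_on_SucD by auto
  show ?case
    by (rule Ck_on_SucE[OF Suc.prems(1)], rule Ck_on_SucE[OF Suc.prems(2)],
        rule Ck_on_SucI[OF assms(1), where D = "\<lambda>x v. prod (f x) (frechet_derivative g (at x) v)
             + prod (frechet_derivative f (at x) v) (g x)"])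
      (auto intro!: FDERIV Suc.IH Ck_on_add assms(1) fg)
qed

lemma Ck_on_sum:
  "open S \<Longrightarrow> (\<And>i. i \<in> I \<Longrightarrow> Ck_on n S (f i)) \<Longrightarrow> Ck_on n S (\<lambda>x. \<Sum>i\<in>I. f i x)"
  by (induction I rule: infinite_finite_induct) (auto intro: Ck_on_const Ck_on_add)

lemma Ck_on_prod:
  fixes f :: "'i \<Rightarrow> 'a::real_normed_vector \<Rightarrow> real"
  shows "open S \<Longrightarrow> (\<And>i. i \<in> I \<Longrightarrow> Ck_on n S (f i)) \<Longrightarrow> Ck_on n S (\<lambda>x. \<Prod>i\<in>I. f i x)"
  by (induction I rule: infinite_finite_induct)
    (auto intro: Ck_on_const bounded_bilinear.Ck_on[OF bounded_bilinear_mult])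

lemma Ck_on_Pair:
  assumes "open S" "Ck_on n S f" "Ck_on n S g"
  shows "Ck_on n S (\<lambda>x. (f x, g x))"
proof -
  have "Ck_on n S (\<lambda>x. (f x, 0) + (0, g x))"
    by (intro Ck_on_add assms Ck_on_bounded_linear_comp[where L = "\<lambda>u. (u, 0)"]
        Ck_on_bounded_linear_comp[where L = "\<lambda>u. (0, u)"])
      (auto intro: bounded_linear_Pair bounded_linear_ident bounded_linear_zero)
  then show ?thesis by simp
qed

lemma linear_expand:
  fixes L :: "'b::euclidean_space \<Rightarrow> 'c::real_vector"
  assumes "linear L"
  shows "L u = (\<Sum>b\<in>Basis. (u \<bullet> b) *\<^sub>R L b)"
  by (subst euclidean_representation[of u, symmetric])
    (simp add: linear_sum[OF assms] linear_cmul[OF assms])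

text \<open>The chain rule evaluates the derivative of \<open>g\<close> in a direction that moves
  with \<open>x\<close>, while the induction hypothesis speaks of fixed directions. Expanding the
  direction in the finite \<open>Basis\<close> separates the two; hence the Euclidean middle
  space.\<close>

lemma Ck_on_compose:
  fixes f :: "'a::real_normed_vector \<Rightarrow> 'b::euclidean_space"
  assumes "open S" "open U" "f ` S \<subseteq> U" "Ck_on n S f" "Ck_on n U g"
  shows "Ck_on n S (\<lambda>x. g (f x))"
  using assms(4,5)
proof (induction n arbitrary: g)
  case 0
  then show ?case using assms(3) by (auto intro: continuous_on_compose2)
next
  case (Suc n)
  have f: "Ck_on n S f" using Suc.prems Ck_on_SucD by auto
  show ?case
  proof (rule Ck_on_SucE[OF Suc.prems(1)], rule Ck_on_SucE[OF Suc.prems(2)],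
      rule Ck_on_SucI[OF assms(1), where D = "\<lambda>x v. \<Sum>b\<in>Basis. (frechet_derivative f (at x) v \<bullet> b) *\<^sub>R
             frechet_derivative g (at (f x)) b"])
    fix x assume *: "\<And>x. x \<in> S \<Longrightarrow> (f has_derivative frechet_derivative f (at x)) (at x)"
      "\<And>x. x \<in> U \<Longrightarrow> (g has_derivative frechet_derivative g (at x)) (at x)" "x \<in> S"
    have "((\<lambda>x. g (f x)) has_derivative (\<lambda>v. frechet_derivative g (at (f x)) (frechet_derivative f (at x) v))) (at x)"
      by (rule has_derivative_compose) (use * assms(3) in auto)
    moreover have "linear (frechet_derivative g (at (f x)))"
      using * assms(3) by (intro has_derivative_linear) auto
    ultimately show "((\<lambda>x. g (f x)) has_derivative (\<lambda>v. \<Sum>b\<in>Basis. (frechet_derivative f (at x) v \<bullet> b) *\<^sub>R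
             frechet_derivative g (at (f x)) b)) (at x)"
      by (rule has_derivative_eq_rhs[OF _ ext[OF linear_expand]])
  next
    fix v assume *: "\<And>v. Ck_on n S (\<lambda>x. frechet_derivative f (at x) v)"
      "\<And>v. Ck_on n U (\<lambda>x. frechet_derivative g (at x) v)"
    have "Ck_on n S (\<lambda>x. frechet_derivative g (at (f x)) b)" for b
      by (rule Suc.IH[OF f *(2)])
    moreover have "Ck_on n S (\<lambda>x. frechet_derivative f (at x) v \<bullet> b)" for b
      by (rule Ck_on_bounded_linear_comp[OF bounded_linear_inner_left assms(1) *(1)])
    ultimately show "Ck_on n S (\<lambda>x. \<Sum>b\<in>Basis. (frechet_derivative f (at x) v \<bullet> b) *\<^sub>R frechet_derivative g (at (f x)) b)"
      by (intro Ck_on_sum assms(1) bounded_bilinear.Ck_on[OF bounded_bilinear_scaleR]) auto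
  qed
qed

text \<open>The derivative is a product of \<open>inverse (f x)\<close>, the derivative of
  \<open>f\<close> and \<open>inverse (f x)\<close> again, so the induction hypothesis for the
  function itself handles its derivative. The square root below follows the same pattern.\<close>

lemma Ck_on_inverse:
  fixes f :: "'a::real_normed_vector \<Rightarrow> real"
  assumes "open S" "Ck_on n S f" "\<And>x. x \<in> S \<Longrightarrow> f x \<noteq> 0"
  shows "Ck_on n S (\<lambda>x. inverse (f x))"
  using assms(2)
proof (induction n)
  case 0
  then show ?case using assms(3) by (auto intro!: continuous_on_inverse)
next
  case (Suc n)
  have f: "Ck_on n S f" using Suc.prems Ck_on_SucD by auto
  show ?case
  proof (rule Ck_on_SucE[OF Suc.prems(1)], rule Ck_on_SucI[OF assms(1)])
    fix x assume *: "\<And>x. x \<in> S \<Longrightarrow> (f has_derivative frechet_derivative f (at x)) (at x)" "x \<in> S"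
    show "((\<lambda>x. inverse (f x)) has_derivative (\<lambda>v. - 1 * (inverse (f x) * frechet_derivative f (at x) v * inverse (f x)))) (at x)"
      using Deriv.has_derivative_inverse[OF assms(3) *(1)] *(2) by simp
  next
    fix v assume *: "\<And>v. Ck_on n S (\<lambda>x. frechet_derivative f (at x) v)"
    show "Ck_on n S (\<lambda>x. - 1 * (inverse (f x) * frechet_derivative f (at x) v * inverse (f x)))"
      by (intro bounded_bilinear.Ck_on[OF bounded_bilinear_mult] assms(1) Suc.IH f Ck_on_const *)
  qed
qed

lemma Ck_on_sqrt:
  fixes f :: "'a::real_normed_vector \<Rightarrow> real"
  assumes "open S" "Ck_on n S f" "\<And>x. x \<in> S \<Longrightarrow> f x > 0"
  shows "Ck_on n S (\<lambda>x. sqrt (f x))"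
  using assms(2)
proof (induction n)
  case 0
  then show ?case by (auto intro!: continuous_on_real_sqrt)
next
  case (Suc n)
  have f: "Ck_on n S f" using Suc.prems Ck_on_SucD by auto
  show ?case
  proof (rule Ck_on_SucE[OF Suc.prems(1)], rule Ck_on_SucI[OF assms(1)])
    fix x assume *: "\<And>x. x \<in> S \<Longrightarrow> (f has_derivative frechet_derivative f (at x)) (at x)" "x \<in> S"
    show "((\<lambda>x. sqrt (f x)) has_derivative (\<lambda>v. (1/2) * (frechet_derivative f (at x) v * inverse (sqrt (f x))))) (at x)"
      using has_derivative_real_sqrt[OF assms(3) *(1)] *(2) by (simp add: field_simps)
  next
    fix v assume *: "\<And>v. Ck_on n S (\<lambda>x. frechet_derivative f (at x) v)"
    have "sqrt (f x) \<noteq> 0" if "x \<in> S" for x using assms(3)[OF that] by simp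
    then show "Ck_on n S (\<lambda>x. (1/2) * (frechet_derivative f (at x) v * inverse (sqrt (f x))))"
      by (intro bounded_bilinear.Ck_on[OF bounded_bilinear_mult] assms(1) Ck_on_inverse Suc.IH f Ck_on_const *)
  qed
qed

section \<open>Closure properties of smooth functions\<close>

lemmas smooth_onI = smooth_on_def[THEN iffD2, rule_format]
lemmas smooth_onD = smooth_on_def[THEN iffD1, rule_format]

lemma smooth_on_subset: "smooth_on S f \<Longrightarrow> U \<subseteq> S \<Longrightarrow> smooth_on U f"
  by (auto simp: smooth_on_def intro: Ck_on_subset)

lemma smooth_on_local:
  "(\<And>x. x \<in> S \<Longrightarrow> \<exists>U. open U \<and> x \<in> U \<and> smooth_on U f) \<Longrightarrow> smooth_on S f"
  by (rule smooth_onI, rule Ck_on_local) (blast dest: smooth_onD)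

lemma smooth_on_cong:
  "open S \<Longrightarrow> smooth_on S f \<Longrightarrow> (\<And>x. x \<in> S \<Longrightarrow> f x = g x) \<Longrightarrow> smooth_on S g"
  unfolding smooth_on_def by (metis Ck_on_cong)

lemma smooth_on_const: "smooth_on S (\<lambda>x. c)"
  by (auto simp: smooth_on_def intro: Ck_on_const)

lemma smooth_on_ident: "open S \<Longrightarrow> smooth_on S (\<lambda>x. x)"
  by (auto simp: smooth_on_def intro: Ck_on_ident)

lemma smooth_on_bounded_linear: "bounded_linear L \<Longrightarrow> open S \<Longrightarrow> smooth_on S L"
  by (auto simp: smooth_on_def intro: Ck_on_bounded_linear)

lemma smooth_on_bounded_linear_comp:
  "bounded_linear L \<Longrightarrow> open S \<Longrightarrow> smooth_on S f \<Longrightarrow> smooth_on S (\<lambda>x. L (f x))"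
  by (auto simp: smooth_on_def intro: Ck_on_bounded_linear_comp)

lemma smooth_on_sum:
  "open S \<Longrightarrow> (\<And>i. i \<in> I \<Longrightarrow> smooth_on S (f i)) \<Longrightarrow> smooth_on S (\<lambda>x. \<Sum>i\<in>I. f i x)"
  by (auto simp: smooth_on_def intro: Ck_on_sum)

lemma smooth_on_prod:
  fixes f :: "'i \<Rightarrow> 'a::real_normed_vector \<Rightarrow> real"
  shows "open S \<Longrightarrow> (\<And>i. i \<in> I \<Longrightarrow> smooth_on S (f i)) \<Longrightarrow> smooth_on S (\<lambda>x. \<Prod>i\<in>I. f i x)"
  by (auto simp: smooth_on_def intro: Ck_on_prod)

lemma smooth_on_mult:
  fixes f g :: "'a::real_normed_vector \<Rightarrow> real"
  shows "open S \<Longrightarrow> smooth_on S f \<Longrightarrow> smooth_on S g \<Longrightarrow> smooth_on S (\<lambda>x. f x * g x)"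
  by (auto simp: smooth_on_def intro: bounded_bilinear.Ck_on[OF bounded_bilinear_mult])

lemma smooth_on_scaleR:
  "open S \<Longrightarrow> smooth_on S f \<Longrightarrow> smooth_on S g \<Longrightarrow> smooth_on S (\<lambda>x. f x *\<^sub>R g x)"
  by (auto simp: smooth_on_def intro: bounded_bilinear.Ck_on[OF bounded_bilinear_scaleR])

lemma smooth_on_Pair:
  "open S \<Longrightarrow> smooth_on S f \<Longrightarrow> smooth_on S g \<Longrightarrow> smooth_on S (\<lambda>x. (f x, g x))"
  by (auto simp: smooth_on_def intro: Ck_on_Pair)

lemma smooth_on_compose:
  fixes f :: "'a::real_normed_vector \<Rightarrow> 'b::euclidean_space"
  shows "open S \<Longrightarrow> open U \<Longrightarrow> f ` S \<subseteq> U \<Longrightarrow> smooth_on S f \<Longrightarrow> smooth_on U g \<Longrightarrow>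
    smooth_on S (\<lambda>x. g (f x))"
  by (auto simp: smooth_on_def intro: Ck_on_compose)

lemma smooth_on_divide:
  fixes f g :: "'a::real_normed_vector \<Rightarrow> real"
  shows "open S \<Longrightarrow> smooth_on S f \<Longrightarrow> smooth_on S g \<Longrightarrow> (\<And>x. x \<in> S \<Longrightarrow> g x \<noteq> 0) \<Longrightarrow>
    smooth_on S (\<lambda>x. f x / g x)"
  by (auto simp: smooth_on_def divide_inverse
      intro!: Ck_on_inverse bounded_bilinear.Ck_on[OF bounded_bilinear_mult])

lemma smooth_on_sqrt:
  fixes f :: "'a::real_normed_vector \<Rightarrow> real"
  shows "open S \<Longrightarrow> smooth_on S f \<Longrightarrow> (\<And>x. x \<in> S \<Longrightarrow> f x > 0) \<Longrightarrow> smooth_on S (\<lambda>x. sqrt (f x))"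
  by (auto simp: smooth_on_def intro: Ck_on_sqrt)

lemma smooth_on_frechet_derivative:
  "smooth_on S f \<Longrightarrow> smooth_on S (\<lambda>x. frechet_derivative f (at x) v)"
  unfolding smooth_on_def using Ck_on.simps(2) by blast

lemma smooth_on_has_derivative:
  "smooth_on S f \<Longrightarrow> x \<in> S \<Longrightarrow> (f has_derivative frechet_derivative f (at x)) (at x)"
  using Ck_on.simps(2)[of 0 S f] by (auto simp: smooth_on_def frechet_derivative_works)

lemma smooth_on_continuous_on: "smooth_on S f \<Longrightarrow> continuous_on S f"
  using smooth_onD[of S f 0] by simp

section \<open>Alternating forms and Gram determinants\<close>

lemma alternating_form_linear: "alternating_form \<omega> \<Longrightarrow> linear (\<lambda>u. \<omega> (v(i := u)))"
  by (simp add: alternating_form_def)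

lemma alternating_form_eq_0: "alternating_form \<omega> \<Longrightarrow> i \<noteq> j \<Longrightarrow> v i = v j \<Longrightarrow> \<omega> v = 0"
  unfolding alternating_form_def by blast

text \<open>Polarization: \<open>\<omega>\<close> vanishes with \<open>a + b\<close> in both slots,
  and so do the expanded terms containing \<open>a\<close> twice or \<open>b\<close> twice.\<close>

lemma alternating_form_swap:
  assumes \<omega>: "alternating_form \<omega>" and ij: "i \<noteq> j"
  shows "\<omega> (v(i := a, j := b)) = - \<omega> (v(i := b, j := a))"
proof -
  define f where "f a b = \<omega> (v(i := a, j := b))" for a b
  have add2: "f c (a + b) = f c a + f c b" for a b c
    unfolding f_def using alternating_form_linear[OF \<omega>, of "v(i := c)" j] by (rule linear_add)
  have add1: "f (a + b) c = f a c + f b c" for a b c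
    unfolding f_def fun_upd_twist[OF ij]
    using alternating_form_linear[OF \<omega>, of "v(j := c)" i] by (rule linear_add)
  have z: "f c c = 0" for c
    unfolding f_def using ij by (intro alternating_form_eq_0[OF \<omega> ij]) simp
  have "f (a + b) (a + b) = f a a + f b a + (f a b + f b b)"
    by (simp only: add1 add2)
  then have "f a b + f b a = 0" unfolding z by (simp add: add.commute)
  then show ?thesis unfolding f_def by (simp add: eq_neg_iff_add_eq_0)
qed

text \<open>Row \<open>i\<close> of \<open>B\<close> holds the coefficients of the new vector
  \<open>i\<close>, as in the definition of \<open>orientation\<close>; with this convention a
  matrix product acts as the composite in the same order.\<close>

definition frame_mult :: "real^'k^'k \<Rightarrow> ('k \<Rightarrow> 'b::real_vector) \<Rightarrow> 'k \<Rightarrow> 'b" where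
  "frame_mult B v = (\<lambda>i. \<Sum>j\<in>UNIV. B $ i $ j *\<^sub>R v j)"

lemma frame_mult_assoc: "frame_mult (A ** B) v = frame_mult A (frame_mult B v)"
proof
  fix i
  have "(\<Sum>j\<in>UNIV. (\<Sum>k\<in>UNIV. A$i$k * B$k$j) *\<^sub>R v j) = (\<Sum>j\<in>UNIV. \<Sum>k\<in>UNIV. (A$i$k * B$k$j) *\<^sub>R v j)"
    by (simp add: scaleR_sum_left)
  also have "\<dots> = (\<Sum>k\<in>UNIV. \<Sum>j\<in>UNIV. (A$i$k * B$k$j) *\<^sub>R v j)" by (rule sum.swap)
  finally show "frame_mult (A ** B) v i = frame_mult A (frame_mult B v) i"
    by (simp add: frame_mult_def matrix_matrix_mult_def scaleR_sum_right)
qed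

text \<open>Both sides are multiplicative in \<open>B\<close>, so elementary matrices suffice: a
  transposition changes the sign by antisymmetry, and a shear adds a term with a repeated vector.
  Neither an ordering of the indices nor a Leibniz sum is involved.\<close>

lemma alternating_form_frame_mult:
  fixes \<omega> :: "('k::finite \<Rightarrow> 'b::real_vector) \<Rightarrow> 'z::real_vector"
  assumes \<omega>: "alternating_form \<omega>"
  shows "\<omega> (frame_mult B v) = det B *\<^sub>R \<omega> v"
proof -
  have "\<forall>v. \<omega> (frame_mult B v) = det B *\<^sub>R \<omega> v"
  proof (induct B rule: induct_matrix_elementary)
    case (1 A B)
    then show ?case by (simp add: frame_mult_assoc det_mul)
  next
    case (2 A i)
    have "\<omega> w = 0" if "w i = 0" for w
      using linear_0[OF alternating_form_linear[OF \<omega>, of w i]] that by (metis fun_upd_triv)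
    moreover have "frame_mult A v i = 0" for v :: "'k \<Rightarrow> 'b"
    proof -
      have "A $ i $ j = 0" for j using "2" by (metis row_def vec_lambda_beta vec_nth_inverse zero_index)
      then show ?thesis by (simp add: frame_mult_def)
    qed
    ultimately show ?case using det_zero_row(1)[OF 2] by simp
  next
    case (3 A)
    have e: "frame_mult A v = (\<lambda>i. A$i$i *\<^sub>R v i)" for v :: "'k \<Rightarrow> 'b"
    proof
      fix i
      have "frame_mult A v i = (\<Sum>j\<in>UNIV. if j = i then A$i$i *\<^sub>R v i else 0)"
        unfolding frame_mult_def by (rule sum.cong) (use 3[of i] in auto)
      then show "frame_mult A v i = A$i$i *\<^sub>R v i" by simp
    qed
    \<comment> \<open>Diagonal entries are pulled out one slot at a time, by induction on the set
      \<open>I\<close> of slots already rescaled.\<close>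
    have "\<omega> (\<lambda>i. if i \<in> I then A$i$i *\<^sub>R v i else v i) = (\<Prod>i\<in>I. A$i$i) *\<^sub>R \<omega> v"
      if "finite I" for I and v :: "'k \<Rightarrow> 'b"
      using that
    proof (induct I)
      case (insert k I)
      let ?t = "\<lambda>i. if i \<in> I then A$i$i *\<^sub>R v i else v i"
      have "(\<lambda>i. if i \<in> insert k I then A$i$i *\<^sub>R v i else v i) = ?t(k := A$k$k *\<^sub>R v k)"
        using insert by auto
      moreover have "?t = ?t(k := v k)" using insert by auto
      moreover have "\<omega> (?t(k := A$k$k *\<^sub>R v k)) = A$k$k *\<^sub>R \<omega> (?t(k := v k))"
        by (rule linear_cmul[OF alternating_form_linear[OF \<omega>]])
      ultimately show ?case using insert by simp
    qed simp
    from this[of UNIV] show ?case using 3 by (simp add: e det_diagonal)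
  next
    case (4 m n)
    let ?B = "(\<chi> i j. mat 1 $ i $ Transposition.transpose m n j) :: real^'k^'k"
    have e: "frame_mult ?B v = v(m := v n, n := v m)" for v :: "'k \<Rightarrow> 'b"
    proof
      fix i
      have "frame_mult ?B v i = (\<Sum>j\<in>UNIV. if j = Transposition.transpose m n i then v j else 0)"
        unfolding frame_mult_def by (rule sum.cong) (auto simp: mat_def)
      then show "frame_mult ?B v i = (v(m := v n, n := v m)) i"
        using 4 by (auto simp: Transposition.transpose_def)
    qed
    have "\<omega> (v(m := v n, n := v m)) = - \<omega> v" for v
      using alternating_form_swap[OF \<omega> 4, of v "v n" "v m"] by simp
    moreover have "det ?B = -1"
      using det_permute_columns[of "Transposition.transpose m n" "mat 1 :: real^'k^'k"] 4
      by (simp add: permutes_swap_id sign_swap_id)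
    ultimately show ?case unfolding e by (auto simp only: scaleR_minus_left scaleR_one)
  next
    case (5 m n c)
    let ?B = "(\<chi> i j. if i = m \<and> j = n then c else of_bool (i = j)) :: real^'k^'k"
    have e: "frame_mult ?B v = v(m := v m + c *\<^sub>R v n)" for v :: "'k \<Rightarrow> 'b"
    proof
      fix i
      have "frame_mult ?B v i = (\<Sum>j\<in>UNIV. (if j = i then v j else 0) + (if i = m \<and> j = n then c *\<^sub>R v j else 0))"
        unfolding frame_mult_def by (rule sum.cong) (use 5 in auto)
      also have "\<dots> = v i + (if i = m then c *\<^sub>R v n else 0)"
        unfolding sum.distrib by auto
      finally show "frame_mult ?B v i = (v(m := v m + c *\<^sub>R v n)) i" by auto
    qed
    have "\<omega> (v(m := v m + c *\<^sub>R v n)) = \<omega> v" for v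
    proof -
      have "\<omega> (v(m := v n)) = 0" by (rule alternating_form_eq_0[OF \<omega> 5]) (use 5 in auto)
      then show ?thesis
        using linear_add[OF alternating_form_linear[OF \<omega>, of v m], of "v m" "c *\<^sub>R v n"]
          linear_cmul[OF alternating_form_linear[OF \<omega>, of v m], of c "v n"] by simp
    qed
    moreover have "det ?B = 1"
    proof -
      have "?B = (\<chi> k. if k = m then row m (mat 1) + c *s row n (mat 1) else row k (mat 1))"
        using 5 by (auto simp: vec_eq_iff row_def mat_def)
      then show ?thesis using det_row_operation[OF 5, of "mat 1 :: real^'k^'k" c] by simp
    qed
    ultimately show ?case unfolding e by (auto simp only: scaleR_one)
  qed
  then show ?thesis by blast
qed

section \<open>Gram determinants\<close>

lemma bilinear_sum_scaleR:
  assumes "bilinear q"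
  shows "q (\<Sum>i\<in>I. c i *\<^sub>R u i) (\<Sum>j\<in>J. d j *\<^sub>R w j) = (\<Sum>i\<in>I. \<Sum>j\<in>J. c i * d j * q (u i) (w j) :: real)"
  unfolding bilinear_sum[OF assms] sum.cartesian_product
  by (intro sum.cong) (auto simp: bilinear_lmul[OF assms] bilinear_rmul[OF assms])

text \<open>The Gram matrix \<open>G\<close> becomes \<open>B ** G ** transpose B\<close>. The real
  \<open>sqrt\<close> is multiplicative on negative arguments as well, so the sign of the Gram
  determinant never enters.\<close>

lemma kvec_norm_frame_mult:
  assumes "bilinear q"
  shows "kvec_norm q (frame_mult B v) = \<bar>det B\<bar> * kvec_norm q v"
proof -
  have "(\<chi> i j. q (frame_mult B v i) (frame_mult B v j)) = B ** (\<chi> i j. q (v i) (v j)) ** transpose B"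
  proof -
    have "q (frame_mult B v i) (frame_mult B v j) = (\<Sum>k\<in>UNIV. (\<Sum>l\<in>UNIV. B$i$l * q (v l) (v k)) * B$j$k)" for i j
      unfolding frame_mult_def bilinear_sum_scaleR[OF assms]
      by (subst sum.swap) (simp add: sum_distrib_right sum_distrib_left mult_ac)
    then show ?thesis by (simp add: vec_eq_iff matrix_matrix_mult_def transpose_def)
  qed
  then have "det (\<chi> i j. q (frame_mult B v i) (frame_mult B v j)) = (det B)\<^sup>2 * det (\<chi> i j. q (v i) (v j))"
    by (simp add: det_mul power2_eq_square)
  then show ?thesis by (simp add: kvec_norm_def real_sqrt_mult)
qed

lemma kvec_norm_orthonormal:
  assumes "\<And>i j. q (e i) (e j) = (if i = j then 1 else 0)"
  shows "kvec_norm q e = 1"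
proof -
  have "(\<chi> i j. q (e i) (e j)) = (mat 1 :: real^'a^'a)" by (simp add: assms mat_def vec_eq_iff)
  then show ?thesis by (simp add: kvec_norm_def)
qed

text \<open>The contraction of \<open>\<lambda> \<and> \<omega>\<close> with \<open>w\<close>, up to the term \<open>\<lambda>(w) \<omega>\<close>.\<close>

lemma alternating_form_contract:
  fixes \<omega> :: "('k::finite \<Rightarrow> 'b::real_vector) \<Rightarrow> real"
  assumes \<omega>: "alternating_form \<omega>" and l: "linear l"
  shows "alternating_form (\<lambda>v. \<Sum>i\<in>UNIV. l (v i) * \<omega> (v(i := w)))"
  unfolding alternating_form_def
proof (intro conjI allI impI)
  fix v :: "'k \<Rightarrow> 'b" and i
  show "linear (\<lambda>u. \<Sum>j\<in>UNIV. l ((v(i := u)) j) * \<omega> ((v(i := u))(j := w)))"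
  proof (intro linear_compose_sum ballI)
    fix j
    show "linear (\<lambda>u. l ((v(i := u)) j) * \<omega> ((v(i := u))(j := w)))"
    proof (cases "j = i")
      case True
      with l show ?thesis
        by (auto intro!: linearI simp: linear_add linear_cmul algebra_simps)
    next
      case False
      have "linear (\<lambda>u. l (v j) * \<omega> ((v(j := w))(i := u)))"
        using linear_compose_scale_right[OF alternating_form_linear[OF \<omega>, of "v(j := w)" i], of "l (v j)"]
        by simp
      with False show ?thesis by (simp add: fun_upd_twist)
    qed
  qed
next
  fix v :: "'k \<Rightarrow> 'b" and a b :: 'k
  assume ab: "a \<noteq> b \<and> v a = v b"
  \<comment> \<open>In every other term the equal vectors in slots \<open>a\<close> and
    \<open>b\<close> both survive the update, and \<open>\<omega>\<close> vanishes.\<close>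
  have "(\<Sum>i\<in>UNIV. l (v i) * \<omega> (v(i := w))) = (\<Sum>i\<in>{a, b}. l (v i) * \<omega> (v(i := w)))"
  proof (rule sum.mono_neutral_right)
    show "\<forall>i\<in>UNIV - {a, b}. l (v i) * \<omega> (v(i := w)) = 0"
    proof
      fix i assume "i \<in> UNIV - {a, b}"
      with ab have "\<omega> (v(i := w)) = 0" by (intro alternating_form_eq_0[OF \<omega>, of a b]) auto
      then show "l (v i) * \<omega> (v(i := w)) = 0" by simp
    qed
  qed auto
  also have "\<dots> = l (v a) * (\<omega> (v(a := w)) + \<omega> (v(b := w)))" using ab by (simp add: algebra_simps)
  also have "\<omega> (v(a := w)) = - \<omega> (v(b := w))"
  proof -
    have "v(a := w, b := v a) = v(a := w)" "v(a := v a, b := w) = v(b := w)" using ab by auto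
    then show ?thesis using alternating_form_swap[OF \<omega>, of a b v w "v a"] ab by metis
  qed
  finally show "(\<Sum>i\<in>UNIV. l (v i) * \<omega> (v(i := w))) = 0" by (simp only: ab_left_minus mult_zero_right)
qed

lemma alternating_form_compose_linear:
  fixes \<omega> :: "('k::finite \<Rightarrow> 'c::real_vector) \<Rightarrow> 'z::real_vector" and f :: "'b::real_vector \<Rightarrow> 'c"
  assumes \<omega>: "alternating_form \<omega>" and f: "linear f"
  shows "alternating_form (\<lambda>v. \<omega> (\<lambda>i. f (v i)))"
  unfolding alternating_form_def
proof (intro conjI allI impI)
  fix v :: "'k \<Rightarrow> 'b" and i
  have "linear ((\<lambda>u. \<omega> ((\<lambda>i. f (v i))(i := u))) \<circ> f)"
    by (intro linear_compose f alternating_form_linear[OF \<omega>])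
  moreover have "(\<lambda>j. f ((v(i := u)) j)) = (\<lambda>i. f (v i))(i := f u)" for u by auto
  ultimately show "linear (\<lambda>u. \<omega> (\<lambda>j. f ((v(i := u)) j)))" by (simp add: o_def)
next
  fix v :: "'k \<Rightarrow> 'b" and i j assume "i \<noteq> j \<and> v i = v j"
  then show "\<omega> (\<lambda>i. f (v i)) = 0" by (intro alternating_form_eq_0[OF \<omega>, of i j]) auto
qed

section \<open>Differentiating multilinear expressions\<close>

text \<open>Smoothness of \<open>a\<close> is given for constant vectors only. Slots are made to
  move one at a time: the vector entering slot \<open>k\<close> is expanded in the
  \<open>Basis\<close>, and the induction, general in \<open>v\<close>, supplies the terms that keep
  a basis vector in that slot.\<close>

lemma smooth_on_multilinear:
  fixes a :: "'d::euclidean_space \<Rightarrow> ('k::finite \<Rightarrow> 'c::euclidean_space) \<Rightarrow> 'z::real_normed_vector"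
    and G :: "'a::real_normed_vector \<Rightarrow> 'd"
  assumes S: "open S" and Z: "open Z" "G ` S \<subseteq> Z" and G: "smooth_on S G"
    and a: "\<And>v. smooth_on Z (\<lambda>z. a z v)"
    and lin: "\<And>z v i. z \<in> Z \<Longrightarrow> linear (\<lambda>u. a z (v(i := u)))"
    and w: "\<And>i. smooth_on S (w i)"
  shows "smooth_on S (\<lambda>x. a (G x) (\<lambda>i. w i x))"
proof -
  have "smooth_on S (\<lambda>x. a (G x) (\<lambda>i. if i \<in> I then w i x else v i))" if "finite I" for I v
    using that
  proof (induct I arbitrary: v)
    case empty
    then show ?case using smooth_on_compose[OF S Z G a, of v] by simp
  next
    case (insert k I)
    show ?case
    proof (rule smooth_on_cong[OF S])
      show "smooth_on S (\<lambda>x. \<Sum>b\<in>Basis. (w k x \<bullet> b) *\<^sub>R a (G x) (\<lambda>i. if i \<in> I then w i x else (v(k := b)) i))"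
        by (intro smooth_on_sum S smooth_on_scaleR insert(3) w
            smooth_on_bounded_linear_comp[OF bounded_linear_inner_left])
      fix x assume "x \<in> S"
      with Z have "G x \<in> Z" by auto
      let ?t = "\<lambda>i. if i \<in> I then w i x else v i"
      have 1: "(\<lambda>i. if i \<in> I then w i x else (v(k := b)) i) = ?t(k := b)" for b using insert(2) by auto
      have 2: "(\<lambda>i. if i \<in> insert k I then w i x else v i) = ?t(k := w k x)" by auto
      show "(\<Sum>b\<in>Basis. (w k x \<bullet> b) *\<^sub>R a (G x) (\<lambda>i. if i \<in> I then w i x else (v(k := b)) i)) =
        a (G x) (\<lambda>i. if i \<in> insert k I then w i x else v i)"
        unfolding 1 2 by (rule linear_expand[OF lin[OF \<open>G x \<in> Z\<close>], symmetric])
    qed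
  qed
  from this[of UNIV] show ?thesis by simp
qed

text \<open>Product rule for a form at a moving point with moving arguments. As with smoothness,
  each slot is expanded in the \<open>Basis\<close>, differentiated as a sum of scalar multiples,
  and reassembled by linearity.\<close>

lemma has_derivative_multilinear:
  fixes a :: "'d::real_normed_vector \<Rightarrow> ('k::finite \<Rightarrow> 'c::euclidean_space) \<Rightarrow> 'z::real_normed_vector"
    and G :: "'a::real_normed_vector \<Rightarrow> 'd"
  assumes S: "open S" "x \<in> S" and Z: "open Z" "G ` S \<subseteq> Z" and G: "(G has_derivative DG) (at x)"
    and a: "\<And>v. ((\<lambda>z. a z v) has_derivative Da v) (at (G x))"
    and lin: "\<And>z v i. z \<in> Z \<Longrightarrow> linear (\<lambda>u. a z (v(i := u)))"
    and w: "\<And>i. (w i has_derivative Dw i) (at x)"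
  shows "((\<lambda>x. a (G x) (\<lambda>i. w i x)) has_derivative
    (\<lambda>\<nu>. Da (\<lambda>i. w i x) (DG \<nu>) + (\<Sum>i\<in>UNIV. a (G x) ((\<lambda>i. w i x)(i := Dw i \<nu>))))) (at x)"
proof -
  have GxZ: "G x \<in> Z" using S Z by auto
  \<comment> \<open>Linearity of \<open>Da\<close> in each slot is derived from that of
    \<open>a\<close>: the basis expansion is differentiated term by term, and derivatives are
    unique.\<close>
  have Da_lin: "Da (v(i := u)) d = (\<Sum>b\<in>Basis. (u \<bullet> b) *\<^sub>R Da (v(i := b)) d)" for v i u d
  proof -
    have "((\<lambda>z. \<Sum>b\<in>Basis. (u \<bullet> b) *\<^sub>R a z (v(i := b))) has_derivative (\<lambda>d. \<Sum>b\<in>Basis. (u \<bullet> b) *\<^sub>R Da (v(i := b)) d)) (at (G x))"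
      by (intro has_derivative_sum has_derivative_scaleR_right a)
    then have "((\<lambda>z. a z (v(i := u))) has_derivative (\<lambda>d. \<Sum>b\<in>Basis. (u \<bullet> b) *\<^sub>R Da (v(i := b)) d)) (at (G x))"
      by (rule has_derivative_transform_within_open[OF _ Z(1) GxZ])
        (rule linear_expand[OF lin, symmetric])
    from has_derivative_unique[OF a this] show ?thesis by metis
  qed
  have "((\<lambda>x. a (G x) (\<lambda>i. if i \<in> I then w i x else v i)) has_derivative
    (\<lambda>\<nu>. Da (\<lambda>i. if i \<in> I then w i x else v i) (DG \<nu>) +
      (\<Sum>j\<in>I. a (G x) ((\<lambda>i. if i \<in> I then w i x else v i)(j := Dw j \<nu>))))) (at x)" if "finite I" for I v
    using that
  proof (induct I arbitrary: v)
    case empty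
    then show ?case using has_derivative_compose[OF G a, of v] by simp
  next
    case (insert k I)
    let ?t = "\<lambda>y i. if i \<in> I then w i y else v i"
    have 1: "(\<lambda>i. if i \<in> I then w i y else (v(k := b)) i) = (?t y)(k := b)" for b y using insert(2) by auto
    have 2: "(\<lambda>i. if i \<in> insert k I then w i y else v i) = (?t y)(k := w k y)" for y by auto
    have IH: "((\<lambda>y. a (G y) ((?t y)(k := b))) has_derivative
      (\<lambda>\<nu>. Da ((?t x)(k := b)) (DG \<nu>) + (\<Sum>j\<in>I. a (G x) ((?t x)(k := b, j := Dw j \<nu>))))) (at x)" for b
      using insert(3)[of "v(k := b)"] unfolding 1 .
    have d: "((\<lambda>y. \<Sum>b\<in>Basis. (w k y \<bullet> b) *\<^sub>R a (G y) ((?t y)(k := b))) has_derivative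
      (\<lambda>\<nu>. \<Sum>b\<in>Basis. (w k x \<bullet> b) *\<^sub>R (Da ((?t x)(k := b)) (DG \<nu>) + (\<Sum>j\<in>I. a (G x) ((?t x)(k := b, j := Dw j \<nu>))))
         + (Dw k \<nu> \<bullet> b) *\<^sub>R a (G x) ((?t x)(k := b)))) (at x)"
      by (intro has_derivative_sum has_derivative_scaleR IH has_derivative_inner_left w)
    have "((\<lambda>y. a (G y) ((?t y)(k := w k y))) has_derivative
      (\<lambda>\<nu>. \<Sum>b\<in>Basis. (w k x \<bullet> b) *\<^sub>R (Da ((?t x)(k := b)) (DG \<nu>) + (\<Sum>j\<in>I. a (G x) ((?t x)(k := b, j := Dw j \<nu>))))
         + (Dw k \<nu> \<bullet> b) *\<^sub>R a (G x) ((?t x)(k := b)))) (at x)"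
      by (rule has_derivative_transform_within_open[OF d S])
        (use Z in \<open>auto intro!: linear_expand[OF lin, symmetric]\<close>)
    moreover have "(\<Sum>b\<in>Basis. (w k x \<bullet> b) *\<^sub>R (Da ((?t x)(k := b)) (DG \<nu>) + (\<Sum>j\<in>I. a (G x) ((?t x)(k := b, j := Dw j \<nu>))))
         + (Dw k \<nu> \<bullet> b) *\<^sub>R a (G x) ((?t x)(k := b))) =
      Da ((?t x)(k := w k x)) (DG \<nu>) +
      (\<Sum>j\<in>insert k I. a (G x) ((?t x)(k := w k x, j := Dw j \<nu>)))" for \<nu>
    proof -
      have "(\<Sum>b\<in>Basis. (w k x \<bullet> b) *\<^sub>R (\<Sum>j\<in>I. a (G x) ((?t x)(k := b, j := Dw j \<nu>)))) =
        (\<Sum>j\<in>I. \<Sum>b\<in>Basis. (w k x \<bullet> b) *\<^sub>R a (G x) ((?t x)(k := b, j := Dw j \<nu>)))"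
        by (simp only: scaleR_sum_right) (rule sum.swap)
      also have "\<dots> = (\<Sum>j\<in>I. a (G x) ((?t x)(k := w k x, j := Dw j \<nu>)))"
      proof (rule sum.cong[OF refl])
        fix j assume "j \<in> I"
        then have jk: "k \<noteq> j" using insert by auto
        show "(\<Sum>b\<in>Basis. (w k x \<bullet> b) *\<^sub>R a (G x) ((?t x)(k := b, j := Dw j \<nu>))) = a (G x) ((?t x)(k := w k x, j := Dw j \<nu>))"
          unfolding fun_upd_twist[OF jk] by (rule linear_expand[OF lin[OF GxZ], symmetric])
      qed
      finally have A: "(\<Sum>b\<in>Basis. (w k x \<bullet> b) *\<^sub>R (\<Sum>j\<in>I. a (G x) ((?t x)(k := b, j := Dw j \<nu>)))) =
        (\<Sum>j\<in>I. a (G x) ((?t x)(k := w k x, j := Dw j \<nu>)))" .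
      have B: "(\<Sum>b\<in>Basis. (Dw k \<nu> \<bullet> b) *\<^sub>R a (G x) ((?t x)(k := b))) = a (G x) ((?t x)(k := w k x, k := Dw k \<nu>))"
        using linear_expand[OF lin[OF GxZ], of "?t x" k "Dw k \<nu>"] by simp
      show ?thesis
        unfolding scaleR_add_right sum.distrib A B Da_lin[symmetric]
        using insert by (simp add: add_ac)
    qed
    ultimately show ?case unfolding 2 by (rule has_derivative_eq_rhs[OF _ ext])
  qed
  from this[of UNIV] show ?thesis by simp
qed

text \<open>The second difference over the parallelogram spanned by \<open>h *\<^sub>R u\<close> and
  \<open>h *\<^sub>R v\<close> is symmetric in \<open>u\<close> and \<open>v\<close>. Two
  applications of the mean value theorem, in either order, express it as \<open>h * h\<close> times
  a mixed derivative at some point of the parallelogram; continuity finishes as \<open>h\<close>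
  shrinks.\<close>

lemma symmetric_mixed_derivatives_real:
  fixes f :: "'a::real_normed_vector \<Rightarrow> real"
  assumes S: "open S" "x \<in> S" and f: "smooth_on S f"
  shows "frechet_derivative (\<lambda>y. frechet_derivative f (at y) u) (at x) v =
    frechet_derivative (\<lambda>y. frechet_derivative f (at y) v) (at x) u"
proof -
  define D2 where "D2 u v y = frechet_derivative (\<lambda>y. frechet_derivative f (at y) u) (at y) v" for u v y
  have MV: "\<exists>s t. 0 \<le> s \<and> s \<le> h \<and> 0 \<le> t \<and> t \<le> h \<and>
      f (x + h *\<^sub>R u + h *\<^sub>R v) - f (x + h *\<^sub>R u) - f (x + h *\<^sub>R v) + f x = h * (h * D2 u v (x + s *\<^sub>R u + t *\<^sub>R v))"
    if h: "h > 0" and sub: "\<And>s t. 0 \<le> s \<Longrightarrow> s \<le> h \<Longrightarrow> 0 \<le> t \<Longrightarrow> t \<le> h \<Longrightarrow> x + s *\<^sub>R u + t *\<^sub>R v \<in> S" for h u v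
  proof -
    have df: "(f has_derivative frechet_derivative f (at y)) (at y)" if "y \<in> S" for y
      using smooth_on_has_derivative[OF f that] .
    have ddf: "((\<lambda>y. frechet_derivative f (at y) u) has_derivative (\<lambda>w. D2 u w y)) (at y)" if "y \<in> S" for y
      unfolding D2_def using smooth_on_has_derivative[OF smooth_on_frechet_derivative[OF f] that] .
    let ?k = "\<lambda>s. f (x + s *\<^sub>R u + h *\<^sub>R v) - f (x + s *\<^sub>R u)"
    let ?k' = "\<lambda>s. frechet_derivative f (at (x + s *\<^sub>R u + h *\<^sub>R v)) u - frechet_derivative f (at (x + s *\<^sub>R u)) u"
    have ray: "((\<lambda>s. g (p + s *\<^sub>R d)) has_real_derivative G d) (at s)"
      if "(g has_derivative G) (at (p + s *\<^sub>R d))" for g :: "'a \<Rightarrow> real" and G p d s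
    proof -
      have "((\<lambda>s. p + s *\<^sub>R d) has_derivative (\<lambda>h. h *\<^sub>R d)) (at s)"
        by (auto intro!: derivative_eq_intros)
      from has_derivative_compose[OF this that]
      have "((\<lambda>s. g (p + s *\<^sub>R d)) has_derivative (\<lambda>h. G (h *\<^sub>R d))) (at s)" .
      moreover have "G (h *\<^sub>R d) = h * G d" for h
        using linear_cmul[OF has_derivative_linear[OF that]] by simp
      ultimately show ?thesis by (simp add: has_field_derivative_def mult_commute_abs)
    qed
    have "(?k has_real_derivative ?k' s) (at s)" if "0 \<le> s" "s \<le> h" for s
    proof (rule DERIV_diff)
      show "((\<lambda>s. f (x + s *\<^sub>R u + h *\<^sub>R v)) has_real_derivative frechet_derivative f (at (x + s *\<^sub>R u + h *\<^sub>R v)) u) (at s)"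
        using ray[OF df, of "x + h *\<^sub>R v" s u] sub[OF that, of h] h by (simp add: add_ac)
      show "((\<lambda>s. f (x + s *\<^sub>R u)) has_real_derivative frechet_derivative f (at (x + s *\<^sub>R u)) u) (at s)"
        using ray[OF df, of "x" s u] sub[OF that, of 0] h by (simp add: add_ac)
    qed
    then obtain s where s: "0 < s" "s < h" "?k h - ?k 0 = (h - 0) * ?k' s"
      using MVT2[of 0 h ?k ?k'] h by auto
    have "((\<lambda>t. frechet_derivative f (at (x + s *\<^sub>R u + t *\<^sub>R v)) u) has_real_derivative D2 u v (x + s *\<^sub>R u + t *\<^sub>R v)) (at t)"
      if "0 \<le> t" "t \<le> h" for t
      using ray[OF ddf, of "x + s *\<^sub>R u" t v] sub[of s t] that s by auto
    then obtain t where t: "0 < t" "t < h" "?k' s = (h - 0) * D2 u v (x + s *\<^sub>R u + t *\<^sub>R v)"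
      using MVT2[of 0 h "\<lambda>t. frechet_derivative f (at (x + s *\<^sub>R u + t *\<^sub>R v)) u"
          "\<lambda>t. D2 u v (x + s *\<^sub>R u + t *\<^sub>R v)"] h by auto
    show ?thesis by (rule exI[of _ s], rule exI[of _ t]) (use s t in \<open>auto simp: algebra_simps\<close>)
  qed
  have cont: "isCont (D2 u v) x" for u v
  proof -
    have "continuous_on S (D2 u v)" unfolding D2_def
      by (intro smooth_on_continuous_on smooth_on_frechet_derivative f)
    then show ?thesis using S continuous_on_eq_continuous_at by blast
  qed
  have "\<bar>D2 u v x - D2 v u x\<bar> \<le> e" if e: "e > 0" for e
  proof -
    from cont[of u v] obtain d1 where d1: "d1 > 0" "\<And>y. dist y x < d1 \<Longrightarrow> \<bar>D2 u v y - D2 u v x\<bar> < e/2"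
      unfolding continuous_at_eps_delta dist_real_def using half_gt_zero[OF e] by blast
    from cont[of v u] obtain d2 where d2: "d2 > 0" "\<And>y. dist y x < d2 \<Longrightarrow> \<bar>D2 v u y - D2 v u x\<bar> < e/2"
      unfolding continuous_at_eps_delta dist_real_def using half_gt_zero[OF e] by blast
    from S obtain d3 where d3: "d3 > 0" "\<And>y. dist y x < d3 \<Longrightarrow> y \<in> S"
      unfolding open_dist by blast
    define d where "d = min d1 (min d2 d3)"
    \<comment> \<open>Chosen so that the whole parallelogram lies within distance \<open>d\<close>
      of \<open>x\<close>; the summand \<open>1\<close> keeps the denominator positive when
      \<open>u\<close> and \<open>v\<close> vanish.\<close>
    define h where "h = d / (norm u + norm v + 1) / 2"
    have d: "d > 0" using d1 d2 d3 by (simp add: d_def)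
    have h: "h > 0" unfolding h_def using d by (simp add: add_nonneg_pos)
    have hb: "h * (norm u + norm v) < d"
    proof -
      have "h * (norm u + norm v + 1) = d / 2"
        unfolding h_def using norm_ge_zero[of u] norm_ge_zero[of v] by (simp add: field_simps add_nonneg_eq_0_iff)
      then show ?thesis using d h by (simp add: algebra_simps)
    qed
    have small: "dist (x + s *\<^sub>R u + t *\<^sub>R v) x < d" if "0 \<le> s" "s \<le> h" "0 \<le> t" "t \<le> h" for s t
    proof -
      have "dist (x + s *\<^sub>R u + t *\<^sub>R v) x \<le> s * norm u + t * norm v"
        using norm_triangle_ineq[of "s *\<^sub>R u" "t *\<^sub>R v"] that by (simp add: dist_norm add.assoc)
      also have "\<dots> \<le> h * norm u + h * norm v" by (intro add_mono mult_right_mono that norm_ge_zero)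
      finally show ?thesis using hb by (simp add: algebra_simps)
    qed
    have small': "dist (x + t *\<^sub>R v + s *\<^sub>R u) x < d" if "0 \<le> s" "s \<le> h" "0 \<le> t" "t \<le> h" for s t
      using small[OF that] by (simp add: add_ac)
    obtain s t where st: "0 \<le> s" "s \<le> h" "0 \<le> t" "t \<le> h" and e1:
      "f (x + h *\<^sub>R u + h *\<^sub>R v) - f (x + h *\<^sub>R u) - f (x + h *\<^sub>R v) + f x = h * (h * D2 u v (x + s *\<^sub>R u + t *\<^sub>R v))"
      using MV[OF h, of u v] d3 small by (force simp: d_def)
    obtain s' t' where st': "0 \<le> s'" "s' \<le> h" "0 \<le> t'" "t' \<le> h" and e2:
      "f (x + h *\<^sub>R v + h *\<^sub>R u) - f (x + h *\<^sub>R v) - f (x + h *\<^sub>R u) + f x = h * (h * D2 v u (x + s' *\<^sub>R v + t' *\<^sub>R u))"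
      using MV[OF h, of v u] d3 small' by (force simp: d_def)
    have "f (x + h *\<^sub>R u + h *\<^sub>R v) - f (x + h *\<^sub>R u) - f (x + h *\<^sub>R v) + f x =
        f (x + h *\<^sub>R v + h *\<^sub>R u) - f (x + h *\<^sub>R v) - f (x + h *\<^sub>R u) + f x"
      by (simp add: add_ac)
    with e1 e2 have "D2 u v (x + s *\<^sub>R u + t *\<^sub>R v) = D2 v u (x + s' *\<^sub>R v + t' *\<^sub>R u)"
      using h by simp
    moreover have "\<bar>D2 u v (x + s *\<^sub>R u + t *\<^sub>R v) - D2 u v x\<bar> < e/2"
      using d1(2) small[OF st] by (simp add: d_def)
    moreover have "\<bar>D2 v u (x + s' *\<^sub>R v + t' *\<^sub>R u) - D2 v u x\<bar> < e/2"
      using d2(2) small'[OF st'(3,4,1,2)] by (simp add: d_def)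
    ultimately show ?thesis by linarith
  qed
  then have "D2 u v x = D2 v u x" using dense_ge[of 0 "\<bar>D2 u v x - D2 v u x\<bar>"] by auto
  then show ?thesis unfolding D2_def .
qed

lemma symmetric_mixed_derivatives:
  fixes f :: "'a::real_normed_vector \<Rightarrow> 'b::euclidean_space"
  assumes S: "open S" "x \<in> S" and f: "smooth_on S f"
  shows "frechet_derivative (\<lambda>y. frechet_derivative f (at y) u) (at x) v =
    frechet_derivative (\<lambda>y. frechet_derivative f (at y) v) (at x) u"
proof (rule euclidean_eqI)
  fix b :: 'b assume "b \<in> Basis"
  have 1: "frechet_derivative (\<lambda>y. f y \<bullet> b) (at y) w = frechet_derivative f (at y) w \<bullet> b" if "y \<in> S" for y w
    using frechet_derivative_eqI[OF has_derivative_inner_left[OF smooth_on_has_derivative[OF f that]]] by metis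
  have 2: "frechet_derivative (\<lambda>y. frechet_derivative (\<lambda>y. f y \<bullet> b) (at y) u) (at x) v =
      frechet_derivative (\<lambda>y. frechet_derivative f (at y) u) (at x) v \<bullet> b" for u v
  proof -
    have d: "((\<lambda>y. frechet_derivative f (at y) u \<bullet> b) has_derivative
      (\<lambda>v. frechet_derivative (\<lambda>y. frechet_derivative f (at y) u) (at x) v \<bullet> b)) (at x)"
      by (intro has_derivative_inner_left smooth_on_has_derivative[OF _ S(2)] smooth_on_frechet_derivative f)
    have "((\<lambda>y. frechet_derivative (\<lambda>y. f y \<bullet> b) (at y) u) has_derivative
      (\<lambda>v. frechet_derivative (\<lambda>y. frechet_derivative f (at y) u) (at x) v \<bullet> b)) (at x)"
      by (rule has_derivative_transform_within_open[OF d S]) (simp add: 1)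
    from frechet_derivative_eqI[OF this] show ?thesis by simp
  qed
  have "smooth_on S (\<lambda>y. f y \<bullet> b)"
    by (rule smooth_on_bounded_linear_comp[OF bounded_linear_inner_left S(1) f])
  from symmetric_mixed_derivatives_real[OF S this, of u v]
  show "frechet_derivative (\<lambda>y. frechet_derivative f (at y) u) (at x) v \<bullet> b =
    frechet_derivative (\<lambda>y. frechet_derivative f (at y) v) (at x) u \<bullet> b" unfolding 2 .
qed

text \<open>
  Cartan's formula for the pull-back \<open>G\<^sup>*a\<close> of a closed form: the derivative in the direction \<open>e0\<close> is
  the divergence of the contraction with \<open>e0\<close>. The terms with second derivatives of \<open>G\<close> cancel in pairs.
\<close>

lemma closed_form_pullback_derivative:
  fixes a :: "'d::euclidean_space \<Rightarrow> ('k::finite \<Rightarrow> 'd) \<Rightarrow> real"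
    and G :: "'a::real_normed_vector \<Rightarrow> 'd"
  assumes S: "open S" "x \<in> S" and Z: "open Z" "G ` S \<subseteq> Z" and G: "smooth_on S G"
    and a: "\<And>v. smooth_on Z (\<lambda>z. a z v)"
    and alt: "\<And>z. z \<in> Z \<Longrightarrow> alternating_form (a z)"
    and closed: "\<And>v w. frechet_derivative (\<lambda>z. a z v) (at (G x)) w =
      (\<Sum>i\<in>UNIV. frechet_derivative (\<lambda>z. a z (v(i := w))) (at (G x)) (v i))"
  shows "frechet_derivative (\<lambda>y. a (G y) (\<lambda>i. frechet_derivative G (at y) (E i))) (at x) e0 =
    (\<Sum>i\<in>UNIV. frechet_derivative (\<lambda>y. a (G y) ((\<lambda>j. frechet_derivative G (at y) (E j))(i := frechet_derivative G (at y) e0)))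
       (at x) (E i))"
proof -
  define Da where "Da v = frechet_derivative (\<lambda>z. a z v) (at (G x))" for v
  define DG where "DG = frechet_derivative G (at x)"
  define D2 where "D2 u w = frechet_derivative (\<lambda>y. frechet_derivative G (at y) u) (at x) w" for u w
  define V where "V = (\<lambda>j. DG (E j))"
  have GZ: "G x \<in> Z" using S Z by auto
  have sym: "D2 u w = D2 w u" for u w
    unfolding D2_def by (rule symmetric_mixed_derivatives[OF S G])
  have D2: "((\<lambda>y. frechet_derivative G (at y) u) has_derivative D2 u) (at x)" for u
    unfolding D2_def by (rule smooth_on_has_derivative[OF smooth_on_frechet_derivative[OF G] S(2)])
  have Da: "((\<lambda>z. a z v) has_derivative Da v) (at (G x))" for v
    unfolding Da_def by (rule smooth_on_has_derivative[OF a GZ])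
  have DGd: "(G has_derivative DG) (at x)"
    unfolding DG_def by (rule smooth_on_has_derivative[OF G S(2)])
  have lin: "linear (\<lambda>u. a z (v(i := u)))" if "z \<in> Z" for z v i
    using alternating_form_linear[OF alt[OF that]] .
  have R: "frechet_derivative (\<lambda>y. a (G y) (\<lambda>j. frechet_derivative G (at y) (F j))) (at x) \<nu> =
     Da (\<lambda>j. DG (F j)) (DG \<nu>) + (\<Sum>j\<in>UNIV. a (G x) ((\<lambda>j. DG (F j))(j := D2 (F j) \<nu>)))" for F \<nu>
    using frechet_derivative_eqI[OF has_derivative_multilinear[OF S Z DGd Da lin D2]]
    unfolding DG_def by metis
  \<comment> \<open>Off-diagonal term of the divergence: slot \<open>i\<close> holds
    \<open>DG e0\<close>, and the vector in slot \<open>j\<close> is differentiated in direction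
    \<open>E i\<close>. Symmetry of \<open>D2\<close> makes it antisymmetric. For
    \<open>i = j\<close> the vector \<open>DG e0\<close> itself is differentiated, and that term is
    kept apart.\<close>
  define T where "T i j = (if i = j then 0 else a (G x) (V(i := DG e0, j := D2 (E j) (E i))))" for i j
  have Tanti: "T i j = - T j i" for i j
    unfolding T_def sym[of "E j" "E i"]
    using alternating_form_swap[OF alt[OF GZ], of i j V "DG e0" "D2 (E i) (E j)"]
    by (auto simp: fun_upd_twist)
  have "(\<Sum>i\<in>UNIV. \<Sum>j\<in>UNIV. T i j) = - (\<Sum>i\<in>UNIV. \<Sum>j\<in>UNIV. T i j)"
    by (subst sum.swap, subst Tanti) (simp add: sum_negf)
  then have T0: "(\<Sum>i\<in>UNIV. \<Sum>j\<in>UNIV. T i j) = 0" by linarith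
  have tm: "frechet_derivative (\<lambda>y. a (G y) ((\<lambda>j. frechet_derivative G (at y) (E j))(i := frechet_derivative G (at y) e0)))
       (at x) (E i) = Da (V(i := DG e0)) (DG (E i)) + a (G x) (V(i := D2 e0 (E i))) + (\<Sum>j\<in>UNIV. T i j)" for i
  proof -
    have 1: "(\<lambda>j. frechet_derivative G (at y) (E j))(i := frechet_derivative G (at y) e0) =
       (\<lambda>j. frechet_derivative G (at y) ((E(i := e0)) j))" for y by auto
    have 2: "(\<lambda>j. DG ((E(i := e0)) j)) = V(i := DG e0)" by (auto simp: V_def)
    have "(\<Sum>j\<in>UNIV. a (G x) (V(i := DG e0, j := D2 ((E(i := e0)) j) (E i)))) =
      (\<Sum>j\<in>UNIV. (if j = i then a (G x) (V(i := D2 e0 (E i))) else 0) + T i j)"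
      by (rule sum.cong) (auto simp: T_def)
    then show ?thesis unfolding 1 R 2 by (simp add: sum.distrib)
  qed
  \<comment> \<open>By closedness, the derivative of the coefficients along \<open>DG e0\<close> is
    the sum of the first terms in \<open>tm\<close>.\<close>
  have "Da V (DG e0) = (\<Sum>i\<in>UNIV. Da (V(i := DG e0)) (DG (E i)))"
    using closed[of V "DG e0"] unfolding Da_def by (simp add: V_def)
  moreover have "frechet_derivative (\<lambda>y. a (G y) (\<lambda>i. frechet_derivative G (at y) (E i))) (at x) e0 =
     Da V (DG e0) + (\<Sum>i\<in>UNIV. a (G x) (V(i := D2 e0 (E i))))"
    unfolding R by (simp add: V_def sym[of "E _" e0])
  ultimately show ?thesis unfolding tm sum.distrib T0 by simp
qed

section \<open>Differentials of maps into and between manifolds\<close>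

text \<open>Continuity is a separate clause: a chart is an arbitrary total function outside its
  domain, so differentiability of the composite does not by itself keep \<open>f\<close> near
  \<open>f y\<close>.\<close>

definition pdiff ::
  "('m::topological_space, 'b::euclidean_space) chart set \<Rightarrow> ('a::real_normed_vector \<Rightarrow> 'm) \<Rightarrow> 'a \<Rightarrow> bool" where
  "pdiff A f y \<longleftrightarrow> isCont f y \<and> (\<forall>c\<in>A. f y \<in> fst c \<longrightarrow> (\<lambda>z. snd c (f z)) differentiable (at y))"

definition mpdiff ::
  "('m::topological_space, 'b::euclidean_space) chart set \<Rightarrow> ('m \<Rightarrow> 'm) \<Rightarrow> 'm \<Rightarrow> bool" where
  "mpdiff A f x \<longleftrightarrow> pdiff A (\<lambda>z. f (chart_inv (chart_at A x) z)) (snd (chart_at A x) x)"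

lemma isCont_open: "isCont f y \<Longrightarrow> open B \<Longrightarrow> f y \<in> B \<Longrightarrow> \<exists>S. open S \<and> y \<in> S \<and> (\<forall>z\<in>S. f z \<in> B)"
  for f :: "'a::t2_space \<Rightarrow> 'z::topological_space"
  unfolding continuous_at_open by blast

locale manifold =
  fixes A :: "('m::{t2_space, second_countable_topology}, 'b::euclidean_space) chart set"
  assumes smooth_manifold: "smooth_manifold A"
begin

lemma chartD:
  assumes "c \<in> A"
  shows "open (fst c)" "open (chart_img c)" "continuous_on (fst c) (snd c)"
    "continuous_on (chart_img c) (chart_inv c)"
    "homeomorphism (fst c) (chart_img c) (snd c) (chart_inv c)"
  using smooth_manifold assms by (auto simp: smooth_manifold_def homeomorphism_def)

lemma chart_inv:
  assumes "c \<in> A"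
  shows "x \<in> fst c \<Longrightarrow> chart_inv c (snd c x) = x" "y \<in> chart_img c \<Longrightarrow> snd c (chart_inv c y) = y"
    "y \<in> chart_img c \<Longrightarrow> chart_inv c y \<in> fst c" "x \<in> fst c \<Longrightarrow> snd c x \<in> chart_img c"
  using chartD(5)[OF assms] by (auto simp: homeomorphism_def)

lemma chart_at: "chart_at A p \<in> A" "p \<in> fst (chart_at A p)"
proof -
  have "p \<in> (\<Union>c\<in>A. fst c)" using smooth_manifold by (simp add: smooth_manifold_def)
  then have "\<exists>c. c \<in> A \<and> p \<in> fst c" by blast
  from someI_ex[OF this] show "chart_at A p \<in> A" "p \<in> fst (chart_at A p)"
    by (auto simp: chart_at_def)
qed

lemma chart_image_eq:
  assumes "c \<in> A"
  shows "snd c ` (fst c \<inter> U) = chart_img c \<inter> chart_inv c -` U"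
proof (intro set_eqI iffI)
  fix y assume "y \<in> chart_img c \<inter> chart_inv c -` U"
  with chart_inv(2,3)[OF assms, of y] show "y \<in> snd c ` (fst c \<inter> U)"
    by (intro image_eqI[of _ _ "chart_inv c y"]) auto
qed (use chart_inv[OF assms] in auto)

lemma open_chart_image:
  assumes "c \<in> A" "open U"
  shows "open (snd c ` (fst c \<inter> U))"
  unfolding chart_image_eq[OF assms(1)]
  by (rule continuous_open_preimage[OF chartD(4,2)[OF assms(1)] assms(2)])

lemma smooth_transition:
  "c \<in> A \<Longrightarrow> c' \<in> A \<Longrightarrow> smooth_on (snd c ` (fst c \<inter> fst c')) (\<lambda>y. snd c' (chart_inv c y))"
  using smooth_manifold by (auto simp: smooth_manifold_def)

lemma transition_has_derivative:
  assumes "c \<in> A" "c' \<in> A" "p \<in> fst c" "p \<in> fst c'"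
  shows "((\<lambda>w. snd c' (chart_inv c w)) has_derivative
    frechet_derivative (\<lambda>w. snd c' (chart_inv c w)) (at (snd c p))) (at (snd c p))"
  by (rule smooth_on_has_derivative[OF smooth_transition[OF assms(1,2)]]) (use assms in auto)

text \<open>Continuity of \<open>f\<close> keeps nearby values in both chart domains, where the
  change of coordinates factors through the transition map.\<close>

lemma chart_change_derivative:
  assumes c: "c \<in> A" "c' \<in> A" "f y \<in> fst c" "f y \<in> fst c'" and f: "isCont f y"
    and d: "((\<lambda>z. snd c (f z)) has_derivative D) (at y)"
  shows "((\<lambda>z. snd c' (f z)) has_derivative
    (\<lambda>u. frechet_derivative (\<lambda>w. snd c' (chart_inv c w)) (at (snd c (f y))) (D u))) (at y)"
proof -
  obtain S where S: "open S" "y \<in> S" "\<forall>z\<in>S. f z \<in> fst c \<inter> fst c'"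
    using isCont_open[OF f open_Int[OF chartD(1)[OF c(1)] chartD(1)[OF c(2)]]] c by blast
  show ?thesis
    by (rule has_derivative_transform_within_open[OF
          has_derivative_compose[OF d transition_has_derivative[OF c]] S(1,2)])
      (use S(3) chart_inv(1)[OF c(1)] in auto)
qed

lemma tcoord_has_derivative:
  assumes "c \<in> A" "p \<in> fst c"
  shows "((\<lambda>y. snd c (chart_inv (chart_at A p) y)) has_derivative tcoord A c p) (at (snd (chart_at A p) p))"
  using transition_has_derivative[OF chart_at(1) assms(1) chart_at(2) assms(2)]
  unfolding tcoord_def[abs_def] .

lemma tvec_has_derivative:
  assumes "c \<in> A" "p \<in> fst c"
  shows "((\<lambda>y. snd (chart_at A p) (chart_inv c y)) has_derivative tvec A c p) (at (snd c p))"
  using transition_has_derivative[OF assms(1) chart_at(1) assms(2) chart_at(2)]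
  unfolding tvec_def[abs_def] .

lemma linear_tvec: "c \<in> A \<Longrightarrow> p \<in> fst c \<Longrightarrow> linear (tvec A c p)"
  by (rule has_derivative_linear[OF tvec_has_derivative])

lemma isCont_chart_inv: "c \<in> A \<Longrightarrow> p \<in> fst c \<Longrightarrow> isCont (chart_inv c) (snd c p)"
  using chartD(2,4)[of c] chart_inv(4)[of c p] by (simp add: continuous_on_eq_continuous_at)

lemma chart_inv_self_derivative:
  assumes "c \<in> A" "p \<in> fst c"
  shows "((\<lambda>y. snd c (chart_inv c y)) has_derivative (\<lambda>u. u)) (at (snd c p))"
  by (rule has_derivative_transform_within_open[OF has_derivative_ident chartD(2)[OF assms(1)]])
    (use assms chart_inv in auto)

text \<open>Passing from the chart chosen at \<open>p\<close> to \<open>c\<close> and back is the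
  identity near the coordinates of \<open>p\<close>; its derivative is computed by the chain
  rule.\<close>

lemma tvec_tcoord:
  assumes c: "c \<in> A" "p \<in> fst c"
  shows "tvec A c p (tcoord A c p v) = v"
proof -
  let ?d = "chart_at A p"
  note d = chart_at[of p] and e = chart_inv(1)[OF chart_at]
  have "((\<lambda>y. snd ?d (chart_inv ?d y)) has_derivative (\<lambda>u. tvec A c p (tcoord A c p u))) (at (snd ?d p))"
    unfolding tvec_def
    using chart_change_derivative[OF c(1) d(1) _ _ isCont_chart_inv[OF d] tcoord_has_derivative[OF c], unfolded e]
      c d by simp
  from has_derivative_unique[OF this chart_inv_self_derivative[OF d]] show ?thesis by metis
qed

lemma pdiffD: "pdiff A f y \<Longrightarrow> isCont f y"
  "pdiff A f y \<Longrightarrow> c \<in> A \<Longrightarrow> f y \<in> fst c \<Longrightarrow>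
    ((\<lambda>z. snd c (f z)) has_derivative frechet_derivative (\<lambda>z. snd c (f z)) (at y)) (at y)"
  by (auto simp: pdiff_def frechet_derivative_works)

lemma pdiffI:
  assumes "isCont f y" "c \<in> A" "f y \<in> fst c" "((\<lambda>z. snd c (f z)) has_derivative D) (at y)"
  shows "pdiff A f y"
  unfolding pdiff_def differentiable_def
  using assms(1) chart_change_derivative[OF assms(2) _ assms(3) _ assms(1,4)] by blast

lemma diff_into_has_derivative:
  "pdiff A f y \<Longrightarrow> ((\<lambda>z. snd (chart_at A (f y)) (f z)) has_derivative diff_into A f y) (at y)"
  using pdiffD(2)[OF _ chart_at, of f y] unfolding diff_into_def[abs_def] .

lemma linear_diff_into: "pdiff A f y \<Longrightarrow> linear (diff_into A f y)"
  by (rule has_derivative_linear[OF diff_into_has_derivative])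

lemma coord_has_derivative:
  assumes "pdiff A f y" "c \<in> A" "f y \<in> fst c"
  shows "((\<lambda>z. snd c (f z)) has_derivative (\<lambda>u. tcoord A c (f y) (diff_into A f y u))) (at y)"
  unfolding tcoord_def
  by (rule chart_change_derivative[OF chart_at(1) assms(2) chart_at(2) assms(3) pdiffD(1)[OF assms(1)]
        diff_into_has_derivative[OF assms(1)]])

lemma diff_into_eq_tvec:
  assumes "pdiff A f y" "c \<in> A" "f y \<in> fst c" "((\<lambda>z. snd c (f z)) has_derivative D) (at y)"
  shows "diff_into A f y u = tvec A c (f y) (D u)"
  using has_derivative_unique[OF assms(4) coord_has_derivative[OF assms(1-3)]] tvec_tcoord[OF assms(2,3)]
  by metis

lemma pdiff_cong:
  assumes "pdiff A f y" "open S" "y \<in> S" "\<And>z. z \<in> S \<Longrightarrow> f z = g z"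
  shows "pdiff A g y" "diff_into A g y = diff_into A f y"
proof -
  have "\<forall>\<^sub>F z in nhds y. f z = g z" unfolding eventually_nhds using assms(2-4) by blast
  from isCont_cong[OF this] have "isCont g y" using pdiffD(1)[OF assms(1)] by simp
  moreover have d: "((\<lambda>z. snd (chart_at A (f y)) (g z)) has_derivative diff_into A f y) (at y)"
    by (rule has_derivative_transform_within_open[OF diff_into_has_derivative[OF assms(1)] assms(2,3)])
      (simp add: assms(4))
  ultimately show g: "pdiff A g y"
    using assms(3,4) by (intro pdiffI[OF _ chart_at]) auto
  show "diff_into A g y = diff_into A f y"
    using frechet_derivative_eqI[OF d] assms(3,4) by (simp add: diff_into_def[abs_def])
qed

lemma pdiff_compose:
  assumes "pdiff A f (h y)" "(h has_derivative D) (at y)"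
  shows "pdiff A (\<lambda>z. f (h z)) y" "diff_into A (\<lambda>z. f (h z)) y u = diff_into A f (h y) (D u)"
proof -
  have d: "((\<lambda>z. snd (chart_at A (f (h y))) (f (h z))) has_derivative (\<lambda>u. diff_into A f (h y) (D u))) (at y)"
    by (rule has_derivative_compose[OF assms(2) diff_into_has_derivative[OF assms(1)]])
  then show "pdiff A (\<lambda>z. f (h z)) y"
    using pdiffD(1)[OF assms(1)] has_derivative_continuous[OF assms(2)] chart_at
    by (intro pdiffI) (auto intro: isCont_o2)
  show "diff_into A (\<lambda>z. f (h z)) y u = diff_into A f (h y) (D u)"
    using frechet_derivative_eqI[OF d] by (simp add: diff_into_def)
qed

lemma mdiff_eq_diff_into:
  "mdiff A f x = diff_into A (\<lambda>z. f (chart_inv (chart_at A x) z)) (snd (chart_at A x) x)"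
  by (simp add: mdiff_def[abs_def] diff_into_def[abs_def] chart_inv(1)[OF chart_at])

lemma linear_mdiff: "mpdiff A f x \<Longrightarrow> linear (mdiff A f x)"
  unfolding mpdiff_def mdiff_eq_diff_into by (rule linear_diff_into)

text \<open>Near \<open>y\<close> the composite factors through the chart chosen at
  \<open>f y\<close>, the one in which \<open>mdiff A F (f y)\<close> is computed. The factorization
  fails outside the chart domain, hence the passage to a neighbourhood by
  \<open>pdiff_cong\<close>.\<close>

lemma mdiff_compose:
  assumes f: "pdiff A f y" and F: "mpdiff A F (f y)"
  shows "pdiff A (\<lambda>z. F (f z)) y" "diff_into A (\<lambda>z. F (f z)) y u = mdiff A F (f y) (diff_into A f y u)"
proof -
  let ?c = "chart_at A (f y)"
  let ?G = "\<lambda>z. F (chart_inv ?c z)"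
  have G: "pdiff A ?G (snd ?c (f y))" using F by (simp add: mpdiff_def)
  note pc = pdiff_compose[OF G diff_into_has_derivative[OF f]]
  obtain S where S: "open S" "y \<in> S" "\<forall>z\<in>S. f z \<in> fst ?c"
    using isCont_open[OF pdiffD(1)[OF f] chartD(1)[OF chart_at(1)] chart_at(2)] by blast
  have e: "\<And>z. z \<in> S \<Longrightarrow> ?G (snd ?c (f z)) = F (f z)" using S(3) chart_inv(1)[OF chart_at(1)] by simp
  show "pdiff A (\<lambda>z. F (f z)) y" by (rule pdiff_cong(1)[OF pc(1) S(1,2) e])
  show "diff_into A (\<lambda>z. F (f z)) y u = mdiff A F (f y) (diff_into A f y u)"
    using pdiff_cong(2)[OF pc(1) S(1,2) e] pc(2)[of u] by (simp add: mdiff_eq_diff_into)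
qed

section \<open>Smooth maps into the manifold\<close>

lemma smooth_into_preimage_open: "smooth_into A W f \<Longrightarrow> open W \<Longrightarrow> open B \<Longrightarrow> open (W \<inter> f -` B)"
  by (auto simp: smooth_into_def intro: continuous_open_preimage)

lemma smooth_into_pdiff:
  assumes "smooth_into A W f" "open W" "y \<in> W"
  shows "pdiff A f y"
proof (rule pdiffI[OF _ chart_at])
  show "isCont f y"
    using assms by (auto simp: smooth_into_def continuous_on_eq_continuous_at)
  show "((\<lambda>z. snd (chart_at A (f y)) (f z)) has_derivative
      frechet_derivative (\<lambda>z. snd (chart_at A (f y)) (f z)) (at y)) (at y)"
    by (rule smooth_on_has_derivative[of "W \<inter> f -` fst (chart_at A (f y))"])
      (use assms chart_at in \<open>auto simp: smooth_into_def\<close>)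
qed

text \<open>One chart around each value suffices, since every other chart is reached through a
  smooth transition map.\<close>

lemma smooth_into_localI:
  assumes "\<And>x. x \<in> S \<Longrightarrow> \<exists>U c. open U \<and> x \<in> U \<and> c \<in> A \<and> continuous_on U f \<and> f ` U \<subseteq> fst c \<and> smooth_on U (\<lambda>z. snd c (f z))"
  shows "smooth_into A S f"
  unfolding smooth_into_def
proof (intro conjI ballI)
  show "continuous_on S f"
    using assms by (metis continuous_at_imp_continuous_on continuous_on_eq_continuous_at)
  fix c' assume c': "c' \<in> A"
  show "smooth_on (S \<inter> f -` fst c') (\<lambda>y. snd c' (f y))"
  proof (rule smooth_on_local)
    fix x assume x: "x \<in> S \<inter> f -` fst c'"
    then obtain U c where U: "open U" "x \<in> U" "c \<in> A" "continuous_on U f" "f ` U \<subseteq> fst c" "smooth_on U (\<lambda>z. snd c (f z))"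
      using assms by blast
    let ?U = "U \<inter> f -` fst c'"
    have o: "open ?U" by (rule continuous_open_preimage[OF U(4,1) chartD(1)[OF c']])
    have "smooth_on ?U (\<lambda>z. snd c' (chart_inv c (snd c (f z))))"
      by (rule smooth_on_compose[OF o open_chart_image[OF U(3) chartD(1)[OF c']] _ smooth_on_subset[OF U(6)]
            smooth_transition[OF U(3) c']]) (use U(5) in auto)
    then have "smooth_on ?U (\<lambda>z. snd c' (f z))"
      by (rule smooth_on_cong[OF o]) (use U(5) chart_inv(1)[OF U(3)] in auto)
    with o U(2) x show "\<exists>U. open U \<and> x \<in> U \<and> smooth_on U (\<lambda>y. snd c' (f y))" by blast
  qed
qed

lemma smooth_into_compose:
  fixes h :: "'a::real_normed_vector \<Rightarrow> 'c::euclidean_space"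
  assumes f: "smooth_into A W f" "open W" and h: "smooth_on S h" "open S" "h ` S \<subseteq> W"
  shows "smooth_into A S (\<lambda>z. f (h z))"
  unfolding smooth_into_def
proof (intro conjI ballI)
  show c: "continuous_on S (\<lambda>z. f (h z))"
    using f h by (auto simp: smooth_into_def intro: continuous_on_compose2 smooth_on_continuous_on)
  fix c' assume c': "c' \<in> A"
  show "smooth_on (S \<inter> (\<lambda>z. f (h z)) -` fst c') (\<lambda>y. snd c' (f (h y)))"
    by (rule smooth_on_compose[OF continuous_open_preimage[OF c h(2) chartD(1)[OF c']]
          smooth_into_preimage_open[OF f chartD(1)[OF c']] _ smooth_on_subset[OF h(1)]])
      (use h f c' in \<open>auto simp: smooth_into_def\<close>)
qed

lemma smooth_into_subset: "smooth_into A W f \<Longrightarrow> U \<subseteq> W \<Longrightarrow> smooth_into A U f"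
  unfolding smooth_into_def by (blast intro: smooth_on_subset continuous_on_subset)

lemma smooth_into_chart_inv: "c \<in> A \<Longrightarrow> smooth_into A (chart_img c) (chart_inv c)"
proof (rule smooth_into_localI)
  fix x assume c: "c \<in> A" and x: "x \<in> chart_img c"
  show "\<exists>U c'. open U \<and> x \<in> U \<and> c' \<in> A \<and> continuous_on U (chart_inv c) \<and> chart_inv c ` U \<subseteq> fst c' \<and>
      smooth_on U (\<lambda>z. snd c' (chart_inv c z))"
    using c x chartD[OF c] chart_inv[OF c] smooth_transition[OF c c]
    by (intro exI[of _ "chart_img c"] exI[of _ c]) (auto simp: chart_img_def)
qed

lemma pdiff_chart_inv:
  assumes "c \<in> A" "p \<in> fst c"
  shows "pdiff A (chart_inv c) (snd c p)" "diff_into A (chart_inv c) (snd c p) u = tvec A c p u"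
proof -
  show p: "pdiff A (chart_inv c) (snd c p)"
    using smooth_into_pdiff[OF smooth_into_chart_inv chartD(2)] chart_inv(4) assms by blast
  show "diff_into A (chart_inv c) (snd c p) u = tvec A c p u"
    using diff_into_eq_tvec[OF p assms(1), of "\<lambda>u. u" u] chart_inv_self_derivative[OF assms] chart_inv(1)[OF assms] assms
    by simp
qed

end

section \<open>Local flows\<close>

locale flow = manifold A for A :: "('m::{t2_space, second_countable_topology}, 'b::euclidean_space) chart set" +
  fixes N N0 :: "'m set" and X :: "'m \<Rightarrow> 'b" and \<epsilon> :: real and F :: "real \<Rightarrow> 'm \<Rightarrow> 'm"
  assumes local_flow: "local_flow A N X N0 \<epsilon> F"
begin

abbreviation "I \<equiv> {-\<epsilon><..<\<epsilon>}"

lemma flowD: "0 < \<epsilon>" "open N0" "x \<in> N0 \<Longrightarrow> F 0 x = x"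
  "c \<in> A \<Longrightarrow> smooth_into A (I \<times> (snd c ` (fst c \<inter> N0))) (\<lambda>(t, y). F t (chart_inv c y))"
  "x \<in> N0 \<Longrightarrow> t \<in> I \<Longrightarrow> ((\<lambda>s. snd (chart_at A (F t x)) (F s x)) has_vector_derivative X (F t x)) (at t)"
  "x \<in> N0 \<Longrightarrow> \<bar>s\<bar> < \<epsilon> \<Longrightarrow> \<bar>t\<bar> < \<epsilon> \<Longrightarrow> \<bar>s + t\<bar> < \<epsilon> \<Longrightarrow> F s x \<in> N0 \<Longrightarrow> F t (F s x) = F (s + t) x"
  using local_flow unfolding local_flow_def by blast+

lemma continuous_on_flow: "continuous_on (I \<times> N0) (\<lambda>(t, x). F t x)"
proof (rule continuous_at_imp_continuous_on, clarify)
  fix t x assume tx: "t \<in> I" "x \<in> N0"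
  let ?c = "chart_at A x"
  let ?U = "fst ?c \<inter> N0"
  note c = chart_at[of x]
  have o: "open ?U" using chartD(1)[OF c(1)] flowD(2) by auto
  have 1: "continuous_on (I \<times> ?U) (\<lambda>p. (fst p, snd ?c (snd p)))"
    by (intro continuous_on_Pair continuous_on_fst continuous_on_id continuous_on_compose2[OF chartD(3)[OF c(1)] continuous_on_snd]) auto
  have 2: "continuous_on (I \<times> (snd ?c ` ?U)) (\<lambda>(t, y). F t (chart_inv ?c y))"
    using flowD(4)[OF c(1)] by (simp add: smooth_into_def)
  have "continuous_on (I \<times> ?U) (\<lambda>p. (\<lambda>(t, y). F t (chart_inv ?c y)) (fst p, snd ?c (snd p)))"
    by (rule continuous_on_compose2[OF 2 1]) auto
  then have "continuous_on (I \<times> ?U) (\<lambda>(t, x). F t x)"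
    by (rule continuous_on_eq) (auto simp: chart_inv(1)[OF c(1)])
  moreover have "open (I \<times> ?U)" by (intro open_Times o) auto
  ultimately show "isCont (\<lambda>(t, x). F t x) (t, x)"
    using tx c by (auto simp: continuous_on_eq_continuous_at)
qed

text \<open>The image of \<open>f\<close> need not lie in one chart, while smoothness of the flow is
  given chart by chart. It is therefore checked near each \<open>(t, y)\<close>, with the chart at
  \<open>f y\<close> for the source and the chart at \<open>F t (f y)\<close> for the
  target.\<close>

lemma smooth_into_flow_compose:
  fixes f :: "'a::euclidean_space \<Rightarrow> 'm"
  assumes f: "smooth_into A W f" "open W" "f ` W \<subseteq> N0"
  shows "smooth_into A (I \<times> W) (\<lambda>(t, y). F t (f y))"
proof -
  have "smooth_into A (I \<times> W) (\<lambda>p. F (fst p) (f (snd p)))"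
  proof (rule smooth_into_localI, clarify)
    fix t y assume ty: "t \<in> I" "y \<in> W"
    let ?c = "chart_at A (f y)" let ?d = "chart_at A (F t (f y))"
    note c = chart_at[of "f y"] and d = chart_at[of "F t (f y)"]
    let ?W = "W \<inter> f -` fst ?c"
    let ?H = "\<lambda>(t, y). F t (chart_inv ?c y)"
    let ?h = "\<lambda>p. (fst p, snd ?c (f (snd p)))"
    have W: "open ?W" by (rule smooth_into_preimage_open[OF f(1,2) chartD(1)[OF c(1)]])
    have IW: "open (I \<times> ?W)" by (intro open_Times W) auto
    have B: "open (I \<times> (snd ?c ` (fst ?c \<inter> N0)))"
      by (intro open_Times open_chart_image[OF c(1) flowD(2)]) auto
    have fc: "smooth_on ?W (\<lambda>y. snd ?c (f y))" using f(1) c by (simp add: smooth_into_def)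
    have "smooth_on (I \<times> ?W) (\<lambda>p. snd ?c (f (snd p)))"
      by (rule smooth_on_compose[OF IW W _ smooth_on_bounded_linear[OF bounded_linear_snd IW] fc]) auto
    then have h: "smooth_on (I \<times> ?W) ?h"
      by (intro smooth_on_Pair IW smooth_on_bounded_linear[OF bounded_linear_fst])
    have "smooth_into A (I \<times> ?W) (\<lambda>p. ?H (?h p))"
      by (rule smooth_into_compose[OF flowD(4)[OF c(1)] B h IW]) (use f(3) in auto)
    moreover have e: "?H (?h p) = F (fst p) (f (snd p))" if "p \<in> I \<times> ?W" for p
      using that by (auto simp: chart_inv(1)[OF c(1)])
    ultimately have cont: "continuous_on (I \<times> ?W) (\<lambda>p. F (fst p) (f (snd p)))"
      and sm: "smooth_on (I \<times> ?W \<inter> (\<lambda>p. ?H (?h p)) -` fst ?d) (\<lambda>p. snd ?d (?H (?h p)))"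
      and op: "open (I \<times> ?W \<inter> (\<lambda>p. ?H (?h p)) -` fst ?d)"
      using d chartD(1)[OF d(1)] smooth_into_preimage_open[OF _ IW]
      by (auto simp: smooth_into_def cong: continuous_on_cong)
    let ?U = "I \<times> ?W \<inter> (\<lambda>p. ?H (?h p)) -` fst ?d"
    have "smooth_on ?U (\<lambda>p. snd ?d (F (fst p) (f (snd p))))"
      by (rule smooth_on_cong[OF op sm]) (use e in auto)
    moreover have "continuous_on ?U (\<lambda>p. F (fst p) (f (snd p)))"
      by (rule continuous_on_subset[OF cont]) auto
    moreover have "(\<lambda>p. F (fst p) (f (snd p))) ` ?U \<subseteq> fst ?d" using e by auto
    moreover have "(t, y) \<in> ?U" using ty d c e[of "(t, y)"] by auto
    ultimately show "\<exists>U c. open U \<and> (t, y) \<in> U \<and> c \<in> A \<and> continuous_on U (\<lambda>p. F (fst p) (f (snd p))) \<and>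
        (\<lambda>p. F (fst p) (f (snd p))) ` U \<subseteq> fst c \<and> smooth_on U (\<lambda>z. snd c (F (fst z) (f (snd z))))"
      using op d by blast
  qed
  then show ?thesis by (simp add: case_prod_beta')
qed

lemma mpdiff_flow:
  assumes "x \<in> N0" "t \<in> I"
  shows "mpdiff A (F t) x"
proof -
  let ?c = "chart_at A x"
  note c = chart_at[of x]
  have "pdiff A (\<lambda>(t, y). F t (chart_inv ?c y)) (t, snd ?c x)"
    by (rule smooth_into_pdiff[OF flowD(4)[OF c(1)]])
      (use assms c in \<open>auto intro!: open_Times open_chart_image flowD\<close>)
  from pdiff_compose(1)[where h = "\<lambda>y. (t, y)", OF this, of "\<lambda>u. (0, u)"] show ?thesis
    unfolding mpdiff_def by (simp add: has_derivative_Pair[OF has_derivative_const has_derivative_ident])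
qed

lemma flow_inverse: "x \<in> N0 \<Longrightarrow> t \<in> I \<Longrightarrow> F t x \<in> N0 \<Longrightarrow> F (- t) (F t x) = x"
  using flowD(6)[of x t "-t"] flowD(3)[of x] flowD(1) by (auto simp: abs_less_iff)

text \<open>Differentiates \<open>flow_inverse\<close>, which holds on a neighbourhood of
  \<open>x\<close> because \<open>F t\<close> stays in \<open>N0\<close> by continuity. It makes the
  differential of \<open>F t\<close> injective, hence bijective.\<close>

lemma mdiff_flow_inverse:
  assumes x: "x \<in> N0" "t \<in> I" "F t x \<in> N0"
  shows "mdiff A (F (- t)) (F t x) (mdiff A (F t) x v) = v"
proof -
  let ?c = "chart_at A x"
  note c = chart_at[of x]
  have e: "chart_inv ?c (snd ?c x) = x" by (rule chart_inv(1)[OF c])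
  note p = pdiff_chart_inv[OF c]
  have t: "- t \<in> I" using x by auto
  have m1: "mpdiff A (F t) (chart_inv ?c (snd ?c x))" unfolding e by (rule mpdiff_flow[OF x(1,2)])
  note c1 = mdiff_compose[OF p(1) m1, unfolded e]
  have m2: "mpdiff A (F (- t)) (F t (chart_inv ?c (snd ?c x)))" unfolding e by (rule mpdiff_flow[OF x(3) t])
  note c2 = mdiff_compose[OF c1(1) m2, unfolded e c1(2)]
  have "isCont (\<lambda>z. F t (chart_inv ?c z)) (snd ?c x)" by (rule pdiffD(1)[OF c1(1)])
  then obtain S where S: "open S" "snd ?c x \<in> S" "\<forall>z\<in>S. F t (chart_inv ?c z) \<in> N0"
    using isCont_open[OF _ flowD(2)] x(3) e by metis
  let ?S = "S \<inter> snd ?c ` (fst ?c \<inter> N0)"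
  have "open ?S" using S open_chart_image[OF c(1) flowD(2)] by auto
  moreover have "snd ?c x \<in> ?S" using S c x by auto
  moreover have "F (- t) (F t (chart_inv ?c z)) = chart_inv ?c z" if "z \<in> ?S" for z
    using that S flow_inverse x(2) chart_inv(1)[OF c(1)] by auto
  ultimately have "diff_into A (chart_inv ?c) (snd ?c x) = diff_into A (\<lambda>z. F (- t) (F t (chart_inv ?c z))) (snd ?c x)"
    by (intro pdiff_cong(2)[OF c2(1)])
  then have "mdiff A (F (- t)) (F t x) (mdiff A (F t) x (tvec A ?c x (tcoord A ?c x v))) = tvec A ?c x (tcoord A ?c x v)"
    using c2(2) p(2) by metis
  then show ?thesis unfolding tvec_tcoord[OF c] .
qed

lemma diff_into_flow:
  fixes f :: "'a::euclidean_space \<Rightarrow> 'm"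
  assumes f: "smooth_into A W f" "open W" "f ` W \<subseteq> N0" and y: "y \<in> W" "t \<in> I"
  shows "diff_into A (\<lambda>(t, y). F t (f y)) (t, y) (0, u) = mdiff A (F t) (f y) (diff_into A f y u)"
    "diff_into A (\<lambda>(t, y). F t (f y)) (t, y) (1, 0) = X (F t (f y))"
    "diff_into A (\<lambda>y. F t (f y)) y u = mdiff A (F t) (f y) (diff_into A f y u)"
    "pdiff A (\<lambda>y. F t (f y)) y"
proof -
  have "open (I \<times> W)" by (intro open_Times f) auto
  with y have p: "pdiff A (\<lambda>(t, y). F t (f y)) (t, y)"
    by (intro smooth_into_pdiff[OF smooth_into_flow_compose[OF f]]) auto
  have fy: "f y \<in> N0" using f y by auto
  note m = mdiff_compose[OF smooth_into_pdiff[OF f(1,2) y(1)] mpdiff_flow[OF fy y(2)]]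
  show 3: "diff_into A (\<lambda>y. F t (f y)) y u = mdiff A (F t) (f y) (diff_into A f y u)"
    and "pdiff A (\<lambda>y. F t (f y)) y" using m by auto
  have "((\<lambda>z. (t, z)) has_derivative (\<lambda>u. (0, u))) (at y)"
    by (intro has_derivative_Pair has_derivative_const has_derivative_ident)
  from pdiff_compose(2)[where h = "\<lambda>z. (t, z)", OF p this, of u]
  show "diff_into A (\<lambda>(t, y). F t (f y)) (t, y) (0, u) = mdiff A (F t) (f y) (diff_into A f y u)"
    using 3 by simp
  have d: "((\<lambda>s. (s, y)) has_derivative (\<lambda>h. (h, 0))) (at t)"
    by (intro has_derivative_Pair has_derivative_const has_derivative_ident)
  from pdiff_compose(2)[where h = "\<lambda>s. (s, y)", OF p this, of 1]
  have "diff_into A (\<lambda>(t, y). F t (f y)) (t, y) (1, 0) = diff_into A (\<lambda>s. F s (f y)) t 1" by simp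
  also have "\<dots> = X (F t (f y))"
    using flowD(5)[OF fy y(2)] unfolding has_vector_derivative_def diff_into_def
    by (drule_tac frechet_derivative_eqI) simp
  finally show "diff_into A (\<lambda>(t, y). F t (f y)) (t, y) (1, 0) = X (F t (f y))" .
qed

end

section \<open>Change of variables\<close>

text \<open>
  The change of variables theorem of the library needs a well-ordered index type; every finite type
  has a well-ordered copy.
\<close>

typedef 'k ordered_copy = "UNIV :: 'k set" morphisms of_copy to_copy ..

lemma of_copy_to_copy [simp]: "of_copy (to_copy i) = i" "to_copy (of_copy j) = j"
  by (simp_all add: to_copy_inverse of_copy_inverse)

lemma inj_to_copy [simp]: "to_copy i = to_copy j \<longleftrightarrow> i = j"
  by (metis of_copy_to_copy(1))

lemma bij_of_copy: "bij of_copy"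
  by (rule o_bij[of to_copy]) (auto simp: fun_eq_iff)

definition copy_index :: "'k::finite ordered_copy \<Rightarrow> nat" where
  "copy_index = (SOME f. inj f) \<circ> of_copy"

lemma inj_copy_index: "inj copy_index"
proof -
  have "\<exists>f :: 'a \<Rightarrow> nat. inj f" by (metis finite_imp_inj_to_nat_seg finite_code)
  from someI_ex[OF this] show ?thesis
    unfolding copy_index_def by (intro inj_compose) (auto intro: bij_is_inj bij_of_copy)
qed

instance ordered_copy :: (finite) finite
proof
  have "(UNIV :: 'a ordered_copy set) = range to_copy" using of_copy_to_copy(2) by (metis surjI)
  then show "finite (UNIV :: 'a ordered_copy set)" by (metis finite finite_imageI)
qed

instantiation ordered_copy :: (finite) wellorder
begin

definition less_eq_ordered_copy :: "'a ordered_copy \<Rightarrow> 'a ordered_copy \<Rightarrow> bool" where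
  "less_eq_ordered_copy a b \<longleftrightarrow> copy_index a \<le> copy_index b"

definition less_ordered_copy :: "'a ordered_copy \<Rightarrow> 'a ordered_copy \<Rightarrow> bool" where
  "less_ordered_copy a b \<longleftrightarrow> copy_index a < copy_index b"

instance
proof
  fix P :: "'a ordered_copy \<Rightarrow> bool" and a
  assume "\<And>x. (\<And>y. y < x \<Longrightarrow> P y) \<Longrightarrow> P x"
  then show "P a" unfolding less_ordered_copy_def by (induct a rule: measure_induct_rule[of copy_index]) blast
qed (auto simp: less_eq_ordered_copy_def less_ordered_copy_def dest: injD[OF inj_copy_index])

end

definition copy_vec :: "real^'k::finite \<Rightarrow> real^'k ordered_copy" where
  "copy_vec x = (\<chi> i. x $ of_copy i)"

definition uncopy_vec :: "real^'k::finite ordered_copy \<Rightarrow> real^'k" where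
  "uncopy_vec x = (\<chi> i. x $ to_copy i)"

lemma copy_vec_simps [simp]: "copy_vec (uncopy_vec x) = x" "uncopy_vec (copy_vec y) = y"
  "copy_vec w $ i = w $ of_copy i" "uncopy_vec z $ j = z $ to_copy j"
  by (simp_all add: copy_vec_def uncopy_vec_def vec_eq_iff)

lemma bounded_linear_copy_vec: "bounded_linear copy_vec" "bounded_linear uncopy_vec"
  by (auto intro!: linearI simp: linear_conv_bounded_linear[symmetric] vec_eq_iff)

lemma prod_Basis_cart: "(\<Prod>b\<in>Basis. f b) = (\<Prod>i\<in>UNIV. f (axis i 1))"
  for f :: "real^'n::finite \<Rightarrow> real"
proof -
  have "(Basis :: (real^'n) set) = range (\<lambda>i. axis i 1)" by (auto simp: Basis_vec_def)
  moreover have "inj (\<lambda>i::'n. axis i (1::real))" by (auto intro!: injI simp: axis_eq_axis)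
  from prod.reindex[OF this, of f] have "prod f (range (\<lambda>i. axis i 1)) = (\<Prod>i\<in>UNIV. f (axis i 1))" by simp
  ultimately show ?thesis by metis
qed

text \<open>Relabelling coordinates preserves the volumes of boxes, and these determine Lebesgue
  measure.\<close>

lemma distr_uncopy_vec: "distr lborel borel uncopy_vec = (lborel :: (real^'k::finite) measure)"
proof (rule lborel_eqI[symmetric])
  fix l u :: "real^'k"
  assume lu: "\<And>b. b \<in> Basis \<Longrightarrow> l \<bullet> b \<le> u \<bullet> b"
  then have le: "l $ i \<le> u $ i" for i
    using lu[of "axis i 1"] by (simp add: inner_axis)
  have m: "uncopy_vec \<in> borel_measurable borel"
    by (intro borel_measurable_continuous_onI linear_continuous_on bounded_linear_copy_vec)
  have "uncopy_vec -` box l u = box (copy_vec l) (copy_vec u)"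
    unfolding set_eq_iff
  proof
    fix z :: "real^'k ordered_copy"
    have "(\<forall>i. l $ i < z $ to_copy i \<and> z $ to_copy i < u $ i) \<longleftrightarrow>
        (\<forall>j. l $ of_copy j < z $ j \<and> z $ j < u $ of_copy j)"
      by (metis of_copy_to_copy)
    then show "z \<in> uncopy_vec -` box l u \<longleftrightarrow> z \<in> box (copy_vec l) (copy_vec u)"
      by (simp add: mem_box_cart)
  qed
  then have "emeasure (distr lborel borel uncopy_vec) (box l u) = emeasure lborel (box (copy_vec l) (copy_vec u))"
    using m by (subst emeasure_distr) auto
  also have "\<dots> = (\<Prod>b\<in>Basis. (copy_vec u - copy_vec l) \<bullet> b)"
    by (rule emeasure_lborel_box) (auto simp: Basis_vec_def inner_axis le)
  also have "(\<Prod>b\<in>Basis. (copy_vec u - copy_vec l) \<bullet> b) = (\<Prod>j\<in>UNIV. u $ of_copy j - l $ of_copy j)"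
    unfolding prod_Basis_cart by (simp add: inner_axis)
  also have "\<dots> = (\<Prod>i\<in>UNIV. u $ i - l $ i)"
    by (rule prod.reindex_bij_betw[OF bij_of_copy])
  also have "\<dots> = (\<Prod>b\<in>Basis. (u - l) \<bullet> b)"
    unfolding prod_Basis_cart by (simp add: inner_axis)
  finally show "emeasure (distr lborel borel uncopy_vec) (box l u) = (\<Prod>b\<in>Basis. (u - l) \<bullet> b)" .
qed simp

text \<open>As a function of the rows, the relabelled determinant is an alternating form with value
  \<open>1\<close> on the standard basis. Then \<open>alternating_form_frame_mult\<close> identifies
  it with \<open>det B\<close>, without transporting permutations and signs.\<close>

lemma det_copy: "det (\<chi> i j. B $ of_copy i $ of_copy j) = det B" for B :: "real^'k::finite^'k"
proof -
  define \<omega> :: "('k \<Rightarrow> real^'k) \<Rightarrow> real" where "\<omega> v = det (\<chi> i. copy_vec (v (of_copy i)))" for v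
  have up: "(\<chi> i. copy_vec ((v(k := u)) (of_copy i))) =
      (\<chi> i. if i = to_copy k then copy_vec u else copy_vec (v (of_copy i)))" for v k and u :: "real^'k"
    by (auto simp: vec_eq_iff)
  have "alternating_form \<omega>"
    unfolding alternating_form_def
  proof (intro conjI allI impI linearI)
    fix v k and a b :: "real^'k" and r
    show "\<omega> (v(k := a + b)) = \<omega> (v(k := a)) + \<omega> (v(k := b))"
      unfolding \<omega>_def up det_row_add[symmetric] linear_add[OF bounded_linear.linear[OF bounded_linear_copy_vec(1)]] ..
    show "\<omega> (v(k := r *\<^sub>R a)) = r *\<^sub>R \<omega> (v(k := a))"
      unfolding \<omega>_def up real_scaleR_def det_row_mul[symmetric]
        linear_cmul[OF bounded_linear.linear[OF bounded_linear_copy_vec(1)]] scalar_mult_eq_scaleR ..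
  next
    fix v :: "'k \<Rightarrow> real^'k" and i j assume "i \<noteq> j \<and> v i = v j"
    then show "\<omega> v = 0" unfolding \<omega>_def
      by (intro det_identical_rows[of "to_copy i" "to_copy j"]) (auto simp: row_def vec_eq_iff)
  qed
  from alternating_form_frame_mult[OF this, of B "\<lambda>j. axis j 1"]
  have "\<omega> (frame_mult B (\<lambda>j. axis j 1)) = det B * \<omega> (\<lambda>j. axis j 1)" by simp
  moreover have "frame_mult B (\<lambda>j. axis j 1) = (\<lambda>i. B $ i)"
  proof
    fix i show "frame_mult B (\<lambda>j. axis j 1) i = B $ i"
      using basis_expansion[of "B $ i"] by (simp add: frame_mult_def scalar_mult_eq_scaleR)
  qed
  ultimately have "\<omega> (\<lambda>i. B $ i) = det B * \<omega> (\<lambda>j. axis j 1)" by simp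
  moreover have "(\<chi> i. copy_vec (axis (of_copy i) 1)) = (mat 1 :: real^'k ordered_copy^'k ordered_copy)"
    by (auto simp: vec_eq_iff mat_def axis_def) (metis of_copy_to_copy(2))
  moreover have "(\<chi> i. copy_vec (B $ of_copy i)) = (\<chi> i j. B $ of_copy i $ of_copy j)"
    by (simp add: vec_eq_iff)
  ultimately show ?thesis by (simp add: \<omega>_def)
qed

text \<open>The finite values of a nonnegative integral are exactly those accepted by
  \<open>has_bochner_integral\<close>; if neither integral is finite, both are infinite. This
  removes integrability from the change of variables formula.\<close>

lemma nn_integral_eq_of_integrable_iff:
  fixes f :: "'a \<Rightarrow> real" and h :: "'c \<Rightarrow> real"
  assumes f: "f \<in> borel_measurable M" "\<And>x. 0 \<le> f x" and h: "h \<in> borel_measurable M'" "\<And>x. 0 \<le> h x"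
    and iff: "\<And>b. has_bochner_integral M f b \<longleftrightarrow> has_bochner_integral M' h b"
  shows "(\<integral>\<^sup>+x. f x \<partial>M) = (\<integral>\<^sup>+x. h x \<partial>M')"
proof -
  have *: "(\<integral>\<^sup>+x. f x \<partial>M) = ennreal b \<longleftrightarrow> (\<integral>\<^sup>+x. h x \<partial>M') = ennreal b" if b: "b \<ge> 0" for b
    using iff[of b] f h b
    by (metis has_bochner_integral_nn_integral has_bochner_integral_iff nn_integral_eq_integral AE_I2)
  show ?thesis
  proof (cases "\<integral>\<^sup>+x. f x \<partial>M")
    case (real r)
    then show ?thesis using *[of r] by simp
  next
    case top
    then show ?thesis using * by (cases "\<integral>\<^sup>+x. h x \<partial>M'") auto
  qed
qed

lemma has_bochner_integral_lborel_iff: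
  fixes f :: "'a::euclidean_space \<Rightarrow> real"
  assumes "(\<lambda>x. indicator S x * f x) \<in> borel_measurable borel"
  shows "has_bochner_integral lborel (\<lambda>x. indicator S x * f x) b \<longleftrightarrow>
    f absolutely_integrable_on S \<and> integral S f = b"
proof -
  have i: "integrable lborel (\<lambda>x. indicator S x * f x) \<longleftrightarrow> f absolutely_integrable_on S"
    using assms by (simp add: set_integrable_def integrable_completion)
  have "f absolutely_integrable_on S \<Longrightarrow> integral S f = integral\<^sup>L lborel (\<lambda>x. indicator S x * f x)"
    using assms by (simp add: set_lebesgue_integral_eq_integral(2)[symmetric] set_lebesgue_integral_def integral_completion)
  with i show ?thesis by (auto simp: has_bochner_integral_iff)
qed

lemma absolutely_integrable_vec1:
  fixes f :: "'a::euclidean_space \<Rightarrow> real"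
  shows "(\<lambda>x. vec (f x) :: real^1) absolutely_integrable_on S \<and> integral S (\<lambda>x. vec (f x) :: real^1) = vec b \<longleftrightarrow>
    f absolutely_integrable_on S \<and> integral S f = b"
proof -
  have L: "bounded_linear (vec :: real \<Rightarrow> real^1)" "bounded_linear (\<lambda>x::real^1. x $ 1)"
    by (auto intro!: linearI simp: linear_conv_bounded_linear[symmetric] vec_eq_iff)
  have 1: "(\<lambda>x. vec (f x) :: real^1) absolutely_integrable_on S" if "f absolutely_integrable_on S"
    using absolutely_integrable_linear[OF that L(1)] by (simp add: o_def)
  have 2: "f absolutely_integrable_on S" if "(\<lambda>x. vec (f x) :: real^1) absolutely_integrable_on S"
    using absolutely_integrable_linear[OF that L(2)] by (simp add: o_def)
  have 3: "integral S (\<lambda>x. vec (f x) :: real^1) = vec (integral S f)" if "f absolutely_integrable_on S"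
    using integral_linear[OF set_lebesgue_integral_eq_integral(1)[OF that] L(1)] by (simp add: o_def)
  show ?thesis using 1 2 3 by (metis vec_component)
qed

text \<open>\<open>v\<close> names the transformed integrand on \<open>S\<close>. Measurability is
  asked of \<open>v\<close> and not of the Jacobian, because densities on parameter domains are
  known to be continuous while \<open>s'\<close> is merely some derivative.\<close>

lemma nn_integral_change_of_variables_wellorder:
  fixes s :: "real^'m::{finite,wellorder} \<Rightarrow> real^'m::_" and u v :: "real^'m::_ \<Rightarrow> real"
  assumes S: "S \<in> sets borel"
    and s: "\<And>x. x \<in> S \<Longrightarrow> (s has_derivative s' x) (at x)" and inj: "inj_on s S"
    and v: "\<And>x. x \<in> S \<Longrightarrow> v x = \<bar>det (matrix (s' x))\<bar> * u (s x)"
    and u: "\<And>y. y \<in> s ` S \<Longrightarrow> 0 \<le> u y"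
    and um: "(\<lambda>y. indicator (s ` S) y * u y) \<in> borel_measurable borel"
    and vm: "(\<lambda>x. indicator S x * v x) \<in> borel_measurable borel"
  shows "(\<integral>\<^sup>+y. ennreal (indicator (s ` S) y * u y) \<partial>lborel) = (\<integral>\<^sup>+x. ennreal (indicator S x * v x) \<partial>lborel)"
proof (rule nn_integral_eq_of_integrable_iff)
  fix b
  let ?f = "\<lambda>x. vec (u x) :: real^1"
  have "(v absolutely_integrable_on S \<and> integral S v = b) \<longleftrightarrow>
      (\<lambda>x. vec (v x) :: real^1) absolutely_integrable_on S \<and> integral S (\<lambda>x. vec (v x) :: real^1) = vec b"
    by (rule absolutely_integrable_vec1[symmetric])
  also have "\<dots> \<longleftrightarrow> (\<lambda>x. \<bar>det (matrix (s' x))\<bar> *\<^sub>R ?f (s x)) absolutely_integrable_on S \<and>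
      integral S (\<lambda>x. \<bar>det (matrix (s' x))\<bar> *\<^sub>R ?f (s x)) = vec b"
  proof -
    have e: "vec (v x) = \<bar>det (matrix (s' x))\<bar> *\<^sub>R ?f (s x)" if "x \<in> S" for x
      using v[OF that] by (simp add: vec_eq_iff)
    then show ?thesis
      by (simp cong: set_integrable_cong integral_cong)
  qed
  also have "\<dots> \<longleftrightarrow> ?f absolutely_integrable_on s ` S \<and> integral (s ` S) ?f = vec b"
    by (rule has_absolute_integral_change_of_variables[OF _ has_derivative_at_withinI[OF s] inj]) (use S in auto)
  also have "\<dots> \<longleftrightarrow> u absolutely_integrable_on s ` S \<and> integral (s ` S) u = b"
    by (rule absolutely_integrable_vec1)
  finally show "has_bochner_integral lborel (\<lambda>y. indicator (s ` S) y * u y) b \<longleftrightarrow>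
      has_bochner_integral lborel (\<lambda>x. indicator S x * v x) b"
    using has_bochner_integral_lborel_iff[OF um] has_bochner_integral_lborel_iff[OF vm] by simp
qed (use um vm u v in \<open>auto simp: indicator_def\<close>)

text \<open>Conjugation with the relabelling of coordinates, which preserves Lebesgue measure and,
  by \<open>det_copy\<close>, the Jacobian determinant.\<close>

lemma nn_integral_change_of_variables:
  fixes s :: "real^'k::finite \<Rightarrow> real^'k" and u v :: "real^'k \<Rightarrow> real"
  assumes S: "S \<in> sets borel"
    and s: "\<And>x. x \<in> S \<Longrightarrow> (s has_derivative s' x) (at x)" and inj: "inj_on s S"
    and v: "\<And>x. x \<in> S \<Longrightarrow> v x = \<bar>det (matrix (s' x))\<bar> * u (s x)"
    and u: "\<And>y. y \<in> s ` S \<Longrightarrow> 0 \<le> u y"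
    and um: "(\<lambda>y. indicator (s ` S) y * u y) \<in> borel_measurable borel"
    and vm: "(\<lambda>x. indicator S x * v x) \<in> borel_measurable borel"
  shows "(\<integral>\<^sup>+y. ennreal (indicator (s ` S) y * u y) \<partial>lborel) = (\<integral>\<^sup>+x. ennreal (indicator S x * v x) \<partial>lborel)"
proof -
  have [measurable]: "uncopy_vec \<in> borel_measurable borel" "copy_vec \<in> borel_measurable borel"
    by (intro borel_measurable_continuous_onI linear_continuous_on bounded_linear_copy_vec)+
  have transfer: "(\<integral>\<^sup>+y. ennreal (h y) \<partial>lborel) = (\<integral>\<^sup>+z. ennreal (h (uncopy_vec z)) \<partial>lborel)"
    if [measurable]: "h \<in> borel_measurable borel" for h :: "real^'k \<Rightarrow> real"
    by (subst distr_uncopy_vec[symmetric], subst nn_integral_distr) auto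
  let ?s = "\<lambda>z. copy_vec (s (uncopy_vec z))"
  let ?S = "uncopy_vec -` S"
  have img: "?s ` ?S = uncopy_vec -` (s ` S)"
  proof (intro set_eqI iffI)
    fix z assume "z \<in> uncopy_vec -` (s ` S)"
    then obtain x where "x \<in> S" "uncopy_vec z = s x" by auto
    then show "z \<in> ?s ` ?S" by (intro image_eqI[of _ _ "copy_vec x"]) (metis copy_vec_simps(1,2), simp)
  qed auto
  have ind: "indicator (uncopy_vec -` B) z = (indicator B (uncopy_vec z) :: real)" for B and z :: "real^'k ordered_copy"
    by (simp add: indicator_def)
  have m: "matrix (\<lambda>h. copy_vec (D (uncopy_vec h))) = (\<chi> i j. matrix D $ of_copy i $ of_copy j)"
    for D :: "real^'k \<Rightarrow> real^'k"
  proof -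
    have "uncopy_vec (axis j 1) = axis (of_copy j) 1" for j :: "'k ordered_copy"
      by (auto simp: vec_eq_iff axis_def)
    then show ?thesis by (simp add: matrix_def vec_eq_iff[of "\<chi> i. _ i"] del: copy_vec_simps(4))
  qed
  have "(\<integral>\<^sup>+z. ennreal (indicator (?s ` ?S) z * u (uncopy_vec z)) \<partial>lborel) =
    (\<integral>\<^sup>+z. ennreal (indicator ?S z * v (uncopy_vec z)) \<partial>lborel)"
  proof (rule nn_integral_change_of_variables_wellorder[where s' = "\<lambda>z h. copy_vec (s' (uncopy_vec z) (uncopy_vec h))"])
    show "?S \<in> sets borel" using S measurable_sets_borel[of uncopy_vec borel S] by simp
    show "(?s has_derivative (\<lambda>h. copy_vec (s' (uncopy_vec z) (uncopy_vec h)))) (at z)" if "z \<in> ?S" for z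
      using that by (intro bounded_linear.has_derivative[OF bounded_linear_copy_vec(1)]
          has_derivative_compose[OF bounded_linear.has_derivative[OF bounded_linear_copy_vec(2) has_derivative_ident] s]) simp
    show "inj_on ?s ?S"
      by (rule inj_onI) (metis copy_vec_simps(1,2) inj inj_onD vimageE)
    show "v (uncopy_vec z) = \<bar>det (matrix (\<lambda>h. copy_vec (s' (uncopy_vec z) (uncopy_vec h))))\<bar> * u (uncopy_vec (?s z))"
      if "z \<in> ?S" for z
      using v[of "uncopy_vec z"] that by (simp add: m det_copy)
    show "0 \<le> u (uncopy_vec y)" if "y \<in> ?s ` ?S" for y
      using that u unfolding img by auto
    show "(\<lambda>y. indicator (?s ` ?S) y * u (uncopy_vec y)) \<in> borel_measurable borel"
      unfolding img ind using measurable_compose[OF _ um, of uncopy_vec borel] by simp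
    show "(\<lambda>x. indicator ?S x * v (uncopy_vec x)) \<in> borel_measurable borel"
      unfolding ind using measurable_compose[OF _ vm, of uncopy_vec borel] by simp
  qed
  then show ?thesis unfolding transfer[OF um] transfer[OF vm] img ind .
qed

text \<open>Takes the place of the inverse function theorem, continuity of \<open>s\<close> being
  known. With \<open>P\<close> a linear left inverse of \<open>G'\<close>, the map
  \<open>K = P \<circ> G\<close> has the identity as derivative at \<open>s x\<close>. So
  \<open>s z - s x\<close> differs from \<open>K (s z) - K (s x)\<close> by a small multiple of its
  own size, and \<open>K \<circ> s\<close> is differentiable.\<close>

lemma has_derivative_left_factor:
  fixes s :: "'a::real_normed_vector \<Rightarrow> 'c::euclidean_space" and G :: "'c \<Rightarrow> 'd::euclidean_space"
  assumes s: "isCont s x" and G: "(G has_derivative G') (at (s x))" "inj G'"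
    and H: "((\<lambda>z. G (s z)) has_derivative H) (at x)"
  obtains S' where "(s has_derivative S') (at x)" "\<And>u. G' (S' u) = H u"
proof -
  obtain P where P: "linear P" "P \<circ> G' = id"
    using linear_injective_left_inverse[OF has_derivative_linear[OF G(1)] G(2)] by blast
  have bP: "bounded_linear P" using P(1) by (simp add: linear_conv_bounded_linear)
  define K where "K z = P (G z)" for z
  have K: "(K has_derivative (\<lambda>u. u)) (at (s x))"
    using bounded_linear.has_derivative[OF bP G(1)] P(2) unfolding K_def by (simp add: o_def id_def fun_eq_iff)
  define S' where "S' u = P (H u)" for u
  have KS: "((\<lambda>z. K (s z)) has_derivative S') (at x)"
    unfolding K_def S'_def by (rule bounded_linear.has_derivative[OF bP H])
  have bS': "bounded_linear S'" using KS by (rule has_derivative_bounded_linear)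
  obtain C where C: "C > 0" "\<And>u. norm (S' u) \<le> norm u * C"
    using bounded_linear.pos_bounded[OF bS'] by blast
  have D: "(s has_derivative S') (at x)"
    unfolding has_derivative_at_alt
  proof (intro conjI bS' allI impI)
    fix e :: real assume e: "e > 0"
    \<comment> \<open>The bound \<open>1/2\<close> lets the remainder be absorbed into
      \<open>norm (s z - s x)\<close>, giving a Lipschitz estimate with constant
      \<open>2 * (C + 1)\<close>; the other bound then makes the same remainder at most
      \<open>e/2 * norm (z - x)\<close>.\<close>
    define e1 where "e1 = min (1/2) (e / (4 * (C + 1)))"
    define e2 where "e2 = min 1 (e / 2)"
    have e1: "e1 > 0" "e1 \<le> 1/2" "e1 * (2 * (C + 1)) \<le> e/2"
    proof -
      show "e1 > 0" using e C by (simp add: e1_def)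
      show "e1 \<le> 1/2" unfolding e1_def by (rule min.cobounded1)
      have "e1 \<le> e / (4 * (C + 1))" by (simp add: e1_def)
      then show "e1 * (2 * (C + 1)) \<le> e/2" using C by (simp add: field_simps)
    qed
    have e2: "e2 > 0" "e2 \<le> 1" "e2 \<le> e/2" using e by (auto simp: e2_def)
    obtain d1 where d1: "d1 > 0" "\<And>y. norm (y - s x) < d1 \<Longrightarrow> norm (K y - K (s x) - (y - s x)) \<le> e1 * norm (y - s x)"
      using K e1(1) unfolding has_derivative_at_alt by blast
    obtain d2 where d2: "d2 > 0" "\<And>z. norm (z - x) < d2 \<Longrightarrow> norm (K (s z) - K (s x) - S' (z - x)) \<le> e2 * norm (z - x)"
      using KS e2(1) unfolding has_derivative_at_alt by blast
    obtain d3 where d3: "d3 > 0" "\<And>z. norm (z - x) < d3 \<Longrightarrow> norm (s z - s x) < d1"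
      using s d1(1) unfolding continuous_at_eps_delta dist_norm by blast
    show "\<exists>d>0. \<forall>z. norm (z - x) < d \<longrightarrow> norm (s z - s x - S' (z - x)) \<le> e * norm (z - x)"
    proof (intro exI[of _ "min d2 d3"] conjI allI impI)
      show "0 < min d2 d3" using d2 d3 by simp
      fix z assume z: "norm (z - x) < min d2 d3"
      let ?r = "K (s z) - K (s x) - (s z - s x)" and ?q = "K (s z) - K (s x) - S' (z - x)"
      have r: "norm ?r \<le> e1 * norm (s z - s x)" using d1(2)[OF d3(2)] z by simp
      have q: "norm ?q \<le> e2 * norm (z - x)" using d2(2) z by simp
      have "norm (s z - s x) \<le> norm ?q + norm (S' (z - x)) + norm ?r"
        using norm_triangle_ineq4[of "?q + S' (z - x)" ?r] norm_triangle_ineq[of ?q "S' (z - x)"]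
        by (simp add: algebra_simps)
      also have "\<dots> \<le> 1 * norm (z - x) + norm (z - x) * C + (1/2) * norm (s z - s x)"
      proof (intro add_mono C(2))
        show "norm ?q \<le> 1 * norm (z - x)" using q e2(2) by (meson mult_right_mono norm_ge_zero order_trans)
        show "norm ?r \<le> (1/2) * norm (s z - s x)" using r e1(2) by (meson mult_right_mono norm_ge_zero order_trans)
      qed
      finally have b: "norm (s z - s x) \<le> 2 * (C + 1) * norm (z - x)" by (simp add: algebra_simps)
      have "norm (s z - s x - S' (z - x)) \<le> norm ?q + norm ?r"
        using norm_triangle_ineq4[of ?q ?r] by (simp add: algebra_simps)
      also have "\<dots> \<le> (e/2) * norm (z - x) + e1 * (2 * (C + 1) * norm (z - x))"
      proof (rule add_mono)
        show "norm ?q \<le> (e/2) * norm (z - x)" using q e2(3) by (meson mult_right_mono norm_ge_zero order_trans)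
        show "norm ?r \<le> e1 * (2 * (C + 1) * norm (z - x))"
          by (rule order_trans[OF r mult_left_mono[OF b]]) (use e1(1) in simp)
      qed
      also have "\<dots> \<le> (e/2) * norm (z - x) + (e/2) * norm (z - x)"
        using mult_right_mono[OF e1(3) norm_ge_zero[of "z - x"]] by (simp add: mult.assoc)
      finally show "norm (s z - s x - S' (z - x)) \<le> e * norm (z - x)" by (simp add: algebra_simps)
    qed
  qed
  show thesis
  proof (rule that[OF D])
    fix u show "G' (S' u) = H u"
      using has_derivative_unique[OF has_derivative_compose[OF D G(1)] H] by metis
  qed
qed

section \<open>Riemannian volume of compact submanifolds\<close>

text \<open>Members of the cover are indexed by data \<open>z\<close>, such as a parametrization
  together with a chart or a cut-off function, so that a finite subcover comes with its data already
  chosen.\<close>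

lemma compact_finite_openin_cover:
  assumes "compact L" "\<And>p. p \<in> L \<Longrightarrow> \<exists>z. Q z \<and> openin (top_of_set L) (im z) \<and> p \<in> im z"
  obtains n and z :: "nat \<Rightarrow> 'z" where "\<And>i. i < n \<Longrightarrow> Q (z i)" "L = (\<Union>i<n. im (z i))"
proof -
  define C where "C = {im z | z. Q z \<and> openin (top_of_set L) (im z)}"
  have "(\<forall>c\<in>C. openin (top_of_set L) c) \<and> L \<subseteq> \<Union>C"
    unfolding C_def using assms(2) by blast
  then obtain D where D: "D \<subseteq> C" "finite D" "L \<subseteq> \<Union>D"
    using assms(1) unfolding compact_eq_openin_cover by meson
  obtain n and e :: "nat \<Rightarrow> _" where e: "D = e ` {i. i < n}"
    using finite_imp_nat_seg_image_inj_on[OF D(2)] by blast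
  have "\<exists>z. Q z \<and> openin (top_of_set L) (im z) \<and> e i = im z" if "i < n" for i
    using D(1) e that unfolding C_def by blast
  then obtain z where z: "\<And>i. i < n \<Longrightarrow> Q (z i) \<and> openin (top_of_set L) (im (z i)) \<and> e i = im (z i)"
    by metis
  show thesis
  proof (rule that[of n z])
    show "L = (\<Union>i<n. im (z i))"
    proof
      show "L \<subseteq> (\<Union>i<n. im (z i))" using D(3) e z by auto
      show "(\<Union>i<n. im (z i)) \<subseteq> L" using z openin_imp_subset by blast
    qed
  qed (use z in blast)
qed

definition volume_density ::
  "('m::topological_space, 'b::euclidean_space) chart set \<Rightarrow> ('m \<Rightarrow> 'b \<Rightarrow> 'b \<Rightarrow> real) \<Rightarrow>
     (real^'k \<Rightarrow> 'm) \<Rightarrow> real^'k::finite \<Rightarrow> real" where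
  "volume_density A g f y = kvec_norm (g (f y)) (coord_frame A f y)"

definition param_measure ::
  "('m::topological_space, 'b::euclidean_space) chart set \<Rightarrow> ('m \<Rightarrow> 'b \<Rightarrow> 'b \<Rightarrow> real) \<Rightarrow>
     (real^'k) set \<Rightarrow> (real^'k \<Rightarrow> 'm) \<Rightarrow> (real^'k::finite) measure" where
  "param_measure A g W f = density lborel (\<lambda>y. ennreal (indicator W y * volume_density A g f y))"

lemma local_paramD:
  assumes "local_param A L W f"
  shows "open W" "smooth_into A W f" "\<And>y. y \<in> W \<Longrightarrow> inj (diff_into A f y)"
    "homeomorphism W (f ` W) f (inv_into W f)" "openin (top_of_set L) (f ` W)"
    "inj_on f W" "f ` W \<subseteq> L" "continuous_on W f" "continuous_on (f ` W) (inv_into W f)"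
proof -
  show "inj_on f W" using assms unfolding local_param_def homeomorphism_def by (metis inj_on_def)
  show "f ` W \<subseteq> L" using assms openin_imp_subset unfolding local_param_def by blast
qed (use assms in \<open>auto simp: local_param_def homeomorphism_def\<close>)

text \<open>The image of \<open>U\<close> is open in the image of \<open>W\<close> because
  \<open>f\<close> is a homeomorphism, and the latter is open in \<open>L\<close>.\<close>

lemma local_param_restrict:
  assumes f: "local_param A L W f" and U: "open U" "U \<subseteq> W"
  shows "local_param A L U f"
proof -
  note D = local_paramD[OF f]
  have inj: "inj_on f U" using D(6) U(2) by (rule inj_on_subset)
  have eq: "inv_into U f x = inv_into W f x" if "x \<in> f ` U" for x
    using that inj D(6) U(2) by (auto simp: inv_into_f_f)
  have "continuous_on (f ` U) (inv_into W f)" by (rule continuous_on_subset[OF D(9)]) (use U(2) in auto)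
  then have c: "continuous_on (f ` U) (inv_into U f)" by (rule continuous_on_eq) (simp add: eq)
  have "openin (top_of_set W) U" using U D(1) by (simp add: openin_open_eq)
  then have "openin (top_of_set (f ` W)) (f ` U)" by (rule homeomorphism_imp_open_map[OF D(4)])
  then have o: "openin (top_of_set L) (f ` U)" using D(5) by (rule openin_trans)
  have "smooth_into A U f"
    using D(2) U(2) unfolding smooth_into_def by (blast intro: smooth_on_subset continuous_on_subset)
  with U D(3) o c inj show ?thesis
    unfolding local_param_def homeomorphism_def
    by (auto intro: continuous_on_subset[OF D(8)])
qed

lemma continuous_preimage_borel:
  fixes f :: "'a::topological_space \<Rightarrow> 'z::topological_space"
  assumes "continuous_on W f" "open W" "B \<in> sets borel"
  shows "W \<inter> f -` B \<in> sets borel"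
proof -
  have "f \<in> borel_measurable (restrict_space borel W)"
    by (rule borel_measurable_continuous_on_restrict[OF assms(1)])
  from measurable_sets[OF this assms(3)] show ?thesis
    using assms(2) by (simp add: space_restrict_space sets_restrict_space_iff Int_commute)
qed

lemma borel_openin_compact:
  fixes L :: "'m::t2_space set"
  assumes "compact L" "openin (top_of_set L) U"
  shows "U \<in> sets borel"
proof -
  obtain V where "open V" "U = L \<inter> V" using assms(2) by (auto simp: openin_open)
  then show ?thesis using compact_imp_closed[OF assms(1)] by auto
qed

locale riemannian = manifold A for A :: "('m::{t2_space, second_countable_topology}, 'b::euclidean_space) chart set" +
  fixes g :: "'m \<Rightarrow> 'b \<Rightarrow> 'b \<Rightarrow> real"
  assumes riemannian_metric: "riemannian_metric A g"
begin

lemma metric_bilinear: "bilinear (g p)"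
  using riemannian_metric by (auto simp: riemannian_metric_def inner_product_def)

text \<open>The metric is given as smooth on constant coordinate vectors. With its two arguments
  indexed by \<open>bool\<close> it becomes a multilinear expression covered by
  \<open>smooth_on_multilinear\<close>.\<close>

lemma smooth_gram:
  fixes h :: "'a::real_normed_vector \<Rightarrow> 'b"
  assumes c: "c \<in> A" and U: "open U" and h: "smooth_on U h" "h ` U \<subseteq> chart_img c"
    and w: "smooth_on U w" "smooth_on U w'"
  shows "smooth_on U (\<lambda>z. g (chart_inv c (h z)) (tvec A c (chart_inv c (h z)) (w z)) (tvec A c (chart_inv c (h z)) (w' z)))"
proof -
  define a where "a z v = g (chart_inv c z) (tvec A c (chart_inv c z) (v True)) (tvec A c (chart_inv c z) (v False))"
    for z and v :: "bool \<Rightarrow> 'b"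
  define ww where "ww b = (if b then w else w')" for b
  have "smooth_on U (\<lambda>x. a (h x) (\<lambda>i. ww i x))"
  proof (rule smooth_on_multilinear[where a = a and w = ww, OF U chartD(2)[OF c] h(2,1)])
    show "smooth_on (chart_img c) (\<lambda>z. a z v)" for v
      using riemannian_metric c by (simp add: riemannian_metric_def a_def)
    show "smooth_on U (ww i)" for i using w by (simp add: ww_def)
    show "linear (\<lambda>u. a z (v(i := u)))" if "z \<in> chart_img c" for z v i
    proof -
      have l: "linear (tvec A c (chart_inv c z))" by (rule linear_tvec[OF c]) (use that chart_inv[OF c] in auto)
      show ?thesis
        by (cases i) (auto intro!: linearI simp: a_def linear_add[OF l] linear_cmul[OF l]
            bilinear_ladd[OF metric_bilinear] bilinear_radd[OF metric_bilinear]
            bilinear_lmul[OF metric_bilinear] bilinear_rmul[OF metric_bilinear])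
    qed
  qed
  then show ?thesis by (simp add: a_def ww_def)
qed

lemma smooth_gram_det:
  fixes h :: "'a::real_normed_vector \<Rightarrow> 'b" and w :: "'k::finite \<Rightarrow> 'a \<Rightarrow> 'b"
  assumes c: "c \<in> A" and U: "open U" and h: "smooth_on U h" "h ` U \<subseteq> chart_img c"
    and w: "\<And>i. smooth_on U (w i)"
  shows "smooth_on U (\<lambda>z. det (\<chi> i j. g (chart_inv c (h z)) (tvec A c (chart_inv c (h z)) (w i z))
    (tvec A c (chart_inv c (h z)) (w j z))))"
proof -
  define M where "M i j z = g (chart_inv c (h z)) (tvec A c (chart_inv c (h z)) (w i z))
    (tvec A c (chart_inv c (h z)) (w j z))" for i j z
  have M: "smooth_on U (M i j)" for i j unfolding M_def by (rule smooth_gram[OF c U h w w])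
  have "smooth_on U (\<lambda>z. \<Sum>p\<in>{p. p permutes UNIV}. of_int (sign p) * (\<Prod>i\<in>UNIV. M i (p i) z))"
    by (intro smooth_on_sum smooth_on_mult smooth_on_prod smooth_on_const U M)
  then show ?thesis by (simp add: det_def M_def)
qed

lemma coord_frame_eq:
  assumes "smooth_into A W f" "open W" "y \<in> W" "c \<in> A" "f y \<in> fst c"
  shows "coord_frame A f y i = tvec A c (f y) (frechet_derivative (\<lambda>z. snd c (f z)) (at y) (axis i 1))"
proof -
  have p: "pdiff A f y" by (rule smooth_into_pdiff[OF assms(1-3)])
  show ?thesis
    unfolding coord_frame_def by (rule diff_into_eq_tvec[OF p assms(4,5) pdiffD(2)[OF p assms(4,5)]])
qed

lemma continuous_volume_density:
  assumes f: "smooth_into A W f" "open W"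
  shows "continuous_on W (volume_density A g f)"
proof (rule continuous_at_imp_continuous_on, rule ballI)
  fix y assume y: "y \<in> W"
  let ?c = "chart_at A (f y)"
  note c = chart_at[of "f y"]
  let ?U = "W \<inter> f -` fst ?c" and ?h = "\<lambda>z. snd ?c (f z)"
  have U: "open ?U" by (rule smooth_into_preimage_open[OF f chartD(1)[OF c(1)]])
  have h: "smooth_on ?U ?h" using f(1) c by (simp add: smooth_into_def)
  have hU: "?h ` ?U \<subseteq> chart_img ?c" using chart_inv[OF c(1)] by auto
  have "continuous_on ?U (\<lambda>z. sqrt (det (\<chi> i j. g (chart_inv ?c (?h z))
      (tvec A ?c (chart_inv ?c (?h z)) (frechet_derivative ?h (at z) (axis i 1)))
      (tvec A ?c (chart_inv ?c (?h z)) (frechet_derivative ?h (at z) (axis j 1))))))"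
    by (intro continuous_on_real_sqrt smooth_on_continuous_on smooth_gram_det[OF c(1) U h hU]
        smooth_on_frechet_derivative h)
  then have "continuous_on ?U (volume_density A g f)"
    by (rule continuous_on_eq)
      (auto simp: volume_density_def kvec_norm_def chart_inv(1)[OF c(1)] coord_frame_eq[OF f _ c(1)])
  then show "isCont (volume_density A g f) y"
    using U y c by (simp add: continuous_on_eq_continuous_at)
qed

lemma param_measure_measurable:
  assumes "local_param A L W f"
  shows "(\<lambda>y. indicator W y * volume_density A g f y) \<in> borel_measurable borel"
proof -
  note D = local_paramD[OF assms]
  show ?thesis
    using borel_measurable_continuous_on_indicator[OF _ continuous_volume_density[OF D(2,1)]] D(1) by simp
qed

lemma emeasure_param_measure:
  assumes f: "local_param A L W f" and S: "S \<in> sets borel" "S \<subseteq> W"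
  shows "emeasure (param_measure A g W f) S = (\<integral>\<^sup>+y. ennreal (volume_density A g f y) * indicator S y \<partial>lborel)"
proof -
  have "emeasure (param_measure A g W f) S = (\<integral>\<^sup>+y. ennreal (indicator W y * volume_density A g f y) * indicator S y \<partial>lborel)"
    unfolding param_measure_def using param_measure_measurable[OF f] S by (subst emeasure_density) auto
  also have "\<dots> = (\<integral>\<^sup>+y. ennreal (volume_density A g f y) * indicator S y \<partial>lborel)"
    by (rule nn_integral_cong) (use S(2) in \<open>auto simp: indicator_def\<close>)
  finally show ?thesis .
qed

text \<open>The transition map is continuous because \<open>f'\<close> is a homeomorphism onto its
  image; since \<open>f'\<close> is an immersion, \<open>has_derivative_left_factor\<close> upgrades
  this to differentiability. The chain rule then expresses one coordinate frame through the
  other.\<close>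

lemma local_param_transition:
  fixes f f' :: "real^'k::finite \<Rightarrow> 'm"
  assumes f: "local_param A L W f" and f': "local_param A L W' f'"
    and y: "y \<in> W" "f y \<in> f' ` W'"
  obtains S' where "((\<lambda>z. inv_into W' f' (f z)) has_derivative S') (at y)"
    "coord_frame A f y = frame_mult (transpose (matrix S')) (coord_frame A f' (inv_into W' f' (f y)))"
proof -
  note D = local_paramD[OF f] and D' = local_paramD[OF f']
  let ?s = "\<lambda>z. inv_into W' f' (f z)"
  obtain V where V: "open V" "f' ` W' = L \<inter> V" using D'(5) by (auto simp: openin_open)
  let ?O = "W \<inter> f -` V"
  have O: "open ?O" by (rule continuous_open_preimage[OF D(8,1) V(1)])
  have yO: "y \<in> ?O" using y V by auto
  have fO: "f z \<in> f' ` W'" if "z \<in> ?O" for z using that D(7) V by auto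
  have sO: "f' (?s z) = f z" "?s z \<in> W'" if "z \<in> ?O" for z
    using fO[OF that] by (auto simp: f_inv_into_f inv_into_into)
  have "continuous_on ?O ?s"
    by (rule continuous_on_compose2[OF D'(9)]) (use fO in \<open>auto intro: continuous_on_subset[OF D(8)]\<close>)
  then have s: "isCont ?s y" using O yO by (simp add: continuous_on_eq_continuous_at)
  let ?c = "chart_at A (f y)"
  note c = chart_at[of "f y"]
  have p: "pdiff A f y" by (rule smooth_into_pdiff[OF D(2,1) y(1)])
  have p': "pdiff A f' (?s y)" by (rule smooth_into_pdiff[OF D'(2,1) sO(2)[OF yO]])
  have c': "f' (?s y) \<in> fst ?c" using sO(1)[OF yO] c by simp
  have G: "((\<lambda>z. snd ?c (f' z)) has_derivative (\<lambda>u. tcoord A ?c (f y) (diff_into A f' (?s y) u))) (at (?s y))"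
    using coord_has_derivative[OF p' c(1) c'] sO(1)[OF yO] by simp
  have inj_t: "inj (tcoord A ?c (f y))" using tvec_tcoord[OF c] by (metis injI)
  have "inj (\<lambda>u. tcoord A ?c (f y) (diff_into A f' (?s y) u))"
    using inj_compose[OF inj_t D'(3)[OF sO(2)[OF yO]]] by (simp add: o_def)
  moreover have "((\<lambda>z. snd ?c (f' (?s z))) has_derivative (\<lambda>u. tcoord A ?c (f y) (diff_into A f y u))) (at y)"
    by (rule has_derivative_transform_within_open[OF coord_has_derivative[OF p c] O yO]) (simp only: sO)
  ultimately obtain S' where S': "(?s has_derivative S') (at y)"
    "\<And>u. tcoord A ?c (f y) (diff_into A f' (?s y) (S' u)) = tcoord A ?c (f y) (diff_into A f y u)"
    using has_derivative_left_factor[OF s G] by metis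
  have e: "diff_into A f' (?s y) (S' u) = diff_into A f y u" for u
    using S'(2) inj_t by (simp add: inj_eq)
  note l = linear_diff_into[OF p']
  have "coord_frame A f y i = frame_mult (transpose (matrix S')) (coord_frame A f' (?s y)) i" for i
  proof -
    have "diff_into A f' (?s y) (\<Sum>j\<in>UNIV. S' (axis i 1) $ j *\<^sub>R axis j 1) =
        (\<Sum>j\<in>UNIV. S' (axis i 1) $ j *\<^sub>R diff_into A f' (?s y) (axis j 1))"
      by (simp add: linear_sum[OF l] linear_cmul[OF l])
    moreover have "(\<Sum>j\<in>UNIV. S' (axis i 1) $ j *\<^sub>R axis j 1) = S' (axis i 1)"
      using basis_expansion[of "S' (axis i 1)"] by (simp add: scalar_mult_eq_scaleR)
    ultimately have "diff_into A f' (?s y) (S' (axis i 1)) = (\<Sum>j\<in>UNIV. S' (axis i 1) $ j *\<^sub>R diff_into A f' (?s y) (axis j 1))"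
      by simp
    then show ?thesis
      by (simp add: coord_frame_def frame_mult_def e transpose_def matrix_def)
  qed
  then show thesis using that[OF S'(1)] by blast
qed

text \<open>The Jacobian factor of the transition map is exactly the factor by which the Gram norm
  changes between the two coordinate frames.\<close>

lemma param_measure_invariant:
  fixes f f' :: "real^'k::finite \<Rightarrow> 'm"
  assumes f: "local_param A L W f" and f': "local_param A L W' f'"
    and B: "B \<in> sets borel" "B \<subseteq> f ` W" "B \<subseteq> f' ` W'"
  shows "emeasure (param_measure A g W f) (W \<inter> f -` B) = emeasure (param_measure A g W' f') (W' \<inter> f' -` B)"
proof -
  note D = local_paramD[OF f] and D' = local_paramD[OF f']
  let ?s = "\<lambda>z. inv_into W' f' (f z)"
  let ?S = "W \<inter> f -` B" and ?S' = "W' \<inter> f' -` B"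
  have S: "?S \<in> sets borel" "?S' \<in> sets borel"
    by (rule continuous_preimage_borel[OF D(8,1) B(1)], rule continuous_preimage_borel[OF D'(8,1) B(1)])
  have s1: "f' (?s z) = f z" "?s z \<in> W'" if "z \<in> ?S" for z
    using that B(3) by (auto simp: f_inv_into_f inv_into_into)
  have img: "?s ` ?S = ?S'"
  proof (intro set_eqI iffI)
    fix z assume z: "z \<in> ?S'"
    then obtain y where y: "y \<in> W" "f' z = f y" using B(2) by auto
    then have "?s y = z" using z D'(6) by (metis IntD1 inv_into_f_f)
    then show "z \<in> ?s ` ?S" using z y by (intro image_eqI[of _ _ y]) auto
  qed (use s1 in auto)
  have "\<forall>y\<in>?S. \<exists>S'. (?s has_derivative S') (at y) \<and>
    coord_frame A f y = frame_mult (transpose (matrix S')) (coord_frame A f' (?s y))"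
  proof
    fix y assume "y \<in> ?S"
    then have "y \<in> W" "f y \<in> f' ` W'" using B(3) by auto
    from local_param_transition[OF f f' this]
    show "\<exists>S'. (?s has_derivative S') (at y) \<and>
        coord_frame A f y = frame_mult (transpose (matrix S')) (coord_frame A f' (?s y))" by metis
  qed
  then obtain s' where s': "\<And>y. y \<in> ?S \<Longrightarrow> (?s has_derivative s' y) (at y)"
    "\<And>y. y \<in> ?S \<Longrightarrow> coord_frame A f y = frame_mult (transpose (matrix (s' y))) (coord_frame A f' (?s y))"
    by metis
  \<comment> \<open>Cutting off at \<open>0\<close>, as \<open>ennreal\<close> does, makes it unnecessary to know that Gram determinants are nonnegative.\<close>
  have ind: "ennreal c * indicator T y = ennreal (indicator T y * max 0 c)" for c T and y :: "real^'k"
    by (auto simp: indicator_def ennreal_neg max_def)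
  have "(\<integral>\<^sup>+y. ennreal (indicator (?s ` ?S) y * max 0 (volume_density A g f' y)) \<partial>lborel) =
    (\<integral>\<^sup>+y. ennreal (indicator ?S y * max 0 (volume_density A g f y)) \<partial>lborel)"
  proof (rule nn_integral_change_of_variables[where s' = s'])
    show "inj_on ?s ?S"
      by (rule inj_onI) (metis s1(1) IntD1 D(6) inj_onD)
    show "max 0 (volume_density A g f y) = \<bar>det (matrix (s' y))\<bar> * max 0 (volume_density A g f' (?s y))"
      if "y \<in> ?S" for y
    proof -
      have "volume_density A g f y = \<bar>det (matrix (s' y))\<bar> * volume_density A g f' (?s y)"
        unfolding volume_density_def s'(2)[OF that] s1(1)[OF that] kvec_norm_frame_mult[OF metric_bilinear]
        by simp
      then show ?thesis by (simp add: max_mult_distrib_left)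
    qed
    have "continuous_on ?S (\<lambda>y. max 0 (volume_density A g f y))"
      by (intro continuous_on_max continuous_on_const continuous_on_subset[OF continuous_volume_density[OF D(2,1)]]) auto
    from borel_measurable_continuous_on_indicator[OF S(1) this]
    show "(\<lambda>y. indicator ?S y * max 0 (volume_density A g f y)) \<in> borel_measurable borel" by simp
    have "continuous_on ?S' (\<lambda>y. max 0 (volume_density A g f' y))"
      by (intro continuous_on_max continuous_on_const continuous_on_subset[OF continuous_volume_density[OF D'(2,1)]]) auto
    from borel_measurable_continuous_on_indicator[OF S(2) this]
    show "(\<lambda>y. indicator (?s ` ?S) y * max 0 (volume_density A g f' y)) \<in> borel_measurable borel"
      unfolding img by simp
  qed (use S s'(1) in auto)
  then show ?thesis
    unfolding emeasure_param_measure[OF f S(1) Int_lower1] emeasure_param_measure[OF f' S(2) Int_lower1] ind img by simp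
qed

text \<open>The images of finitely many parametrizations covering \<open>L\<close> are cut into
  disjoint Borel pieces \<open>D i\<close>, and each piece is measured in its own parametrization.
  By \<open>param_measure_invariant\<close> every other parametrization assigns the same measure to
  subsets of a piece.\<close>

lemma riemannian_volume_exists:
  assumes L: "compact L" and sub: "submanifold TYPE('k::finite) A L"
  shows "\<exists>\<mu>. is_riemannian_volume TYPE('k) A g L \<mu>"
proof -
  have "\<exists>z :: (real^'k) set \<times> (real^'k \<Rightarrow> 'm). (case z of (W, f) \<Rightarrow> local_param A L W f) \<and> openin (top_of_set L) (snd z ` fst z) \<and> p \<in> snd z ` fst z"
    if p: "p \<in> L" for p
  proof -
    obtain W and f :: "real^'k \<Rightarrow> 'm" where "local_param A L W f" "p \<in> f ` W"
      using sub p unfolding submanifold_def by blast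
    then show ?thesis by - (rule exI[of _ "(W, f)"], auto dest: local_paramD(5))
  qed
  from compact_finite_openin_cover[OF L this]
  obtain n and z :: "nat \<Rightarrow> (real^'k) set \<times> (real^'k \<Rightarrow> 'm)" where
    z: "\<And>i. i < n \<Longrightarrow> case z i of (W, f) \<Rightarrow> local_param A L W f" "L = (\<Union>i<n. snd (z i) ` fst (z i))"
    by blast
  define W f where "W i = fst (z i)" and "f i = snd (z i)" for i
  have f: "local_param A L (W i) (f i)" if "i < n" for i
    using z(1)[OF that] by (simp add: W_def f_def case_prod_beta)
  have cov: "L = (\<Union>i<n. f i ` W i)" using z(2) by (simp add: W_def f_def)
  define D where "D i = disjointed (\<lambda>i. f i ` W i) i" for i
  have UD: "(\<Union>i<n. D i) = L"
    unfolding cov D_def using finite_UN_disjointed_eq[of "\<lambda>i. f i ` W i" n] by (simp add: lessThan_atLeast0)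
  have disj: "disjoint_family_on D {..<n}"
    using disjoint_family_disjointed[of "\<lambda>i. f i ` W i"] unfolding D_def[symmetric, abs_def]
    by (rule disjoint_family_on_mono[rotated]) simp
  have D: "D i \<in> sets borel" "D i \<subseteq> f i ` W i" if "i < n" for i
  proof -
    show "D i \<in> sets borel"
      unfolding D_def disjointed_def
      by (intro sets.Diff sets.finite_UN borel_openin_compact[OF L local_paramD(5)[OF f]]) (use that in auto)
    show "D i \<subseteq> f i ` W i" unfolding D_def by (rule disjointed_subset)
  qed
  define m where "m B = (\<Sum>i<n. emeasure (param_measure A g (W i) (f i)) (W i \<inter> f i -` (B \<inter> D i)))" for B
  have pre: "W i \<inter> f i -` B \<in> sets (param_measure A g (W i) (f i))" if "i < n" "B \<in> sets borel" for i B
    using continuous_preimage_borel[OF local_paramD(8,1)[OF f[OF that(1)]] that(2)] by (simp add: param_measure_def)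
  define \<mu> where "\<mu> = measure_of UNIV (sets borel) m"
  have em: "emeasure \<mu> B = m B" if B: "B \<in> sets borel" for B
    unfolding \<mu>_def
  proof (rule emeasure_measure_of_sigma[OF _ _ _ B])
    show "sigma_algebra (UNIV :: 'm set) (sets borel)" using sets.sigma_algebra_axioms[of borel] by simp
    show "positive (sets borel) m" by (simp add: positive_def m_def)
    show "countably_additive (sets borel) m"
      unfolding countably_additive_def
    proof (intro allI impI)
      fix B :: "nat \<Rightarrow> 'm set"
      assume B: "range B \<subseteq> sets borel" "disjoint_family B"
      have "(\<Sum>k. m (B k)) = (\<Sum>i<n. \<Sum>k. emeasure (param_measure A g (W i) (f i)) (W i \<inter> f i -` (B k \<inter> D i)))"
        unfolding m_def by (rule suminf_sum) (rule summableI)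
      also have "\<dots> = m (\<Union>k. B k)"
        unfolding m_def
      proof (rule sum.cong[OF refl])
        fix i assume "i \<in> {..<n}"
        then have i: "i < n" by simp
        have "(\<Sum>k. emeasure (param_measure A g (W i) (f i)) (W i \<inter> f i -` (B k \<inter> D i))) =
          emeasure (param_measure A g (W i) (f i)) (\<Union>k. W i \<inter> f i -` (B k \<inter> D i))"
        proof (rule suminf_emeasure)
          show "range (\<lambda>k. W i \<inter> f i -` (B k \<inter> D i)) \<subseteq> sets (param_measure A g (W i) (f i))"
          proof (rule image_subsetI)
            fix k show "W i \<inter> f i -` (B k \<inter> D i) \<in> sets (param_measure A g (W i) (f i))"
              by (rule pre[OF i]) (use B(1) D(1)[OF i] in auto)
          qed
          show "disjoint_family (\<lambda>k. W i \<inter> f i -` (B k \<inter> D i))"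
            using B(2) by (auto simp: disjoint_family_on_def)
        qed
        also have "(\<Union>k. W i \<inter> f i -` (B k \<inter> D i)) = W i \<inter> f i -` ((\<Union>k. B k) \<inter> D i)" by auto
        finally show "(\<Sum>k. emeasure (param_measure A g (W i) (f i)) (W i \<inter> f i -` (B k \<inter> D i))) =
          emeasure (param_measure A g (W i) (f i)) (W i \<inter> f i -` ((\<Union>k. B k) \<inter> D i))" .
      qed
      finally show "(\<Sum>k. m (B k)) = m (\<Union>k. B k)" .
    qed
  qed
  have "is_riemannian_volume TYPE('k) A g L \<mu>"
    unfolding is_riemannian_volume_def
  proof (intro conjI allI impI)
    show "sets \<mu> = sets borel" unfolding \<mu>_def
      by (metis sets.sets_measure_of_eq space_borel)
    have "D i \<subseteq> L" if "i < n" for i using that UD by auto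
    then have "W i \<inter> f i -` (- L \<inter> D i) = {}" if "i < n" for i using that by auto
    moreover have "- L \<in> sets borel" using compact_imp_closed[OF L] by auto
    ultimately show "emeasure \<mu> (- L) = 0" by (simp add: em m_def)
  next
    fix W' and f' :: "real^'k \<Rightarrow> 'm" and B
    assume f': "local_param A L W' f'" and B: "B \<in> sets borel" "B \<subseteq> f' ` W'"
    note D' = local_paramD[OF f']
    have S: "W' \<inter> f' -` B \<in> sets borel" if "B \<in> sets borel" for B
      by (rule continuous_preimage_borel[OF D'(8,1) that])
    have "emeasure \<mu> B = (\<Sum>i<n. emeasure (param_measure A g W' f') (W' \<inter> f' -` (B \<inter> D i)))"
      unfolding em[OF B(1)] m_def
    proof (rule sum.cong[OF refl])
      fix i assume "i \<in> {..<n}"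
      then have i: "i < n" by simp
      show "emeasure (param_measure A g (W i) (f i)) (W i \<inter> f i -` (B \<inter> D i)) =
          emeasure (param_measure A g W' f') (W' \<inter> f' -` (B \<inter> D i))"
        using D[OF i] B by (intro param_measure_invariant[OF f[OF i] f']) auto
    qed
    also have "\<dots> = emeasure (param_measure A g W' f') (\<Union>i<n. W' \<inter> f' -` (B \<inter> D i))"
    proof (rule sum_emeasure)
      show "(\<lambda>i. W' \<inter> f' -` (B \<inter> D i)) ` {..<n} \<subseteq> sets (param_measure A g W' f')"
        using S[OF sets.Int[OF B(1) D(1)]] by (auto simp: param_measure_def vimage_Int)
      show "disjoint_family_on (\<lambda>i. W' \<inter> f' -` (B \<inter> D i)) {..<n}"
        unfolding disjoint_family_on_def
      proof (intro ballI impI)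
        fix i j assume "i \<in> {..<n}" "j \<in> {..<n}" "i \<noteq> j"
        then have "D i \<inter> D j = {}" using disj by (simp add: disjoint_family_on_def)
        then show "W' \<inter> f' -` (B \<inter> D i) \<inter> (W' \<inter> f' -` (B \<inter> D j)) = {}" by blast
      qed
    qed simp
    also have "(\<Union>i<n. W' \<inter> f' -` (B \<inter> D i)) = W' \<inter> f' -` B"
    proof -
      have "(\<Union>i<n. W' \<inter> f' -` (B \<inter> D i)) = W' \<inter> f' -` (B \<inter> (\<Union>i<n. D i))" by auto
      then show ?thesis unfolding UD using D'(7) B(2) by auto
    qed
    also have "emeasure (param_measure A g W' f') (W' \<inter> f' -` B) =
        (\<integral>\<^sup>+ y. ennreal (kvec_norm (g (f' y)) (coord_frame A f' y)) * indicator (W' \<inter> f' -` B) y \<partial>lborel)"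
      using emeasure_param_measure[OF f' S[OF B(1)]] by (simp add: volume_density_def)
    finally show "emeasure \<mu> B = \<dots>" .
  qed
  then show ?thesis by blast
qed

lemma is_riemannian_volume:
  assumes "compact L" "submanifold TYPE('k::finite) A L"
  shows "is_riemannian_volume TYPE('k) A g L (riemannian_volume TYPE('k) A g L)"
  unfolding riemannian_volume_def by (rule someI_ex[OF riemannian_volume_exists[OF assms]])

section \<open>Integration against the Riemannian volume\<close>

lemma is_riemannian_volumeD:
  fixes f :: "real^'k::finite \<Rightarrow> 'm"
  assumes "is_riemannian_volume TYPE('k) A g L \<mu>" "local_param A L W f" "B \<in> sets borel" "B \<subseteq> f ` W"
  shows "emeasure \<mu> B = (\<integral>\<^sup>+y. ennreal (volume_density A g f y) * indicator (W \<inter> f -` B) y \<partial>lborel)"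
  using assms unfolding is_riemannian_volume_def volume_density_def by blast

text \<open>\<open>f0\<close> is constant off \<open>W\<close>, which makes it Borel on the whole
  space; the constant does not matter because \<open>param_measure\<close> vanishes off
  \<open>W\<close>. The image measure turns integrals over a parametrized piece into Lebesgue
  integrals.\<close>

lemma distr_param_measure:
  fixes f :: "real^'k::finite \<Rightarrow> 'm"
  assumes L: "compact L" and \<mu>: "is_riemannian_volume TYPE('k) A g L \<mu>" and f: "local_param A L W f"
  defines "f0 \<equiv> \<lambda>y. if y \<in> W then f y else undefined"
  shows "f0 \<in> borel_measurable borel"
    "distr (param_measure A g W f) borel f0 = density \<mu> (\<lambda>x. ennreal (indicator (f ` W) x))"
proof -
  note D = local_paramD[OF f]
  have pre: "f0 -` B = (W \<inter> f -` B) \<union> (if undefined \<in> B then - W else {})" for B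
    by (auto simp: f0_def split: if_splits)
  show m: "f0 \<in> borel_measurable borel"
  proof (rule measurableI)
    fix B assume "B \<in> sets (borel :: 'm measure)"
    then show "f0 -` B \<inter> space borel \<in> sets borel"
      unfolding pre using continuous_preimage_borel[OF D(8,1)] D(1) by auto
  qed simp
  have fW: "f ` W \<in> sets borel" by (rule borel_openin_compact[OF L D(5)])
  have s: "sets \<mu> = sets borel" using \<mu> by (simp add: is_riemannian_volume_def)
  show "distr (param_measure A g W f) borel f0 = density \<mu> (\<lambda>x. ennreal (indicator (f ` W) x))"
  proof (rule measure_eqI)
    fix B assume "B \<in> sets (distr (param_measure A g W f) borel f0)"
    then have B: "B \<in> sets borel" by simp
    have fB: "f ` W \<inter> B \<in> sets borel" using fW B by auto
    have "emeasure (distr (param_measure A g W f) borel f0) B = emeasure (param_measure A g W f) (f0 -` B)"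
      using m B by (subst emeasure_distr) (auto simp: param_measure_def)
    also have "\<dots> = (\<integral>\<^sup>+y. ennreal (indicator W y * volume_density A g f y) * indicator (f0 -` B) y \<partial>lborel)"
      unfolding param_measure_def using param_measure_measurable[OF f] measurable_sets[OF m B]
      by (subst emeasure_density) auto
    also have "\<dots> = (\<integral>\<^sup>+ y. ennreal (volume_density A g f y) * indicator (W \<inter> f -` (f ` W \<inter> B)) y \<partial>lborel)"
      by (rule nn_integral_cong) (auto simp: indicator_def f0_def)
    also have "\<dots> = emeasure \<mu> (f ` W \<inter> B)"
      by (rule is_riemannian_volumeD[OF \<mu> f fB Int_lower1, symmetric])
    also have "\<dots> = emeasure (density \<mu> (\<lambda>x. ennreal (indicator (f ` W) x))) B"
    proof -
      have "emeasure \<mu> (f ` W \<inter> B) = (\<integral>\<^sup>+x. indicator (f ` W \<inter> B) x \<partial>\<mu>)"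
        using fB s by simp
      also have "\<dots> = (\<integral>\<^sup>+x. ennreal (indicator (f ` W) x) * indicator B x \<partial>\<mu>)"
        by (rule nn_integral_cong) (auto simp: indicator_def)
      finally show ?thesis using fW B s by (subst emeasure_density) (auto cong: measurable_cong_sets)
    qed
    finally show "emeasure (distr (param_measure A g W f) borel f0) B =
        emeasure (density \<mu> (\<lambda>x. ennreal (indicator (f ` W) x))) B" .
  qed (use s in simp)
qed

lemma nn_integral_riemannian_volume:
  fixes f :: "real^'k::finite \<Rightarrow> 'm"
  assumes L: "compact L" and \<mu>: "is_riemannian_volume TYPE('k) A g L \<mu>" and f: "local_param A L W f"
    and h: "h \<in> borel_measurable borel" "\<And>x. x \<notin> f ` W \<Longrightarrow> h x = 0"
  shows "(\<integral>\<^sup>+x. h x \<partial>\<mu>) = (\<integral>\<^sup>+y. ennreal (indicator W y * volume_density A g f y) * h (f y) \<partial>lborel)"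
proof -
  let ?f = "\<lambda>y. if y \<in> W then f y else undefined"
  note d = distr_param_measure[OF L \<mu> f]
  have s: "sets \<mu> = sets borel" using \<mu> by (simp add: is_riemannian_volume_def)
  have fW: "f ` W \<in> sets borel" by (rule borel_openin_compact[OF L local_paramD(5)[OF f]])
  have hm: "h \<in> borel_measurable \<mu>" using h(1) s by (simp cong: measurable_cong_sets)
  have "(\<integral>\<^sup>+x. h x \<partial>\<mu>) = (\<integral>\<^sup>+x. ennreal (indicator (f ` W) x) * h x \<partial>\<mu>)"
    by (rule nn_integral_cong) (use h(2) in \<open>auto simp: indicator_def\<close>)
  also have "\<dots> = (\<integral>\<^sup>+x. h x \<partial>density \<mu> (\<lambda>x. ennreal (indicator (f ` W) x)))"
    by (rule nn_integral_density[symmetric]) (use fW s hm in \<open>auto cong: measurable_cong_sets\<close>)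
  also have "\<dots> = (\<integral>\<^sup>+y. h (?f y) \<partial>param_measure A g W f)"
    unfolding d(2)[symmetric] using d(1) h(1)
    by (subst nn_integral_distr) (auto simp: param_measure_def)
  also have "\<dots> = (\<integral>\<^sup>+y. ennreal (indicator W y * volume_density A g f y) * h (?f y) \<partial>lborel)"
    unfolding param_measure_def
    by (rule nn_integral_density)
      (use param_measure_measurable[OF f] measurable_compose[OF d(1) h(1)] in auto)
  also have "\<dots> = (\<integral>\<^sup>+y. ennreal (indicator W y * volume_density A g f y) * h (f y) \<partial>lborel)"
    by (rule nn_integral_cong) (auto simp: indicator_def)
  finally show ?thesis .
qed

text \<open>Here \<open>h\<close> may change sign, so the Bochner integral is used; a density in
  such an integral has to be nonnegative, which is the content of \<open>pos\<close>.\<close>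

lemma integral_riemannian_volume:
  fixes f :: "real^'k::finite \<Rightarrow> 'm" and h :: "'m \<Rightarrow> real"
  assumes L: "compact L" and \<mu>: "is_riemannian_volume TYPE('k) A g L \<mu>" and f: "local_param A L W f"
    and h: "h \<in> borel_measurable borel" "\<And>x. x \<notin> f ` W \<Longrightarrow> h x = 0"
    and pos: "\<And>y. y \<in> W \<Longrightarrow> 0 \<le> volume_density A g f y"
  shows "(\<integral>x. h x \<partial>\<mu>) = (\<integral>y. indicator W y * volume_density A g f y * h (f y) \<partial>lborel)"
proof -
  let ?f = "\<lambda>y. if y \<in> W then f y else undefined"
  note d = distr_param_measure[OF L \<mu> f]
  have s: "sets \<mu> = sets borel" using \<mu> by (simp add: is_riemannian_volume_def)
  have fW: "f ` W \<in> sets borel" by (rule borel_openin_compact[OF L local_paramD(5)[OF f]])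
  have hm: "h \<in> borel_measurable \<mu>" using h(1) s by (simp cong: measurable_cong_sets)
  have "(\<integral>x. h x \<partial>\<mu>) = (\<integral>x. indicator (f ` W) x *\<^sub>R h x \<partial>\<mu>)"
    by (rule Bochner_Integration.integral_cong) (use h(2) in \<open>auto simp: indicator_def\<close>)
  also have "\<dots> = (\<integral>x. h x \<partial>density \<mu> (\<lambda>x. ennreal (indicator (f ` W) x)))"
    by (rule integral_density[symmetric]) (use fW s hm in \<open>auto cong: measurable_cong_sets\<close>)
  also have "\<dots> = (\<integral>y. h (?f y) \<partial>param_measure A g W f)"
    unfolding d(2)[symmetric] using d(1) h(1)
    by (subst integral_distr) (auto simp: param_measure_def)
  also have "\<dots> = (\<integral>y. (indicator W y * volume_density A g f y) *\<^sub>R h (?f y) \<partial>lborel)"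
    unfolding param_measure_def
    by (rule integral_density)
      (use param_measure_measurable[OF f] measurable_compose[OF d(1) h(1)] pos in \<open>auto simp: indicator_def\<close>)
  also have "\<dots> = (\<integral>y. indicator W y * volume_density A g f y * h (f y) \<partial>lborel)"
    by (rule Bochner_Integration.integral_cong) (auto simp: indicator_def)
  finally show ?thesis .
qed

text \<open>Around each point a parametrization restricts to a ball whose closure stays in its
  domain. The density is bounded on that ball, so its image has finite volume, and finitely many
  such images cover \<open>L\<close>.\<close>

lemma finite_riemannian_volume:
  assumes L: "compact L" and sub: "submanifold TYPE('k::finite) A L" and \<mu>: "is_riemannian_volume TYPE('k) A g L \<mu>"
  shows "finite_measure \<mu>"
proof -
  have s: "sets \<mu> = sets borel" and sp: "space \<mu> = UNIV" and 0: "emeasure \<mu> (- L) = 0"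
    using \<mu> sets_eq_imp_space_eq[of \<mu> borel] by (auto simp: is_riemannian_volume_def)
  have "\<exists>z :: (real^'k) set \<times> (real^'k \<Rightarrow> 'm). emeasure \<mu> (snd z ` fst z) < \<infinity> \<and>
      openin (top_of_set L) (snd z ` fst z) \<and> p \<in> snd z ` fst z" if p: "p \<in> L" for p
  proof -
    obtain W and f :: "real^'k \<Rightarrow> 'm" where f: "local_param A L W f" "p \<in> f ` W"
      using sub p unfolding submanifold_def by blast
    note D = local_paramD[OF f(1)]
    obtain y where y: "y \<in> W" "p = f y" using f(2) by auto
    obtain r where r: "r > 0" "cball y r \<subseteq> W" using D(1) y(1) open_contains_cball by blast
    have f': "local_param A L (ball y r) f"
      by (rule local_param_restrict[OF f(1)]) (use r ball_subset_cball in auto)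
    note D' = local_paramD[OF f']
    have "compact (volume_density A g f ` cball y r)"
      by (intro compact_continuous_image continuous_on_subset[OF continuous_volume_density[OF D(2,1)] r(2)]) auto
    then obtain C where C: "\<And>z. z \<in> cball y r \<Longrightarrow> volume_density A g f z \<le> C"
      by (meson bounded_imp_bdd_above compact_imp_bounded bdd_above.unfold imageI)
    have fB: "f ` ball y r \<in> sets borel" by (rule borel_openin_compact[OF L D'(5)])
    have "emeasure \<mu> (f ` ball y r) = (\<integral>\<^sup>+ y'. ennreal (kvec_norm (g (f y')) (coord_frame A f y')) *
        indicator (ball y r \<inter> f -` (f ` ball y r)) y' \<partial>lborel)"
      using \<mu> f' fB unfolding is_riemannian_volume_def by blast
    also have "\<dots> \<le> (\<integral>\<^sup>+ y'. ennreal C * indicator (ball y r) y' \<partial>lborel)"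
      by (rule nn_integral_mono) (use C in \<open>auto simp: indicator_def volume_density_def intro!: ennreal_leI\<close>)
    also have "\<dots> = ennreal C * emeasure lborel (ball y r)" by (subst nn_integral_cmult_indicator) auto
    also have "\<dots> < \<infinity>" using emeasure_lborel_ball_finite[of y r] by (simp add: ennreal_mult_less_top)
    finally have "emeasure \<mu> (f ` ball y r) < \<infinity>" .
    moreover have "p \<in> f ` ball y r" using y r by auto
    ultimately show ?thesis using D'(5) by (intro exI[of _ "(ball y r, f)"]) auto
  qed
  then have "\<exists>U. (emeasure \<mu> U < \<infinity> \<and> U \<in> sets \<mu>) \<and> openin (top_of_set L) U \<and> p \<in> U" if "p \<in> L" for p
    using that borel_openin_compact[OF L] s by metis
  from compact_finite_openin_cover[where im = "\<lambda>U. U", OF L this]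
  obtain n and U :: "nat \<Rightarrow> 'm set" where
    z: "\<And>i. i < n \<Longrightarrow> emeasure \<mu> (U i) < \<infinity> \<and> U i \<in> sets \<mu>" "L = (\<Union>i<n. U i)" by metis
  have "emeasure \<mu> L \<le> (\<Sum>i<n. emeasure \<mu> (U i))"
    by (subst z(2), rule emeasure_subadditive_finite) (use z(1) in auto)
  also have "\<dots> < \<infinity>" using z(1) by (simp add: ennreal_sum_less_top)
  finally have "emeasure \<mu> L < \<infinity>" .
  moreover have "emeasure \<mu> (L \<union> - L) \<le> emeasure \<mu> L + emeasure \<mu> (- L)"
    using compact_imp_closed[OF L] s by (intro emeasure_subadditive) auto
  ultimately show ?thesis using 0 sp by (intro finite_measureI) (auto simp: Compl_partition)
qed

text \<open>The Jacobian relation is asked for one parametrization around each point. The total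
  volume is summed over disjoint pieces subordinate to these, each piece being measured through
  \<open>f\<close> on \<open>L\<close> and through \<open>\<Phi> \<circ> f\<close> on the
  image.\<close>

lemma emeasure_volume_image:
  fixes L :: "'m set" and \<Phi> :: "'m \<Rightarrow> 'm" and J :: "'m \<Rightarrow> real"
  assumes L: "compact L" and sub: "submanifold TYPE('k::finite) A L"
    and \<Phi>: "compact (\<Phi> ` L)" "inj_on \<Phi> L"
    and \<Phi>p: "\<And>W (f :: real^'k \<Rightarrow> 'm). local_param A L W f \<Longrightarrow> local_param A (\<Phi> ` L) W (\<lambda>y. \<Phi> (f y))"
    and J: "(\<lambda>x. indicator L x * J x) \<in> borel_measurable borel" "\<And>x. x \<in> L \<Longrightarrow> 0 \<le> J x"
    and dens: "\<And>p. p \<in> L \<Longrightarrow> \<exists>W (f :: real^'k \<Rightarrow> 'm). local_param A L W f \<and> p \<in> f ` W \<and>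
      (\<forall>y\<in>W. volume_density A g (\<lambda>y. \<Phi> (f y)) y = J (f y) * volume_density A g f y)"
    and \<mu>: "is_riemannian_volume TYPE('k) A g L \<mu>" and \<mu>': "is_riemannian_volume TYPE('k) A g (\<Phi> ` L) \<mu>'"
  shows "emeasure \<mu>' (\<Phi> ` L) = (\<integral>\<^sup>+x. ennreal (indicator L x * J x) \<partial>\<mu>)"
proof -
  have s: "sets \<mu> = sets borel" "sets \<mu>' = sets borel" using \<mu> \<mu>' by (auto simp: is_riemannian_volume_def)
  let ?Q = "\<lambda>z :: (real^'k) set \<times> (real^'k \<Rightarrow> 'm). local_param A L (fst z) (snd z) \<and>
      (\<forall>y\<in>fst z. volume_density A g (\<lambda>y. \<Phi> (snd z y)) y = J (snd z y) * volume_density A g (snd z) y)"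
  have "\<exists>z. ?Q z \<and> openin (top_of_set L) (snd z ` fst z) \<and> p \<in> snd z ` fst z" if p: "p \<in> L" for p
  proof -
    from dens[OF p] obtain W and f :: "real^'k \<Rightarrow> 'm" where "local_param A L W f" "p \<in> f ` W"
      "\<forall>y\<in>W. volume_density A g (\<lambda>y. \<Phi> (f y)) y = J (f y) * volume_density A g f y" by blast
    then show ?thesis by - (rule exI[of _ "(W, f)"], auto dest: local_paramD(5))
  qed
  from compact_finite_openin_cover[where Q = ?Q and im = "\<lambda>z. snd z ` fst z", OF L this]
  obtain n and z :: "nat \<Rightarrow> (real^'k) set \<times> (real^'k \<Rightarrow> 'm)" where
    z: "\<And>i. i < n \<Longrightarrow> ?Q (z i)" "L = (\<Union>i<n. snd (z i) ` fst (z i))"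
    by blast
  define W f where "W i = fst (z i)" and "f i = snd (z i)" for i
  have f: "local_param A L (W i) (f i)"
    and J': "\<And>y. y \<in> W i \<Longrightarrow> volume_density A g (\<lambda>y. \<Phi> (f i y)) y = J (f i y) * volume_density A g (f i) y"
    if "i < n" for i
    using z(1)[OF that] by (auto simp: W_def f_def)
  have cov: "L = (\<Union>i<n. f i ` W i)" using z(2) by (simp add: W_def f_def)
  define D where "D i = disjointed (\<lambda>i. f i ` W i) i" for i
  have UD: "(\<Union>i<n. D i) = L"
    unfolding cov D_def using finite_UN_disjointed_eq[of "\<lambda>i. f i ` W i" n] by (simp add: lessThan_atLeast0)
  have disj: "disjoint_family_on D {..<n}"
    using disjoint_family_disjointed[of "\<lambda>i. f i ` W i"] unfolding D_def[symmetric, abs_def]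
    by (rule disjoint_family_on_mono[rotated]) simp
  have DW: "D i \<subseteq> f i ` W i" for i unfolding D_def by (rule disjointed_subset)
  have bor: "D i \<in> sets borel" if "i < n" for i
    unfolding D_def disjointed_def
    by (intro sets.Diff sets.finite_UN borel_openin_compact[OF L local_paramD(5)[OF f]]) (use that in auto)
  have DL: "D i \<subseteq> L" if "i < n" for i using that UD by auto
  \<comment> \<open>Each piece is a difference built from relatively open sets. Injectivity carries
    differences to differences, and \<open>\<Phi>\<close> sends images of parametrizations to
    relatively open sets.\<close>
  have bor': "\<Phi> ` D i \<in> sets borel" if i: "i < n" for i
  proof -
    have sub: "f j ` W j \<subseteq> L" if "j < n" for j by (rule local_paramD(7)[OF f[OF that]])
    then have sub': "(\<Union>j\<in>{0..<i}. f j ` W j) \<subseteq> L" using i by (intro UN_least) auto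
    have "\<Phi> ` D i = \<Phi> ` (f i ` W i) - (\<Union>j\<in>{0..<i}. \<Phi> ` (f j ` W j))"
      unfolding D_def disjointed_def image_UN[symmetric]
      by (rule inj_on_image_set_diff[OF \<Phi>(2)]) (use sub[OF i] sub' in blast)+
    moreover have "\<Phi> ` (f j ` W j) \<in> sets borel" if "j < n" for j
      using borel_openin_compact[OF \<Phi>(1) local_paramD(5)[OF \<Phi>p[OF f[OF that]]]] by (simp add: image_image)
    ultimately show ?thesis using i by auto
  qed
  have piece: "emeasure \<mu>' (\<Phi> ` D i) = (\<integral>\<^sup>+x. ennreal (indicator L x * J x) * indicator (D i) x \<partial>\<mu>)" if i: "i < n" for i
  proof -
    have "emeasure \<mu>' (\<Phi> ` D i) = (\<integral>\<^sup>+ y. ennreal (volume_density A g (\<lambda>y. \<Phi> (f i y)) y) *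
        indicator (W i \<inter> (\<lambda>y. \<Phi> (f i y)) -` (\<Phi> ` D i)) y \<partial>lborel)"
      by (rule is_riemannian_volumeD[OF \<mu>' \<Phi>p[OF f[OF i]] bor'[OF i]]) (use DW[of i] in auto)
    also have "\<dots> = (\<integral>\<^sup>+y. ennreal (indicator (W i) y * volume_density A g (f i) y) *
        (ennreal (indicator L (f i y) * J (f i y)) * indicator (D i) (f i y)) \<partial>lborel)"
    proof (rule nn_integral_cong)
      fix y
      have "f i y \<in> D i" if "y \<in> W i" "\<Phi> (f i y) \<in> \<Phi> ` D i"
        using that \<Phi>(2) DL[OF i] local_paramD(7)[OF f[OF i]] by (auto dest!: inj_onD)
      then show "ennreal (volume_density A g (\<lambda>y. \<Phi> (f i y)) y) * indicator (W i \<inter> (\<lambda>y. \<Phi> (f i y)) -` (\<Phi> ` D i)) y =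
        ennreal (indicator (W i) y * volume_density A g (f i) y) *
        (ennreal (indicator L (f i y) * J (f i y)) * indicator (D i) (f i y))"
        using J'[OF i, of y] J(2)[of "f i y"] DL[OF i]
        by (auto simp: indicator_def ennreal_mult' mult.commute)
    qed
    also have "\<dots> = (\<integral>\<^sup>+x. ennreal (indicator L x * J x) * indicator (D i) x \<partial>\<mu>)"
      by (rule nn_integral_riemannian_volume[OF L \<mu> f[OF i], symmetric]) (use J(1) bor[OF i] DW[of i] in \<open>auto simp: indicator_def\<close>)
    finally show ?thesis .
  qed
  have "emeasure \<mu>' (\<Phi> ` L) = emeasure \<mu>' (\<Union>i<n. \<Phi> ` D i)" by (simp add: UD[symmetric] image_UN)
  also have "\<dots> = (\<Sum>i<n. emeasure \<mu>' (\<Phi> ` D i))"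
  proof (rule sum_emeasure[symmetric])
    show "disjoint_family_on (\<lambda>i. \<Phi> ` D i) {..<n}"
      unfolding disjoint_family_on_def
    proof (intro ballI impI)
      fix i j assume ij: "i \<in> {..<n}" "j \<in> {..<n}" "i \<noteq> j"
      then have "\<Phi> ` D i \<inter> \<Phi> ` D j = \<Phi> ` (D i \<inter> D j)"
        using DL by (intro inj_on_image_Int[OF \<Phi>(2), symmetric]) auto
      then show "\<Phi> ` D i \<inter> \<Phi> ` D j = {}" using disj ij by (simp add: disjoint_family_on_def)
    qed
  qed (use bor' s in auto)
  also have "\<dots> = (\<Sum>i<n. \<integral>\<^sup>+x. ennreal (indicator L x * J x) * indicator (D i) x \<partial>\<mu>)"
    by (rule sum.cong) (auto simp: piece)
  also have "\<dots> = (\<integral>\<^sup>+x. (\<Sum>i<n. ennreal (indicator L x * J x) * indicator (D i) x) \<partial>\<mu>)"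
    by (rule nn_integral_sum[symmetric]) (use J(1) bor s in \<open>auto cong: measurable_cong_sets\<close>)
  also have "\<dots> = (\<integral>\<^sup>+x. ennreal (indicator L x * J x) \<partial>\<mu>)"
  proof (rule nn_integral_cong)
    fix x
    have "(\<Sum>i<n. indicator (D i) x :: ennreal) = indicator L x"
      by (subst indicator_UN_disjoint[OF _ disj, symmetric]) (simp_all add: UD)
    then show "(\<Sum>i<n. ennreal (indicator L x * J x) * indicator (D i) x) = ennreal (indicator L x * J x)"
      by (simp add: sum_distrib_left[symmetric]) (simp add: indicator_def)
  qed
  finally show ?thesis .
qed

end

section \<open>Integrals depending on a parameter\<close>

text \<open>Dominated convergence along sequences: the mean value theorem bounds all difference
  quotients by \<open>B\<close>, and constants are integrable for a finite measure.\<close>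

lemma has_real_derivative_integral:
  fixes q :: "real \<Rightarrow> 'a \<Rightarrow> real"
  assumes M: "finite_measure M" and r: "r > 0"
    and int: "\<And>s. \<bar>s - t\<bar> < r \<Longrightarrow> integrable M (q s)"
    and d: "\<And>s x. \<bar>s - t\<bar> < r \<Longrightarrow> x \<in> space M \<Longrightarrow> ((\<lambda>s. q s x) has_real_derivative q' s x) (at s)"
    and B: "\<And>s x. \<bar>s - t\<bar> < r \<Longrightarrow> x \<in> space M \<Longrightarrow> \<bar>q' s x\<bar> \<le> B"
    and m: "q' t \<in> borel_measurable M"
  shows "((\<lambda>s. \<integral>x. q s x \<partial>M) has_real_derivative (\<integral>x. q' t x \<partial>M)) (at t)"
  unfolding has_field_derivative_iff tendsto_at_iff_sequentially
proof (intro allI impI)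
  interpret finite_measure M by (rule M)
  fix S :: "nat \<Rightarrow> real"
  assume S: "\<forall>i. S i \<in> UNIV - {t}" "S \<longlonglongrightarrow> t"
  have "eventually (\<lambda>i. dist (S i) t < r) sequentially" using S(2) r by (rule tendstoD)
  then obtain n0 where n0: "\<And>i. i \<ge> n0 \<Longrightarrow> \<bar>S i - t\<bar> < r"
    unfolding eventually_sequentially dist_real_def by blast
  define Q where "Q i x = (q (S (i + n0)) x - q t x) / (S (i + n0) - t)" for i x
  have "(\<lambda>i. \<integral>x. Q i x \<partial>M) \<longlonglongrightarrow> (\<integral>x. q' t x \<partial>M)"
  proof (rule integral_dominated_convergence[OF m _ integrable_const[of B]])
    show "Q i \<in> borel_measurable M" for i
      unfolding Q_def using int[OF n0[of "i + n0"]] int[of t] r by auto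
    show "AE x in M. (\<lambda>i. Q i x) \<longlonglongrightarrow> q' t x"
    proof (rule AE_I2)
      fix x assume x: "x \<in> space M"
      have "((\<lambda>s. (q s x - q t x) / (s - t)) \<longlongrightarrow> q' t x) (at t)"
        using d[OF _ x, of t] r by (simp add: has_field_derivative_iff)
      moreover have "\<forall>i. S (i + n0) \<in> UNIV - {t}" using S(1) by blast
      ultimately have "((\<lambda>s. (q s x - q t x) / (s - t)) \<circ> (\<lambda>i. S (i + n0))) \<longlonglongrightarrow> q' t x"
        unfolding tendsto_at_iff_sequentially using LIMSEQ_ignore_initial_segment[OF S(2), of n0] by metis
      then show "(\<lambda>i. Q i x) \<longlonglongrightarrow> q' t x" by (simp add: Q_def o_def)
    qed
    show "AE x in M. norm (Q i x) \<le> B" for i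
    proof (rule AE_I2)
      fix x assume x: "x \<in> space M"
      have "norm (q (S (i + n0)) x - q t x) \<le> B * norm (S (i + n0) - t)"
      proof (rule field_differentiable_bound[of "{t - r <..< t + r}" "\<lambda>s. q s x" "\<lambda>s. q' s x"])
        fix s assume "s \<in> {t - r <..< t + r}"
        then have s: "\<bar>s - t\<bar> < r" by auto
        show "((\<lambda>s. q s x) has_real_derivative q' s x) (at s within {t - r <..< t + r})"
          by (rule has_field_derivative_at_within[OF d[OF s x]])
        show "norm (q' s x) \<le> B" using B[OF s x] by simp
      qed (use n0[of "i + n0"] r in auto)
      then show "norm (Q i x) \<le> B" unfolding Q_def using S(1)
        by (simp add: divide_le_eq norm_divide)
    qed
  qed
  moreover have "(\<integral>x. Q i x \<partial>M) = ((\<lambda>s. ((\<integral>x. q s x \<partial>M) - (\<integral>x. q t x \<partial>M)) / (s - t)) \<circ> S) (i + n0)" for i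
    unfolding Q_def using int[OF n0[of "i + n0"]] int[of t] r by (simp add: Bochner_Integration.integral_diff)
  ultimately have "(\<lambda>i. ((\<lambda>s. ((\<integral>x. q s x \<partial>M) - (\<integral>x. q t x \<partial>M)) / (s - t)) \<circ> S) (i + n0)) \<longlonglongrightarrow> (\<integral>x. q' t x \<partial>M)"
    by simp
  then show "((\<lambda>s. ((\<integral>x. q s x \<partial>M) - (\<integral>x. q t x \<partial>M)) / (s - t)) \<circ> S) \<longlonglongrightarrow> (\<integral>x. q' t x \<partial>M)"
    by (rule LIMSEQ_offset)
qed

text \<open>
  By translation invariance all difference quotients of a function with compact support have
  integral \<open>0\<close>.
\<close>

lemma integral_derivative_compact_support:
  fixes u :: "'a::euclidean_space \<Rightarrow> real"
  assumes W: "open W" and u: "Ck_on 1 W u" and K: "compact K" "K \<subseteq> W" and supp: "\<And>y. y \<in> W \<Longrightarrow> y \<notin> K \<Longrightarrow> u y = 0"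
  shows "integrable lborel (\<lambda>y. indicator W y * frechet_derivative u (at y) e)"
    "(\<integral>y. indicator W y * frechet_derivative u (at y) e \<partial>lborel) = 0"
proof -
  \<comment> \<open>Extension by zero. It is C1 on \<open>W\<close>, where it equals
    \<open>u\<close>, and on the complement of \<open>K\<close>, where it vanishes; these two open
    sets cover the space.\<close>
  define v where "v y = indicator W y * u y" for y
  have vW: "Ck_on 1 W v" by (rule Ck_on_cong[OF W u]) (simp add: v_def)
  have oK: "open (- K)" using compact_imp_closed[OF K(1)] by auto
  have vK: "Ck_on 1 (- K) v"
    by (rule Ck_on_cong[OF oK Ck_on_const[of _ _ 0]]) (use supp in \<open>auto simp: v_def indicator_def\<close>)
  have v: "Ck_on (Suc 0) UNIV v"
    by (rule Ck_on_local) (use vW vK W oK K in \<open>metis Compl_iff One_nat_def subsetD\<close>)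
  have vd: "(v has_derivative frechet_derivative v (at y)) (at y)" for y
    using v by (simp add: frechet_derivative_works)
  have vc: "continuous_on UNIV (\<lambda>y. frechet_derivative v (at y) e)" using v by simp
  have eq: "frechet_derivative v (at y) e = indicator W y * frechet_derivative u (at y) e" for y
  proof (cases "y \<in> W")
    case True
    then have "frechet_derivative v (at y) = frechet_derivative u (at y)"
      using frechet_derivative_transform_within_open[of v y W u] vd W
      by (auto simp: v_def differentiable_def)
    with True show ?thesis by simp
  next
    case False
    then have "((\<lambda>_. 0) has_derivative frechet_derivative v (at y)) (at y)"
      using K by (intro has_derivative_transform_within_open[OF vd oK])
        (use supp in \<open>auto simp: v_def indicator_def\<close>)
    from has_derivative_unique[OF this has_derivative_const] False show ?thesis by simp
  qed
  have z: "frechet_derivative v (at y) e = 0" if "y \<notin> K" for y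
  proof -
    have "((\<lambda>_. 0) has_derivative frechet_derivative v (at y)) (at y)"
      using that by (intro has_derivative_transform_within_open[OF vd oK])
        (use supp in \<open>auto simp: v_def indicator_def\<close>)
    from has_derivative_unique[OF this has_derivative_const] show ?thesis by simp
  qed
  have cint: "integrable lborel w" if "continuous_on UNIV w" "\<And>y. y \<notin> K \<Longrightarrow> w y = 0" for w :: "'a \<Rightarrow> real"
  proof -
    have "integrable lborel (\<lambda>x. indicator K x *\<^sub>R w x)"
      by (rule borel_integrable_compact[OF K(1) continuous_on_subset[OF that(1)]]) simp
    moreover have "(\<lambda>x. indicator K x *\<^sub>R w x) = w" using that(2) by (auto simp: indicator_def fun_eq_iff)
    ultimately show ?thesis by simp
  qed
  have "continuous_on UNIV v"
    by (intro continuous_at_imp_continuous_on ballI has_derivative_continuous[OF vd])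
  then have vi: "integrable lborel v" by (rule cint) (use supp in \<open>auto simp: v_def indicator_def\<close>)
  have di: "integrable lborel (\<lambda>y. frechet_derivative v (at y) e)" by (rule cint[OF vc z])
  then show "integrable lborel (\<lambda>y. indicator W y * frechet_derivative u (at y) e)" unfolding eq .
  have "bounded ((\<lambda>y. frechet_derivative v (at y) e) ` K)"
    by (intro compact_imp_bounded compact_continuous_image continuous_on_subset[OF vc] K) auto
  then obtain B where B: "\<And>y. y \<in> K \<Longrightarrow> \<bar>frechet_derivative v (at y) e\<bar> \<le> B" "B > 0"
    unfolding bounded_pos by auto
  have B': "\<bar>frechet_derivative v (at y) e\<bar> \<le> B" for y using B z[of y] by (cases "y \<in> K") auto
  define h where "h n = inverse (real (Suc n))" for n
  have h: "h n > 0" "h n \<le> 1" for n by (auto simp: h_def divide_simps)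
  have h0: "h \<longlonglongrightarrow> 0" unfolding h_def by (rule LIMSEQ_inverse_real_of_nat)
  define Q where "Q n y = (v (y + h n *\<^sub>R e) - v y) / h n" for n y
  \<comment> \<open>All points from which a shift by \<open>s *\<^sub>R e\<close> with
    \<open>0 \<le> s \<le> 1\<close> can reach \<open>K\<close>. As \<open>h n \<le> 1\<close>,
    every quotient \<open>Q n\<close> vanishes off this compact set, so \<open>B\<close> times its
    indicator dominates.\<close>
  define K' where "K' = (\<lambda>(k, s). k - s *\<^sub>R e) ` (K \<times> {0..1})"
  have K': "compact K'" unfolding K'_def
    by (intro compact_continuous_image compact_Times K) (auto intro!: continuous_intros simp: case_prod_beta')
  have ray: "((\<lambda>s. v (y + s *\<^sub>R e)) has_real_derivative frechet_derivative v (at (y + s *\<^sub>R e)) e) (at s)" for y s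
  proof -
    have "((\<lambda>s. y + s *\<^sub>R e) has_derivative (\<lambda>h. h *\<^sub>R e)) (at s)" by (auto intro!: derivative_eq_intros)
    from has_derivative_compose[OF this vd] show ?thesis
      using linear_cmul[OF has_derivative_linear[OF vd]] by (simp add: has_field_derivative_def mult_commute_abs)
  qed
  have Qb: "norm (Q n y) \<le> B * indicator K' y" for n y
  proof (cases "y \<in> K'")
    case True
    have "norm (v (y + h n *\<^sub>R e) - v (y + 0 *\<^sub>R e)) \<le> B * norm (h n - 0)"
      by (rule field_differentiable_bound[of UNIV "\<lambda>s. v (y + s *\<^sub>R e)"
            "\<lambda>s. frechet_derivative v (at (y + s *\<^sub>R e)) e"]) (use ray B' in auto)
    with True h(1)[of n] show ?thesis by (simp add: Q_def norm_divide divide_le_eq)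
  next
    case False
    have "y + s *\<^sub>R e \<notin> K" if "0 \<le> s" "s \<le> 1" for s
      using False that unfolding K'_def by (force intro: image_eqI[of _ _ "(y + s *\<^sub>R e, s)"])
    from this[of "h n"] this[of 0] h[of n] have "v (y + h n *\<^sub>R e) = 0" "v y = 0"
      using supp by (auto simp: v_def indicator_def)
    with False show ?thesis by (simp add: Q_def)
  qed
  have tr: "integrable lborel (\<lambda>y. v (y + c)) \<and> (\<integral>y. v (y + c) \<partial>lborel) = (\<integral>y. v y \<partial>lborel)" for c
  proof -
    have vm: "v \<in> borel_measurable borel" using borel_measurable_integrable[OF vi] by simp
    have D: "distr lborel borel ((+) c) = lborel" by (rule lborel_distr_plus)
    show ?thesis
      using integrable_distr[of "(+) c" lborel borel v] integral_distr[of "(+) c" lborel borel v] vi vm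
      unfolding D by (simp add: add.commute)
  qed
  have "(\<lambda>n. \<integral>y. Q n y \<partial>lborel) \<longlonglongrightarrow> (\<integral>y. frechet_derivative v (at y) e \<partial>lborel)"
  proof (rule integral_dominated_convergence[where w = "\<lambda>y. B * indicator K' y"])
    show "(\<lambda>y. frechet_derivative v (at y) e) \<in> borel_measurable lborel" using di by auto
    show "Q n \<in> borel_measurable lborel" for n
      unfolding Q_def using tr[of "h n *\<^sub>R e"] vi by auto
    show "integrable lborel (\<lambda>y. B * indicator K' y)"
      using K' emeasure_bounded_finite[OF compact_imp_bounded[OF K']] compact_imp_closed[OF K'] by auto
    show "AE y in lborel. (\<lambda>n. Q n y) \<longlonglongrightarrow> frechet_derivative v (at y) e"
    proof (rule AE_I2)
      fix y
      have "((\<lambda>s. (v (y + s *\<^sub>R e) - v (y + 0 *\<^sub>R e)) / (s - 0)) \<longlongrightarrow> frechet_derivative v (at (y + 0 *\<^sub>R e)) e) (at 0)"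
        using ray[of y 0] by (simp only: has_field_derivative_iff)
      from this[unfolded tendsto_at_iff_sequentially, rule_format, of h] h(1) h0
      show "(\<lambda>n. Q n y) \<longlonglongrightarrow> frechet_derivative v (at y) e" by (simp add: Q_def o_def less_imp_neq[symmetric])
    qed
    show "AE y in lborel. norm (Q n y) \<le> B * indicator K' y" for n using Qb by simp
  qed
  moreover have "(\<integral>y. Q n y \<partial>lborel) = 0" for n
    unfolding Q_def using tr[of "h n *\<^sub>R e"] vi by (simp add: Bochner_Integration.integral_diff)
  ultimately have "(\<integral>y. frechet_derivative v (at y) e \<partial>lborel) = 0"
    by (simp add: LIMSEQ_const_iff)
  then show "(\<integral>y. indicator W y * frechet_derivative u (at y) e \<partial>lborel) = 0" unfolding eq .
qed

section \<open>The flow in coordinates\<close>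

context flow
begin

text \<open>A dictionary: \<open>G\<close> maps between Euclidean spaces, where the calculus of
  multilinear expressions applies, and \<open>tvec\<close> translates its partial derivatives back
  into push-forwards and the generator.\<close>

lemma flow_coord:
  fixes f :: "'a::euclidean_space \<Rightarrow> 'm"
  assumes f: "smooth_into A W f" "open W" "f ` W \<subseteq> N0" and d: "d \<in> A"
  defines "G \<equiv> \<lambda>(t, y). snd d (F t (f y))"
    and "U \<equiv> I \<times> W \<inter> (\<lambda>(t, y). F t (f y)) -` fst d"
  shows "open U" "smooth_on U G" "G ` U \<subseteq> chart_img d"
    "(t, y) \<in> U \<Longrightarrow> chart_inv d (G (t, y)) = F t (f y)"
    "(t, y) \<in> U \<Longrightarrow> tvec A d (F t (f y)) (frechet_derivative G (at (t, y)) (0, u)) = mdiff A (F t) (f y) (diff_into A f y u)"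
    "(t, y) \<in> U \<Longrightarrow> tvec A d (F t (f y)) (frechet_derivative G (at (t, y)) (1, 0)) = X (F t (f y))"
proof -
  note s = smooth_into_flow_compose[OF f]
  have o: "open (I \<times> W)" by (intro open_Times f) auto
  show U: "open U" unfolding U_def by (rule smooth_into_preimage_open[OF s o chartD(1)[OF d]])
  show "smooth_on U G" using s d unfolding smooth_into_def U_def G_def by (auto simp: case_prod_beta')
  show "G ` U \<subseteq> chart_img d" unfolding G_def U_def by (auto intro: chart_inv(4)[OF d])
  assume ty: "(t, y) \<in> U"
  then have m: "t \<in> I" "y \<in> W" "F t (f y) \<in> fst d" by (auto simp: U_def)
  show "chart_inv d (G (t, y)) = F t (f y)" using m chart_inv(1)[OF d] by (simp add: G_def)
  have p: "pdiff A (\<lambda>(t, y). F t (f y)) (t, y)" using smooth_into_pdiff[OF s o] m by auto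
  have h: "((\<lambda>z. snd d ((\<lambda>(t, y). F t (f y)) z)) has_derivative
      frechet_derivative (\<lambda>z. snd d ((\<lambda>(t, y). F t (f y)) z)) (at (t, y))) (at (t, y))"
    by (rule pdiffD(2)[OF p d]) (use m in auto)
  have Ge: "(\<lambda>z. snd d ((\<lambda>(t, y). F t (f y)) z)) = G" by (auto simp: G_def)
  have e: "diff_into A (\<lambda>(t, y). F t (f y)) (t, y) w = tvec A d (F t (f y)) (frechet_derivative G (at (t, y)) w)" for w
    using diff_into_eq_tvec[OF p d _ h] m unfolding Ge by simp
  show "tvec A d (F t (f y)) (frechet_derivative G (at (t, y)) (0, u)) = mdiff A (F t) (f y) (diff_into A f y u)"
    using diff_into_flow(1)[OF f m(2,1)] e by simp
  show "tvec A d (F t (f y)) (frechet_derivative G (at (t, y)) (1, 0)) = X (F t (f y))"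
    using diff_into_flow(2)[OF f m(2,1)] e by simp
qed

end

section \<open>Flowing an oriented submanifold\<close>

text \<open>Locally the square root of a smooth Gram determinant; \<open>pos\<close> keeps it away
  from the singularity of the root at \<open>0\<close>.\<close>

lemma (in riemannian) smooth_volume_density:
  assumes f: "smooth_into A W f" "open W" and pos: "\<And>y. y \<in> W \<Longrightarrow> 0 < volume_density A g f y"
  shows "smooth_on W (volume_density A g f)"
proof (rule smooth_on_local)
  fix y assume y: "y \<in> W"
  let ?c = "chart_at A (f y)"
  note c = chart_at[of "f y"]
  let ?U = "W \<inter> f -` fst ?c" and ?h = "\<lambda>z. snd ?c (f z)"
  have U: "open ?U" by (rule smooth_into_preimage_open[OF f chartD(1)[OF c(1)]])
  have h: "smooth_on ?U ?h" using f(1) c by (simp add: smooth_into_def)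
  have hU: "?h ` ?U \<subseteq> chart_img ?c" using chart_inv[OF c(1)] by auto
  let ?D = "\<lambda>z. det (\<chi> i j. g (chart_inv ?c (?h z))
      (tvec A ?c (chart_inv ?c (?h z)) (frechet_derivative ?h (at z) (axis i 1)))
      (tvec A ?c (chart_inv ?c (?h z)) (frechet_derivative ?h (at z) (axis j 1))))"
  have e: "volume_density A g f z = sqrt (?D z)" if "z \<in> ?U" for z
    using that by (auto simp: volume_density_def kvec_norm_def chart_inv(1)[OF c(1)] coord_frame_eq[OF f _ c(1)])
  have "0 < ?D z" if "z \<in> ?U" for z using pos[of z] e[OF that] that by simp
  then have "smooth_on ?U (\<lambda>z. sqrt (?D z))"
    by (intro smooth_on_sqrt U smooth_gram_det[OF c(1) U h hU] smooth_on_frechet_derivative h)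
  then have "smooth_on ?U (volume_density A g f)"
    by (rule smooth_on_cong[OF U]) (simp add: e)
  with U y c show "\<exists>U. open U \<and> y \<in> U \<and> smooth_on U (volume_density A g f)" by blast
qed

lemma (in flow) mdiff_flow_0:
  assumes "x \<in> N0"
  shows "mdiff A (F 0) x v = v"
proof -
  let ?c = "chart_at A x"
  note c = chart_at[of x]
  let ?W = "snd ?c ` (fst ?c \<inter> N0)"
  have W: "open ?W" by (rule open_chart_image[OF c(1) flowD(2)])
  have f: "smooth_into A ?W (chart_inv ?c)"
    by (rule smooth_into_subset[OF smooth_into_chart_inv[OF c(1)]]) (auto simp: chart_img_def)
  have fW: "chart_inv ?c ` ?W \<subseteq> N0" using chart_inv(1)[OF c(1)] by auto
  have x: "snd ?c x \<in> ?W" "0 \<in> I" "chart_inv ?c (snd ?c x) = x"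
    using assms c flowD(1) chart_inv(1)[OF c] by auto
  have "diff_into A (\<lambda>y. F 0 (chart_inv ?c y)) (snd ?c x) = diff_into A (chart_inv ?c) (snd ?c x)"
    by (rule pdiff_cong(2)[OF pdiff_chart_inv(1)[OF c] W x(1)]) (use fW flowD(3) chart_inv(1)[OF c(1)] in auto)
  with diff_into_flow(3)[OF f W fW x(1,2), of "tcoord A ?c x v"] show ?thesis
    using pdiff_chart_inv(2)[OF c] tvec_tcoord[OF c, of v] unfolding x(3) by simp
qed

locale oriented_flow = flow A N N0 X \<epsilon> F + riemannian A g
  for A :: "('m::{t2_space, second_countable_topology}, 'b::euclidean_space) chart set"
    and N N0 X \<epsilon> F g +
  fixes L :: "'m set" and Or :: "'m \<Rightarrow> ('k::finite \<Rightarrow> 'b) set" and \<xi> :: "'m \<Rightarrow> 'k \<Rightarrow> 'b"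
  assumes oriented: "compact_oriented_submanifold A L Or"
    and unit: "\<forall>x\<in>L. unit_kvector g Or x (\<xi> x)"
    and LN0: "L \<subseteq> N0"
begin

definition J :: "real \<Rightarrow> 'm \<Rightarrow> real" where
  "J t x = kvec_norm (g (F t x)) (\<lambda>i. mdiff A (F t) x (\<xi> x i))"

definition oriented_param :: "(real^'k) set \<Rightarrow> (real^'k \<Rightarrow> 'm) \<Rightarrow> bool" where
  "oriented_param W f \<longleftrightarrow> local_param A L W f \<and>
     (\<forall>y\<in>W. Or (f y) = {e. \<exists>B :: real^'k^'k. 0 < det B \<and> e = frame_mult B (coord_frame A f y)})"

lemma compact_L: "compact L" and submanifold_L: "submanifold TYPE('k) A L"
  using oriented by (auto simp: compact_oriented_submanifold_def)

lemma oriented_param_exists: "p \<in> L \<Longrightarrow> \<exists>W f. oriented_param W f \<and> p \<in> f ` W"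
  using oriented unfolding compact_oriented_submanifold_def orientation_def oriented_param_def frame_mult_def
  by blast

lemma oriented_param_restrict: "oriented_param W f \<Longrightarrow> open U \<Longrightarrow> U \<subseteq> W \<Longrightarrow> oriented_param U f"
  unfolding oriented_param_def using local_param_restrict by blast

lemma oriented_paramD:
  assumes "oriented_param W f"
  shows "local_param A L W f" "smooth_into A W f" "open W" "f ` W \<subseteq> L" "f ` W \<subseteq> N0"
  using assms local_paramD[of A L W f] LN0 by (auto simp: oriented_param_def)

text \<open>A matrix of positive determinant leads from the coordinate frame to
  \<open>\<xi>\<close>. As \<open>\<xi>\<close> has Gram norm \<open>1\<close>, that determinant is
  the reciprocal of the density. Thus pointwise statements about \<open>\<xi>\<close> become
  statements about frames that vary smoothly.\<close>

lemma oriented_frame: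
  assumes f: "oriented_param W f" and y: "y \<in> W"
  shows "0 < volume_density A g f y"
    "alternating_form \<omega> \<Longrightarrow> \<omega> (coord_frame A f y) = volume_density A g f y *\<^sub>R (\<omega> (\<xi> (f y)) :: 'z::real_vector)"
    "bilinear q \<Longrightarrow> kvec_norm q (coord_frame A f y) = volume_density A g f y * kvec_norm q (\<xi> (f y))"
proof -
  have "f y \<in> L" using oriented_paramD(4)[OF f] y by auto
  then have u: "\<xi> (f y) \<in> Or (f y)" "kvec_norm (g (f y)) (\<xi> (f y)) = 1"
    using unit by (auto simp: unit_kvector_def intro: kvec_norm_orthonormal)
  then obtain B :: "real^'k^'k" where B: "0 < det B" "\<xi> (f y) = frame_mult B (coord_frame A f y)"
    using f y by (auto simp: oriented_param_def)
  have d: "det B * volume_density A g f y = 1"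
    using kvec_norm_frame_mult[OF metric_bilinear, of "f y" B "coord_frame A f y"] B u(2)
    by (simp add: volume_density_def)
  then have "0 < det B * volume_density A g f y" by simp
  then show "0 < volume_density A g f y" using B(1) by (rule zero_less_mult_pos)
  show "\<omega> (coord_frame A f y) = volume_density A g f y *\<^sub>R \<omega> (\<xi> (f y))" if "alternating_form \<omega>"
    unfolding B(2) alternating_form_frame_mult[OF that] using d by (simp add: mult.commute)
  show "kvec_norm q (coord_frame A f y) = volume_density A g f y * kvec_norm q (\<xi> (f y))" if "bilinear q"
    unfolding B(2) kvec_norm_frame_mult[OF that] using d B(1) by (simp add: mult.assoc[symmetric] mult.commute)
qed

lemma coord_frame_flow:
  assumes f: "oriented_param W f" and y: "y \<in> W" and t: "t \<in> I"
  shows "coord_frame A (\<lambda>y. F t (f y)) y = (\<lambda>i. mdiff A (F t) (f y) (coord_frame A f y i))"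
  using diff_into_flow(3)[OF oriented_paramD(2,3,5)[OF f] y t] by (simp add: coord_frame_def fun_eq_iff)

text \<open>\<open>oriented_frame\<close> applied to the bilinear form pulled back by the
  differential of \<open>F t\<close>.\<close>

lemma volume_density_flow:
  assumes f: "oriented_param W f" and y: "y \<in> W" and t: "t \<in> I"
  shows "volume_density A g (\<lambda>y. F t (f y)) y = J t (f y) * volume_density A g f y"
proof -
  have "f y \<in> N0" using oriented_paramD(5)[OF f] y by auto
  note l = linear_mdiff[OF mpdiff_flow[OF this t]]
  have "bilinear (\<lambda>u v. g (F t (f y)) (mdiff A (F t) (f y) u) (mdiff A (F t) (f y) v))"
    using metric_bilinear[of "F t (f y)"] unfolding bilinear_def
    by (auto intro: linear_compose[OF l, unfolded o_def])
  from oriented_frame(3)[OF f y this] show ?thesis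
    by (simp add: volume_density_def coord_frame_flow[OF f y t] kvec_norm_def J_def mult.commute)
qed

lemma J_0: "x \<in> L \<Longrightarrow> J 0 x = 1"
  using unit LN0 mdiff_flow_0[of x] flowD(3)[of x]
  by (auto simp: J_def unit_kvector_def intro!: kvec_norm_orthonormal)

text \<open>One chart \<open>c\<close> holds the flowed patch for all these times, so coordinate
  formulas are valid on a full product of time and parameter; positivity of \<open>J\<close> keeps
  its square root formula smooth.\<close>

definition patch :: "real \<Rightarrow> (real^'k) set \<Rightarrow> (real^'k \<Rightarrow> 'm) \<Rightarrow> ('m, 'b) chart \<Rightarrow> bool" where
  "patch \<delta> W f c \<longleftrightarrow> oriented_param W f \<and> c \<in> A \<and>
     (\<forall>t\<in>{-\<delta><..<\<delta>}. \<forall>y\<in>W. t \<in> I \<and> F t (f y) \<in> fst c \<and> 0 < J t (f y))"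

text \<open>Squared volume density of the flowed parametrization, jointly in time and parameter; the
  directions \<open>(0, axis i 1)\<close> keep time fixed.\<close>

definition gram_det :: "(real^'k \<Rightarrow> 'm) \<Rightarrow> ('m, 'b) chart \<Rightarrow> real \<times> (real^'k) \<Rightarrow> real" where
  "gram_det f c z = (let G = \<lambda>(t, y). snd c (F t (f y)) in
     det (\<chi> i j. g (chart_inv c (G z)) (tvec A c (chart_inv c (G z)) (frechet_derivative G (at z) (0, axis i 1)))
       (tvec A c (chart_inv c (G z)) (frechet_derivative G (at z) (0, axis j 1)))))"

lemma gram_det:
  assumes f: "oriented_param W f" and c: "c \<in> A"
  defines "U \<equiv> I \<times> W \<inter> (\<lambda>(t, y). F t (f y)) -` fst c"
  shows "smooth_on U (gram_det f c)"
    "(t, y) \<in> U \<Longrightarrow> J t (f y) * volume_density A g f y = sqrt (gram_det f c (t, y))"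
proof -
  note fc = flow_coord[OF oriented_paramD(2,3,5)[OF f] c, folded U_def]
  show "smooth_on U (gram_det f c)"
    unfolding gram_det_def[abs_def] Let_def
    by (rule smooth_gram_det[OF c fc(1-3)]) (intro smooth_on_frechet_derivative fc(2))
  assume ty: "(t, y) \<in> U"
  then have m: "t \<in> I" "y \<in> W" by (auto simp: U_def)
  show "J t (f y) * volume_density A g f y = sqrt (gram_det f c (t, y))"
    unfolding volume_density_flow[OF f m(2,1), symmetric] gram_det_def Let_def fc(4)[OF ty] fc(5)[OF ty]
    by (simp add: volume_density_def coord_frame_flow[OF f m(2,1)] kvec_norm_def coord_frame_def)
qed

text \<open>Lying in the chart and having positive Gram determinant are open conditions on
  \<open>(t, y)\<close>. Both hold at time \<open>0\<close>, where \<open>J = 1\<close>; a product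
  neighbourhood yields \<open>\<delta>\<close> and the smaller domain.\<close>

lemma patch_at:
  assumes p: "p \<in> L"
  shows "\<exists>\<delta> W f c. 0 < \<delta> \<and> patch \<delta> W f c \<and> p \<in> f ` W"
proof -
  obtain W f where f: "oriented_param W f" "p \<in> f ` W" using oriented_param_exists[OF p] by blast
  then obtain y where y: "y \<in> W" "p = f y" by auto
  let ?c = "chart_at A p"
  note c = chart_at[of p]
  let ?U = "I \<times> W \<inter> (\<lambda>(t, y). F t (f y)) -` fst ?c"
  note fc = flow_coord[OF oriented_paramD(2,3,5)[OF f(1)] c(1)]
  note gd = gram_det[OF f(1) c(1)]
  let ?V = "?U \<inter> gram_det f ?c -` {0<..}"
  have "open ?V" by (rule continuous_open_preimage[OF smooth_on_continuous_on[OF gd(1)] fc(1)]) simp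
  moreover have "(0, y) \<in> ?V"
  proof -
    have U: "(0, y) \<in> ?U" using y c flowD(1,3) p LN0 by auto
    have "0 < sqrt (gram_det f ?c (0, y))"
      using gd(2)[OF U] J_0[OF p] oriented_frame(1)[OF f(1) y(1)] y(2) by simp
    with U show ?thesis by simp
  qed
  ultimately obtain T Y where TY: "open T" "open Y" "(0, y) \<in> T \<times> Y" "T \<times> Y \<subseteq> ?V"
    by (rule open_prod_elim)
  then have TY: "open T" "open Y" "0 \<in> T" "y \<in> Y" "T \<times> Y \<subseteq> ?V" by auto
  obtain \<delta> where \<delta>: "\<delta> > 0" "ball 0 \<delta> \<subseteq> T" using TY(1,3) open_contains_ball by blast
  have "oriented_param (W \<inter> Y) f"
    by (rule oriented_param_restrict[OF f(1)]) (use TY oriented_paramD(3)[OF f(1)] in auto)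
  moreover have "t \<in> I \<and> F t (f z) \<in> fst ?c \<and> 0 < J t (f z)" if "t \<in> {-\<delta><..<\<delta>}" "z \<in> W \<inter> Y" for t z
  proof -
    have "t \<in> ball 0 \<delta>" using that(1) by (auto simp: dist_real_def)
    then have V: "(t, z) \<in> ?V" using TY(5) \<delta>(2) that(2) by blast
    then have "0 < J t (f z) * volume_density A g f z" using gd(2)[of t z] by simp
    moreover have "0 < volume_density A g f z" using oriented_frame(1)[OF f(1)] that(2) by simp
    ultimately have "0 < J t (f z)" by (simp add: zero_less_mult_iff)
    with V show ?thesis by simp
  qed
  ultimately have "patch \<delta> (W \<inter> Y) f ?c" using c(1) by (simp add: patch_def)
  then show ?thesis using \<delta>(1) y TY(4) by blast
qed

text \<open>Compactness of \<open>L\<close> enters twice: the tube lemma keeps the flowed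
  \<open>L\<close> inside \<open>N0\<close> for short times, and a finite subcover by patches allows
  \<open>\<delta>\<close> to be a minimum.\<close>

lemma patches_exist:
  "\<exists>\<delta>>0. \<delta> \<le> \<epsilon> \<and> (\<forall>t\<in>{-\<delta><..<\<delta>}. \<forall>x\<in>L. F t x \<in> N0) \<and> (\<forall>p\<in>L. \<exists>W f c. patch \<delta> W f c \<and> p \<in> f ` W)"
proof -
  let ?V = "I \<times> N0 \<inter> (\<lambda>(t, x). F t x) -` N0"
  have oV: "open ?V"
    by (rule continuous_open_preimage[OF continuous_on_flow]) (auto intro!: open_Times flowD(2))
  have "{0} \<times> L \<subseteq> ?V" using LN0 flowD(1,3) by auto
  from Elementary_Topology.tube_lemma[OF compact_L oV this]
  obtain T where T: "0 \<in> T" "open T" "T \<times> L \<subseteq> ?V" by metis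
  obtain \<delta>1 where \<delta>1: "\<delta>1 > 0" "ball 0 \<delta>1 \<subseteq> T" using T open_contains_ball by blast
  define Q where "Q = (\<lambda>(\<delta>, W, f, c). 0 < \<delta> \<and> patch \<delta> W f c)"
  define im :: "real \<times> (real^'k) set \<times> (real^'k \<Rightarrow> 'm) \<times> ('m, 'b) chart \<Rightarrow> 'm set"
    where "im = (\<lambda>(\<delta>, W, f, c). f ` W)"
  have cov: "\<exists>z. Q z \<and> openin (top_of_set L) (im z) \<and> p \<in> im z" if p: "p \<in> L" for p
  proof -
    obtain \<delta> W f c where *: "0 < \<delta>" "patch \<delta> W f c" "p \<in> f ` W" using patch_at[OF p] by blast
    then have "oriented_param W f" by (simp add: patch_def)
    from local_paramD(5)[OF oriented_paramD(1)[OF this]] have "openin (top_of_set L) (f ` W)" .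
    with * show ?thesis by (intro exI[of _ "(\<delta>, W, f, c)"]) (simp add: Q_def im_def)
  qed
  obtain n :: nat and z where z: "\<And>i. i < n \<Longrightarrow> Q (z i)" "L = (\<Union>i<n. im (z i))"
    using compact_finite_openin_cover[of L Q im, OF compact_L cov] by metis
  define \<delta> where "\<delta> = Min (insert \<epsilon> (insert \<delta>1 ((\<lambda>i. fst (z i)) ` {..<n})))"
  have "\<delta> > 0" unfolding \<delta>_def using flowD(1) \<delta>1(1) z(1) by (auto simp: Q_def case_prod_beta')
  moreover have "\<delta> \<le> \<epsilon>" "\<delta> \<le> \<delta>1" "\<And>i. i < n \<Longrightarrow> \<delta> \<le> fst (z i)"
    unfolding \<delta>_def by (rule Min_le, simp, blast)+
  ultimately have \<delta>: "\<delta> > 0" "\<delta> \<le> \<epsilon>" "\<delta> \<le> \<delta>1" "\<And>i. i < n \<Longrightarrow> \<delta> \<le> fst (z i)" by auto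
  have "F t x \<in> N0" if "t \<in> {-\<delta><..<\<delta>}" "x \<in> L" for t x
  proof -
    have "t \<in> ball 0 \<delta>1" using that(1) \<delta>(3) by (auto simp: dist_real_def)
    then have "(t, x) \<in> ?V" using T(3) \<delta>1(2) that(2) by blast
    then show ?thesis by simp
  qed
  moreover have "\<exists>W f c. patch \<delta> W f c \<and> p \<in> f ` W" if p: "p \<in> L" for p
  proof -
    have "p \<in> (\<Union>i<n. im (z i))" using p z(2) by blast
    then obtain i where i: "i < n" "p \<in> im (z i)" by blast
    obtain d W f c where e: "z i = (d, W, f, c)" by (cases "z i") auto
    have "\<delta> \<le> d" using \<delta>(4)[OF i(1)] e by simp
    then have "patch \<delta> W f c" using z(1)[OF i(1)] e by (auto simp: Q_def patch_def)
    moreover have "p \<in> f ` W" using i(2) e by (simp add: im_def)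
    ultimately show ?thesis by blast
  qed
  ultimately show ?thesis using \<delta>(1,2) by blast
qed

end

locale flow_nbhd = oriented_flow A N N0 X \<epsilon> F g L Or \<xi>
  for A :: "('m::{t2_space, second_countable_topology}, 'b::euclidean_space) chart set"
    and N N0 X \<epsilon> F g L and Or :: "'m \<Rightarrow> ('k::finite \<Rightarrow> 'b) set" and \<xi> +
  fixes \<delta> :: real and \<mu> :: "'m measure"
  assumes \<mu>: "\<mu> = riemannian_volume TYPE('k) A g L" and \<delta>: "0 < \<delta>" "\<delta> \<le> \<epsilon>" and flow_N0: "t \<in> {-\<delta><..<\<delta>} \<Longrightarrow> x \<in> L \<Longrightarrow> F t x \<in> N0"
    and patches: "p \<in> L \<Longrightarrow> \<exists>W f c. patch \<delta> W f c \<and> p \<in> f ` W"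
begin

abbreviation "I\<delta> \<equiv> {-\<delta><..<\<delta>}"

lemma I\<delta>: "t \<in> I\<delta> \<Longrightarrow> t \<in> I" using \<delta> by auto

lemma patchD:
  assumes "patch \<delta> W f c"
  shows "oriented_param W f" "c \<in> A" "open (I\<delta> \<times> W)"
    "I\<delta> \<times> W \<subseteq> I \<times> W \<inter> (\<lambda>(t, y). F t (f y)) -` fst c"
    "t \<in> I\<delta> \<Longrightarrow> y \<in> W \<Longrightarrow> 0 < J t (f y)"
  using assms oriented_paramD(3)[of W f] by (auto simp: patch_def intro!: open_Times)

text \<open>Smoothness is joint in time and parameter, so that time derivatives stay in the class
  and are bounded on compact sets of times and points.\<close>

definition smooth_family :: "(real \<Rightarrow> 'm \<Rightarrow> real) \<Rightarrow> bool" where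
  "smooth_family Q \<longleftrightarrow> (\<forall>W f c. patch \<delta> W f c \<longrightarrow> smooth_on (I\<delta> \<times> W) (\<lambda>(t, y). Q t (f y)))"

lemma smooth_familyD:
  "smooth_family Q \<Longrightarrow> patch \<delta> W f c \<Longrightarrow> smooth_on (I\<delta> \<times> W) (\<lambda>(t, y). Q t (f y))"
  unfolding smooth_family_def by blast

lemma smooth_on_density:
  assumes p: "patch \<delta> W f c"
  shows "smooth_on (I\<delta> \<times> W) (\<lambda>z. volume_density A g f (snd z))"
proof (rule smooth_on_compose[OF patchD(3)[OF p] oriented_paramD(3)[OF patchD(1)[OF p]]])
  show "smooth_on (I\<delta> \<times> W) snd" by (rule smooth_on_bounded_linear[OF bounded_linear_snd patchD(3)[OF p]])
  show "smooth_on W (volume_density A g f)"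
    by (rule smooth_volume_density[OF oriented_paramD(2,3)[OF patchD(1)[OF p]] oriented_frame(1)[OF patchD(1)[OF p]]])
qed auto

text \<open>By \<open>gram_det\<close>, \<open>J\<close> times the density is the square root of a
  smooth positive function; the density is positive and smooth and can be divided out.\<close>

lemma smooth_family_J: "smooth_family J"
  unfolding smooth_family_def
proof (intro allI impI)
  fix W f c assume p: "patch \<delta> W f c"
  note f = patchD(1)[OF p] and D = patchD[OF p]
  note gd = gram_det[OF f D(2)]
  have pos: "0 < volume_density A g f (snd z)" if "z \<in> I\<delta> \<times> W" for z
    using oriented_frame(1)[OF f] that by auto
  have e: "sqrt (gram_det f c z) = J (fst z) (f (snd z)) * volume_density A g f (snd z)" if "z \<in> I\<delta> \<times> W" for z
    using gd(2)[of "fst z" "snd z"] that D(4) by (auto simp: subset_iff)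
  have "0 < sqrt (gram_det f c z)" if "z \<in> I\<delta> \<times> W" for z
    unfolding e[OF that] using that D(5) pos[OF that] by (intro mult_pos_pos) auto
  then have gpos: "0 < gram_det f c z" if "z \<in> I\<delta> \<times> W" for z using that by simp
  have "smooth_on (I\<delta> \<times> W) (\<lambda>z. sqrt (gram_det f c z) / volume_density A g f (snd z))"
    by (intro smooth_on_divide smooth_on_sqrt D(3) smooth_on_subset[OF gd(1) D(4)] gpos smooth_on_density[OF p]
        less_imp_neq[OF pos, symmetric])
  then show "smooth_on (I\<delta> \<times> W) (\<lambda>(t, y). J t (f y))"
  proof (rule smooth_on_cong[OF D(3)])
    fix z assume "z \<in> I\<delta> \<times> W"
    from e[OF this] pos[OF this]
    show "sqrt (gram_det f c z) / volume_density A g f (snd z) = (case z of (t, y) \<Rightarrow> J t (f y))"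
      by (simp add: case_prod_beta')
  qed
qed

lemma smooth_family_time_derivative:
  assumes Q: "smooth_family Q" and p: "patch \<delta> W f c" and ty: "t \<in> I\<delta>" "y \<in> W"
  shows "((\<lambda>s. Q s (f y)) has_real_derivative frechet_derivative (\<lambda>(t, y). Q t (f y)) (at (t, y)) (1, 0)) (at t)"
proof -
  let ?h = "\<lambda>(t, y). Q t (f y)"
  have d: "(?h has_derivative frechet_derivative ?h (at (t, y))) (at (t, y))"
    by (rule smooth_on_has_derivative[OF smooth_familyD[OF Q p]]) (use ty in auto)
  have "((\<lambda>s. (s, y)) has_derivative (\<lambda>h. (h, 0))) (at t)"
    by (intro has_derivative_Pair has_derivative_const has_derivative_ident)
  from has_derivative_compose[OF this d]
  have 1: "((\<lambda>s. Q s (f y)) has_derivative (\<lambda>h. frechet_derivative ?h (at (t, y)) (h, 0))) (at t)" by simp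
  have "frechet_derivative ?h (at (t, y)) (h, 0) = frechet_derivative ?h (at (t, y)) (1, 0) * h" for h
    using linear_cmul[OF has_derivative_linear[OF d], of h "(1, 0)"] by (simp add: mult.commute)
  then show ?thesis unfolding has_field_derivative_def by (rule has_derivative_eq_rhs[OF 1 ext])
qed

lemma smooth_family_deriv:
  assumes Q: "smooth_family Q"
  shows "smooth_family (\<lambda>t x. deriv (\<lambda>s. Q s x) t)"
  unfolding smooth_family_def
proof (intro allI impI)
  fix W f c assume p: "patch \<delta> W f c"
  have "smooth_on (I\<delta> \<times> W) (\<lambda>z. frechet_derivative (\<lambda>(t, y). Q t (f y)) (at z) (1, 0))"
    by (rule smooth_on_frechet_derivative[OF smooth_familyD[OF Q p]])
  then show "smooth_on (I\<delta> \<times> W) (\<lambda>(t, y). deriv (\<lambda>s. Q s (f y)) t)"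
    by (rule smooth_on_cong[OF patchD(3)[OF p]])
      (use DERIV_imp_deriv[OF smooth_family_time_derivative[OF Q p]] in auto)
qed

lemma smooth_family_has_derivative:
  assumes Q: "smooth_family Q" and tx: "t \<in> I\<delta>" "x \<in> L"
  shows "((\<lambda>s. Q s x) has_real_derivative deriv (\<lambda>s. Q s x) t) (at t)"
proof -
  obtain W f c y where p: "patch \<delta> W f c" "x = f y" "y \<in> W" using patches[OF tx(2)] by blast
  note d = smooth_family_time_derivative[OF Q p(1) tx(1) p(3), folded p(2)]
  show ?thesis using d DERIV_imp_deriv[OF d] by simp
qed

text \<open>The continuous inverse of a parametrization carries continuity over to \<open>L\<close>;
  the image of \<open>W\<close> is relatively open, so it decides continuity at its points.\<close>

lemma smooth_family_continuous:
  assumes Q: "smooth_family Q"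
  shows "continuous_on (I\<delta> \<times> L) (\<lambda>(t, x). Q t x)"
  unfolding continuous_on_eq_continuous_within
proof clarify
  fix t x assume tx: "t \<in> I\<delta>" "x \<in> L"
  obtain W f c where p: "patch \<delta> W f c" "x \<in> f ` W" using patches[OF tx(2)] by blast
  note D = local_paramD[OF oriented_paramD(1)[OF patchD(1)[OF p(1)]]]
  have "continuous_on (I\<delta> \<times> W) (\<lambda>(t, y). Q t (f y))"
    by (rule smooth_on_continuous_on[OF smooth_familyD[OF Q p(1)]])
  moreover have "continuous_on (I\<delta> \<times> f ` W) (\<lambda>z. (fst z, inv_into W f (snd z)))"
    by (intro continuous_on_Pair continuous_on_fst continuous_on_id continuous_on_compose2[OF D(9) continuous_on_snd]) auto
  ultimately have "continuous_on (I\<delta> \<times> f ` W) (\<lambda>z. (\<lambda>(t, y). Q t (f y)) (fst z, inv_into W f (snd z)))"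
    by (rule continuous_on_compose2) (auto intro: inv_into_into)
  then have c: "continuous_on (I\<delta> \<times> f ` W) (\<lambda>(t, x). Q t x)"
    by (rule continuous_on_eq) (auto simp: D(6))
  obtain V where V: "open V" "f ` W = L \<inter> V" using D(5) by (auto simp: openin_open)
  have "at (t, x) within I\<delta> \<times> L = at (t, x) within I\<delta> \<times> f ` W"
    by (rule at_within_nhd[of _ "UNIV \<times> V"]) (use V p tx in \<open>auto intro!: open_Times\<close>)
  moreover have "(t, x) \<in> I\<delta> \<times> f ` W" using tx p by auto
  ultimately show "continuous (at (t, x) within I\<delta> \<times> L) (\<lambda>(t, x). Q t x)"
    using c by (metis continuous_on_eq_continuous_within)
qed

section \<open>Integrals of smooth families over the submanifold\<close>

lemma volume_L: "is_riemannian_volume TYPE('k) A g L \<mu>"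
  unfolding \<mu> by (rule is_riemannian_volume[OF compact_L submanifold_L])

lemma finite_volume_L: "finite_measure \<mu>"
  by (rule finite_riemannian_volume[OF compact_L submanifold_L volume_L])

lemma sets_volume_L: "sets \<mu> = sets borel"
  using volume_L by (simp add: is_riemannian_volume_def)

lemma borel_L: "L \<in> sets borel" using compact_imp_closed[OF compact_L] by auto

lemma continuous_integrable:
  fixes q :: "'m \<Rightarrow> real"
  assumes "continuous_on L q"
  shows "(\<lambda>x. indicator L x * q x) \<in> borel_measurable borel" "integrable \<mu> (\<lambda>x. indicator L x * q x)"
proof -
  interpret finite_measure \<mu> by (rule finite_volume_L)
  show m: "(\<lambda>x. indicator L x * q x) \<in> borel_measurable borel"
    using borel_measurable_continuous_on_indicator[OF borel_L assms] by simp
  have "bounded (q ` L)" by (intro compact_imp_bounded compact_continuous_image assms compact_L)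
  then obtain B where B: "\<And>x. x \<in> L \<Longrightarrow> \<bar>q x\<bar> \<le> B" unfolding bounded_iff by auto
  have "norm (indicator L x * q x) \<le> \<bar>B\<bar>" for x
    using B[of x] by (auto simp: indicator_def)
  then show "integrable \<mu> (\<lambda>x. indicator L x * q x)"
    using m sets_volume_L by (intro integrable_const_bound[of _ "\<bar>B\<bar>"]) (auto cong: measurable_cong_sets)
qed

lemma smooth_family_continuous_slice:
  assumes Q: "smooth_family Q" and t: "t \<in> I\<delta>"
  shows "continuous_on L (Q t)"
proof -
  have "continuous_on L (\<lambda>x. (\<lambda>(t, x). Q t x) (t, x))"
    by (rule continuous_on_compose2[OF smooth_family_continuous[OF Q]]) (use t in \<open>auto intro!: continuous_intros\<close>)
  then show ?thesis by simp
qed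

text \<open>With \<open>r\<close> half the distance from \<open>t\<close> to the ends of
  \<open>I\<delta>\<close>, the closed interval of radius \<open>r\<close> stays inside. The time
  derivative is continuous, hence bounded, on its product with the compact \<open>L\<close>.\<close>

lemma smooth_family_integral:
  assumes Q: "smooth_family Q" and t: "t \<in> I\<delta>"
  shows "((\<lambda>s. \<integral>x. indicator L x * Q s x \<partial>\<mu>) has_real_derivative
    (\<integral>x. indicator L x * deriv (\<lambda>s. Q s x) t \<partial>\<mu>)) (at t)"
proof -
  define r where "r = (\<delta> - \<bar>t\<bar>) / 2"
  have r: "r > 0" using t by (auto simp: r_def)
  have s: "s \<in> I\<delta>" if "\<bar>s - t\<bar> \<le> r" for s
  proof -
    have aux: "a < d \<Longrightarrow> u \<le> a + b \<Longrightarrow> b \<le> (d - a) / 2 \<Longrightarrow> u < d" for a b d u :: real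
      by (simp add: field_simps)
    have "\<bar>t\<bar> < \<delta>" using t by auto
    then have "\<bar>s\<bar> < \<delta>" by (rule aux[of _ _ _ "\<bar>s - t\<bar>"]) (use that r_def in auto)
    then show ?thesis by auto
  qed
  note Q' = smooth_family_deriv[OF Q]
  have "bounded ((\<lambda>(t, x). deriv (\<lambda>s. Q s x) t) ` ({t - r..t + r} \<times> L))"
    by (intro compact_imp_bounded compact_continuous_image compact_Times compact_L compact_Icc
        continuous_on_subset[OF smooth_family_continuous[OF Q']]) (use s in auto)
  then obtain B where B: "\<And>s x. \<bar>s - t\<bar> \<le> r \<Longrightarrow> x \<in> L \<Longrightarrow> \<bar>deriv (\<lambda>s. Q s x) s\<bar> \<le> B"
    unfolding bounded_iff by fastforce
  show ?thesis
  proof (rule has_real_derivative_integral[OF finite_volume_L r, where B = "\<bar>B\<bar>"])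
    fix s assume st: "\<bar>s - t\<bar> < r"
    show "integrable \<mu> (\<lambda>x. indicator L x * Q s x)"
      by (rule continuous_integrable(2)[OF smooth_family_continuous_slice[OF Q s]]) (use st in simp)
    fix x
    show "((\<lambda>s. indicator L x * Q s x) has_real_derivative indicator L x * deriv (\<lambda>s. Q s x) s) (at s)"
      using DERIV_cmult[OF smooth_family_has_derivative[OF Q s], of s x 1] st
      by (cases "x \<in> L") auto
    show "\<bar>indicator L x * deriv (\<lambda>s. Q s x) s\<bar> \<le> \<bar>B\<bar>"
      using B[of s x] st by (auto simp: indicator_def)
  next
    show "(\<lambda>x. indicator L x * deriv (\<lambda>s. Q s x) t) \<in> borel_measurable \<mu>"
      using continuous_integrable(1)[OF smooth_family_continuous_slice[OF Q' t]] sets_volume_L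
      by (simp cong: measurable_cong_sets)
  qed
qed

text \<open>\<open>F (- t)\<close> gives injectivity, and a continuous injection of the compact
  \<open>L\<close> is a homeomorphism onto its image. The immersion property persists because the
  differential of \<open>F t\<close> has a left inverse.\<close>

lemma local_param_flow:
  assumes t: "t \<in> I\<delta>"
  shows "compact (F t ` L)" "inj_on (F t) L"
    "local_param A L W (f :: real^'k \<Rightarrow> 'm) \<Longrightarrow> local_param A (F t ` L) W (\<lambda>y. F t (f y))"
proof -
  have cF: "continuous_on N0 (F t)"
  proof -
    have "continuous_on N0 (\<lambda>x. (\<lambda>(t, x). F t x) (t, x))"
      by (rule continuous_on_compose2[OF continuous_on_flow]) (use I\<delta>[OF t] in \<open>auto intro!: continuous_intros\<close>)
    then show ?thesis by simp
  qed
  then have cL: "continuous_on L (F t)" by (rule continuous_on_subset[OF _ LN0])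
  show cFL: "compact (F t ` L)" by (rule compact_continuous_image[OF cL compact_L])
  have inv: "F (- t) (F t x) = x" if "x \<in> L" for x
    using flow_inverse[OF _ I\<delta>[OF t] flow_N0[OF t that]] LN0 that by auto
  show inj: "inj_on (F t) L" by (rule inj_onI) (metis inv)
  obtain h where h: "homeomorphism L (F t ` L) (F t) h"
    using homeomorphism_compact[OF compact_L cL refl inj] by blast
  assume f: "local_param A L W f"
  note D = local_paramD[OF f]
  let ?f = "\<lambda>y. F t (f y)"
  have fN0: "f ` W \<subseteq> N0" using D(7) LN0 by blast
  have IW: "open (I \<times> W)" by (intro open_Times D) auto
  have "smooth_on W (\<lambda>y. (t, y))"
    by (intro smooth_on_Pair D(1) smooth_on_const smooth_on_ident)
  moreover have "(\<lambda>y. (t, y)) ` W \<subseteq> I \<times> W" using I\<delta>[OF t] by blast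
  ultimately have sm: "smooth_into A W ?f"
    using smooth_into_compose[OF smooth_into_flow_compose[OF D(2,1) fN0] IW _ D(1)] by fastforce
  have injd: "inj (diff_into A ?f y)" if y: "y \<in> W" for y
  proof (rule injI)
    fix u v assume "diff_into A ?f y u = diff_into A ?f y v"
    then have "mdiff A (F t) (f y) (diff_into A f y u) = mdiff A (F t) (f y) (diff_into A f y v)"
      using diff_into_flow(3)[OF D(2,1) fN0 y I\<delta>[OF t]] by simp
    moreover have "f y \<in> N0" "F t (f y) \<in> N0" using y fN0 flow_N0[OF t] D(7) by auto
    ultimately have "diff_into A f y u = diff_into A f y v"
      using mdiff_flow_inverse[OF _ I\<delta>[OF t]] by metis
    then show "u = v" using D(3)[OF y] by (simp add: inj_eq)
  qed
  have im: "?f ` W = F t ` (f ` W)" by auto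
  have hW: "homeomorphism (f ` W) (F t ` f ` W) (F t) h"
    by (rule homeomorphism_of_subsets[OF h D(7) subset_refl refl]) 
  have "homeomorphism W (?f ` W) (F t \<circ> f) (inv_into W f \<circ> h)"
    unfolding im by (rule homeomorphism_compose[OF D(4) hW])
  moreover have injf: "inj_on ?f W" using comp_inj_on[OF D(6) inj_on_subset[OF inj D(7)]] by (simp add: o_def)
  have "inv_into W ?f q = (inv_into W f \<circ> h) q" if q: "q \<in> ?f ` W" for q
  proof -
    obtain y where y: "y \<in> W" "q = ?f y" using q by auto
    moreover have "h q = f y" using homeomorphism_apply1[OF hW, of "f y"] y by simp
    ultimately show ?thesis using inv_into_f_f[OF injf] inv_into_f_f[OF D(6)] by simp
  qed
  ultimately have "homeomorphism W (?f ` W) ?f (inv_into W ?f)"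
    by (auto intro: homeomorphism_cong)
  moreover have "openin (top_of_set (F t ` L)) (?f ` W)"
    unfolding im by (rule homeomorphism_imp_open_map[OF h D(5)])
  ultimately show "local_param A (F t ` L) W ?f" using D(1) sm injd by (simp add: local_param_def)
qed

lemma J_pos: "t \<in> I\<delta> \<Longrightarrow> x \<in> L \<Longrightarrow> 0 < J t x"
  using patches patchD(5) by blast

text \<open>\<open>J t\<close> is the Jacobian of \<open>F t\<close> along \<open>L\<close>, by
  \<open>volume_density_flow\<close>; its continuity on the compact \<open>L\<close> turns the
  extended integral into a real one.\<close>

lemma volume_flow:
  assumes t: "t \<in> I\<delta>"
  shows "submanifold_volume TYPE('k) A g (F t ` L) = (\<integral>x. indicator L x * J t x \<partial>\<mu>)"
proof -
  note lp = local_param_flow[OF t]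
  have sub: "submanifold TYPE('k) A (F t ` L)"
    unfolding submanifold_def
  proof
    fix q assume "q \<in> F t ` L"
    then obtain p where p: "p \<in> L" "q = F t p" by auto
    obtain W and f :: "real^'k \<Rightarrow> 'm" where "local_param A L W f" "p \<in> f ` W"
      using submanifold_L p(1) unfolding submanifold_def by blast
    then show "\<exists>W (f :: real^'k \<Rightarrow> 'm). local_param A (F t ` L) W f \<and> q \<in> f ` W"
      using lp(3) p(2) by (intro exI[of _ W] exI[of _ "\<lambda>y. F t (f y)"]) auto
  qed
  note ci = continuous_integrable[OF smooth_family_continuous_slice[OF smooth_family_J t]]
  have "emeasure (riemannian_volume TYPE('k) A g (F t ` L)) (F t ` L) = (\<integral>\<^sup>+x. ennreal (indicator L x * J t x) \<partial>\<mu>)"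
  proof (rule emeasure_volume_image[OF compact_L submanifold_L lp(1,2,3) ci(1) _ _ volume_L
        is_riemannian_volume[OF lp(1) sub]])
    show "0 \<le> J t x" if "x \<in> L" for x using J_pos[OF t that] by simp
    fix p assume "p \<in> L"
    then obtain W f c where "patch \<delta> W f c" "p \<in> f ` W" using patches by blast
    then show "\<exists>W (f :: real^'k \<Rightarrow> 'm). local_param A L W f \<and> p \<in> f ` W \<and>
        (\<forall>y\<in>W. volume_density A g (\<lambda>y. F t (f y)) y = J t (f y) * volume_density A g f y)"
      using patchD(1) oriented_paramD(1) volume_density_flow[OF _ _ I\<delta>[OF t]] by metis
  qed auto
  also have "\<dots> = ennreal (\<integral>x. indicator L x * J t x \<partial>\<mu>)"
    by (rule nn_integral_eq_integral[OF ci(2)]) (use J_pos[OF t] in \<open>auto simp: indicator_def intro: less_imp_le\<close>)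
  finally show ?thesis
    unfolding submanifold_volume_def measure_def
    using J_pos[OF t] by (simp add: Bochner_Integration.integral_nonneg_AE indicator_def less_imp_le)
qed

end

section \<open>Partitions of unity\<close>

text \<open>Profile of the bump functions; its derivative \<open>2 * max 0 s\<close> is continuous,
  and at \<open>0\<close> the difference quotient is bounded by the step.\<close>

lemma Ck_on_max_square: "Ck_on 1 UNIV (\<lambda>s::real. (max 0 s)\<^sup>2)"
proof -
  have d: "((\<lambda>s::real. (max 0 s)\<^sup>2) has_derivative (\<lambda>h. 2 * max 0 s * h)) (at s)" for s
  proof -
    consider "s > 0" | "s < 0" | "s = 0" by linarith
    then show ?thesis
    proof cases
      case 1
      have "((\<lambda>s::real. s\<^sup>2) has_derivative (\<lambda>h. 2 * max 0 s * h)) (at s)"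
        using 1 by (auto intro!: derivative_eq_intros)
      then show ?thesis by (rule has_derivative_transform_within_open[of _ _ _ _ "{0<..}"]) (use 1 in auto)
    next
      case 2
      have "((\<lambda>s::real. 0) has_derivative (\<lambda>h. 2 * max 0 s * h)) (at s)" using 2 by simp
      then show ?thesis by (rule has_derivative_transform_within_open[of _ _ _ _ "{..<0}"]) (use 2 in auto)
    next
      case 3
      have "((\<lambda>h::real. (max 0 h)\<^sup>2 / h) \<longlongrightarrow> 0) (at 0)"
      proof (rule tendsto_rabs_zero_cancel, rule tendsto_sandwich[of "\<lambda>_. 0" _ _ "\<lambda>h. \<bar>h\<bar>"])
        show "\<forall>\<^sub>F h::real in at 0. \<bar>(max 0 h)\<^sup>2 / h\<bar> \<le> \<bar>h\<bar>"
          by (intro always_eventually allI) (auto simp: max_def power2_eq_square abs_mult)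
        show "((\<lambda>h::real. \<bar>h\<bar>) \<longlongrightarrow> 0) (at 0)" by (intro tendsto_rabs_zero tendsto_ident_at)
      qed (auto intro!: always_eventually)
      then have "((\<lambda>s::real. (max 0 s)\<^sup>2) has_real_derivative 0) (at 0)"
        by (simp add: has_field_derivative_iff)
      then show ?thesis unfolding has_field_derivative_def 3 by (rule has_derivative_eq_rhs) auto
    qed
  qed
  have "Ck_on 0 UNIV (\<lambda>s::real. 2 * max 0 s * v)" for v by (auto intro!: continuous_intros)
  from Ck_on_SucI[OF open_UNIV d this] show ?thesis by simp
qed

context manifold
begin

definition C1 :: "('m \<Rightarrow> real) \<Rightarrow> bool" where
  "C1 \<beta> \<longleftrightarrow> (\<forall>c\<in>A. Ck_on 1 (chart_img c) (\<lambda>z. \<beta> (chart_inv c z)))"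

text \<open>Computed in the chart that identifies the tangent space at \<open>x\<close> with
  \<open>'b\<close>, so that it applies directly to vectors such as
  \<open>\<xi> x i\<close>.\<close>

definition mderiv :: "('m \<Rightarrow> real) \<Rightarrow> 'm \<Rightarrow> 'b \<Rightarrow> real" where
  "mderiv \<beta> x = frechet_derivative (\<lambda>z. \<beta> (chart_inv (chart_at A x) z)) (at (snd (chart_at A x) x))"

lemma mderiv_has_derivative:
  assumes "C1 \<beta>"
  shows "((\<lambda>z. \<beta> (chart_inv (chart_at A x) z)) has_derivative mderiv \<beta> x) (at (snd (chart_at A x) x))"
proof -
  have "Ck_on (Suc 0) (chart_img (chart_at A x)) (\<lambda>z. \<beta> (chart_inv (chart_at A x) z))"
    using assms chart_at by (simp add: C1_def)
  then show ?thesis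
    using chart_inv(4)[OF chart_at] unfolding mderiv_def by (auto simp: frechet_derivative_works)
qed

lemma linear_mderiv: "C1 \<beta> \<Longrightarrow> linear (mderiv \<beta> x)"
  by (rule has_derivative_linear[OF mderiv_has_derivative])

lemma mderiv_zero:
  assumes "C1 \<beta>" "closed C" "\<And>x. x \<notin> C \<Longrightarrow> \<beta> x = 0" "x \<notin> C"
  shows "mderiv \<beta> x w = 0"
proof -
  let ?c = "chart_at A x"
  have "open (snd ?c ` (fst ?c \<inter> - C))" using assms(2) by (intro open_chart_image chart_at) auto
  moreover have "snd ?c x \<in> snd ?c ` (fst ?c \<inter> - C)" using assms(4) chart_at by auto
  ultimately have "((\<lambda>z. 0) has_derivative mderiv \<beta> x) (at (snd ?c x))"
    by (rule has_derivative_transform_within_open[OF mderiv_has_derivative[OF assms(1)]])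
      (use assms(3) chart_inv(1)[OF chart_at(1)] in auto)
  from has_derivative_unique[OF this has_derivative_const] show ?thesis by simp
qed

lemma C1_compose:
  assumes \<beta>: "C1 \<beta>" and f: "smooth_into A W f" "open W"
  shows "Ck_on 1 W (\<lambda>y. \<beta> (f y))"
    "y \<in> W \<Longrightarrow> ((\<lambda>y. \<beta> (f y)) has_derivative (\<lambda>u. mderiv \<beta> (f y) (diff_into A f y u))) (at y)"
proof -
  show "Ck_on 1 W (\<lambda>y. \<beta> (f y))"
  proof (rule Ck_on_local)
    fix y assume y: "y \<in> W"
    let ?c = "chart_at A (f y)"
    note c = chart_at[of "f y"]
    let ?U = "W \<inter> f -` fst ?c"
    have U: "open ?U" by (rule smooth_into_preimage_open[OF f chartD(1)[OF c(1)]])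
    have h: "smooth_on ?U (\<lambda>y. snd ?c (f y))" using f(1) c by (simp add: smooth_into_def)
    have b: "Ck_on 1 (chart_img ?c) (\<lambda>z. \<beta> (chart_inv ?c z))" using \<beta> c unfolding C1_def by blast
    have "Ck_on 1 ?U (\<lambda>y. \<beta> (chart_inv ?c (snd ?c (f y))))"
      by (rule Ck_on_compose[OF U chartD(2)[OF c(1)] _ smooth_onD[OF h] b]) (use chart_inv(4)[OF c(1)] in auto)
    then have "Ck_on 1 ?U (\<lambda>y. \<beta> (f y))"
      by (rule Ck_on_cong[OF U]) (use chart_inv(1)[OF c(1)] in auto)
    with U y c show "\<exists>U. open U \<and> y \<in> U \<and> Ck_on 1 U (\<lambda>y. \<beta> (f y))" by blast
  qed
  assume y: "y \<in> W"
  let ?c = "chart_at A (f y)"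
  note c = chart_at[of "f y"]
  let ?U = "W \<inter> f -` fst ?c"
  have U: "open ?U" by (rule smooth_into_preimage_open[OF f chartD(1)[OF c(1)]])
  have yU: "y \<in> ?U" using y c by simp
  show "((\<lambda>y. \<beta> (f y)) has_derivative (\<lambda>u. mderiv \<beta> (f y) (diff_into A f y u))) (at y)"
    by (rule has_derivative_transform_within_open[OF has_derivative_compose[OF
            diff_into_has_derivative[OF smooth_into_pdiff[OF f y]] mderiv_has_derivative[OF \<beta>]] U yU])
      (use chart_inv(1)[OF c(1)] in auto)
qed

lemma C1_isCont:
  assumes "C1 \<beta>"
  shows "continuous_on UNIV \<beta>"
proof (rule continuous_at_imp_continuous_on, rule ballI)
  fix x
  let ?c = "chart_at A x"
  note c = chart_at[of x]
  have "Ck_on 1 (chart_img ?c) (\<lambda>z. \<beta> (chart_inv ?c z))" using assms c unfolding C1_def by blast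
  from Ck_on_mono[OF zero_le_one this]
  have "continuous_on (chart_img ?c) (\<lambda>z. \<beta> (chart_inv ?c z))" by simp
  then have "continuous_on (fst ?c) (\<lambda>x. \<beta> (chart_inv ?c (snd ?c x)))"
    by (rule continuous_on_compose2[OF _ chartD(3)[OF c(1)]]) (use chart_inv(4)[OF c(1)] in auto)
  then have "continuous_on (fst ?c) \<beta>"
    by (rule continuous_on_eq) (simp add: chart_inv(1)[OF c(1)])
  then show "isCont \<beta> x" using chartD(1)[OF c(1)] c(2) by (simp add: continuous_on_eq_continuous_at)
qed

text \<open>A radial C1 function supported in a closed coordinate ball. The image \<open>C\<close>
  of this ball is compact, hence closed in the Hausdorff space, so extension by zero is C1: the
  chart domain and the complement of \<open>C\<close> are open and cover everything.\<close>

lemma bump: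
  assumes Q: "open Q" "p \<in> Q"
  obtains \<beta> C where "C1 \<beta>" "\<And>x. 0 \<le> \<beta> x" "0 < \<beta> p" "closed C" "C \<subseteq> Q" "\<And>x. x \<notin> C \<Longrightarrow> \<beta> x = 0"
proof -
  let ?d = "chart_at A p"
  note d = chart_at[of p]
  let ?V = "snd ?d ` (fst ?d \<inter> Q)"
  have "open ?V" "snd ?d p \<in> ?V" using open_chart_image[OF d(1) Q(1)] d(2) Q(2) by auto
  then obtain r where r: "r > 0" "cball (snd ?d p) r \<subseteq> ?V" using open_contains_cball by blast
  have rI: "cball (snd ?d p) r \<subseteq> chart_img ?d" using r(2) by (auto simp: chart_img_def)
  define q where "q z = r\<^sup>2 - (z - snd ?d p) \<bullet> (z - snd ?d p)" for z
  define b where "b z = (max 0 (q z))\<^sup>2" for z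
  define C where "C = chart_inv ?d ` cball (snd ?d p) r"
  define \<beta> where "\<beta> x = (if x \<in> fst ?d then b (snd ?d x) else 0)" for x
  have "compact C" unfolding C_def
    by (intro compact_continuous_image continuous_on_subset[OF chartD(4)[OF d(1)] rI]) auto
  then have C: "closed C" by (rule compact_imp_closed)
  have z: "\<beta> x = 0" if "x \<notin> C" for x
  proof (cases "x \<in> fst ?d")
    case True
    have "snd ?d x \<notin> cball (snd ?d p) r"
      using that chart_inv(1)[OF d(1) True] unfolding C_def by (metis imageI)
    then have "r < norm (snd ?d x - snd ?d p)" by (simp add: dist_norm norm_minus_commute)
    then have "r\<^sup>2 < (norm (snd ?d x - snd ?d p))\<^sup>2" using r(1) by (intro power_strict_mono) auto
    then show ?thesis using True by (simp add: \<beta>_def b_def q_def power2_norm_eq_inner)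
  qed (simp add: \<beta>_def)
  have "Ck_on 1 UNIV q" unfolding q_def diff_conv_add_uminus
    by (intro Ck_on_add open_UNIV Ck_on_const
        Ck_on_bounded_linear_comp[OF bounded_linear_minus[OF bounded_linear_ident]]
        bounded_bilinear.Ck_on[OF bounded_bilinear_inner] Ck_on_ident)
  from Ck_on_compose[OF open_UNIV open_UNIV _ this Ck_on_max_square]
  have b: "Ck_on 1 UNIV b" unfolding b_def[abs_def] by blast
  have "Ck_on 1 (chart_img c) (\<lambda>z. \<beta> (chart_inv c z))" if c: "c \<in> A" for c
  proof (rule Ck_on_local)
    fix z assume zc: "z \<in> chart_img c"
    show "\<exists>U. open U \<and> z \<in> U \<and> Ck_on 1 U (\<lambda>z. \<beta> (chart_inv c z))"
    proof (cases "chart_inv c z \<in> C")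
      case True
      then have zd: "chart_inv c z \<in> fst ?d" using chart_inv(3)[OF d(1)] rI by (auto simp: C_def)
      let ?U = "snd c ` (fst c \<inter> fst ?d)"
      have U: "open ?U" by (rule open_chart_image[OF c chartD(1)[OF d(1)]])
      have "Ck_on 1 ?U (\<lambda>z. b (snd ?d (chart_inv c z)))"
        by (rule Ck_on_compose[OF U open_UNIV _ smooth_onD[OF smooth_transition[OF c d(1)]] b]) simp
      then have "Ck_on 1 ?U (\<lambda>z. \<beta> (chart_inv c z))"
        by (rule Ck_on_cong[OF U]) (auto simp: \<beta>_def chart_inv(1)[OF c])
      moreover have "z \<in> ?U" using zc zd by (simp add: chart_image_eq[OF c])
      ultimately show ?thesis using U by blast
    next
      case False
      let ?U = "snd c ` (fst c \<inter> - C)"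
      have U: "open ?U" using C by (intro open_chart_image[OF c]) auto
      have "Ck_on 1 ?U (\<lambda>z. \<beta> (chart_inv c z))"
        by (rule Ck_on_cong[OF U Ck_on_const[of _ _ 0]]) (auto simp: z chart_inv(1)[OF c])
      moreover have "z \<in> ?U" using zc False by (simp add: chart_image_eq[OF c])
      ultimately show ?thesis using U by blast
    qed
  qed
  then have "C1 \<beta>" by (simp add: C1_def)
  moreover have "0 < \<beta> p" using d(2) r(1) by (simp add: \<beta>_def b_def q_def)
  moreover have "C \<subseteq> Q" using r(2) chart_inv(1)[OF d(1)] by (auto simp: C_def)
  moreover have "0 \<le> \<beta> x" for x by (simp add: \<beta>_def b_def)
  ultimately show thesis using that C z by blast
qed

end

section \<open>The flow preserves the integral of a closed form\<close>

locale closed_form_flow = flow_nbhd A N N0 X \<epsilon> F g L Or \<xi> \<delta> \<mu>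
  for A :: "('m::{t2_space, second_countable_topology}, 'b::euclidean_space) chart set"
    and N N0 X \<epsilon> F g L and Or :: "'m \<Rightarrow> ('k::finite \<Rightarrow> 'b) set" and \<xi> \<delta> \<mu> +
  fixes \<phi> :: "'m \<Rightarrow> ('k \<Rightarrow> 'b) \<Rightarrow> real"
  assumes \<phi>: "smooth_form A \<phi>" "closed_form A \<phi>"
begin

definition P :: "real \<Rightarrow> 'm \<Rightarrow> real" where
  "P t x = \<phi> (F t x) (\<lambda>i. mdiff A (F t) x (\<xi> x i))"

definition coords :: "(real^'k \<Rightarrow> 'm) \<Rightarrow> ('m, 'b) chart \<Rightarrow> real \<times> (real^'k) \<Rightarrow> 'b" where
  "coords f c = (\<lambda>(t, y). snd c (F t (f y)))"

definition pullback :: "(real^'k \<Rightarrow> 'm) \<Rightarrow> ('m, 'b) chart \<Rightarrow> real \<times> (real^'k) \<Rightarrow> real" where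
  "pullback f c z = local_form A c \<phi> (coords f c z) (\<lambda>i. frechet_derivative (coords f c) (at z) (0, axis i 1))"

text \<open>Component \<open>i\<close> of the field whose divergence is the time derivative of
  \<open>pullback\<close>. The time direction replaces the vector in slot \<open>i\<close> and stays
  in that position, so no signs appear.\<close>

definition contraction :: "(real^'k \<Rightarrow> 'm) \<Rightarrow> ('m, 'b) chart \<Rightarrow> 'k \<Rightarrow> real \<times> (real^'k) \<Rightarrow> real" where
  "contraction f c i z = local_form A c \<phi> (coords f c z)
     ((\<lambda>j. frechet_derivative (coords f c) (at z) (0, axis j 1))(i := frechet_derivative (coords f c) (at z) (1, 0)))"

section \<open>The pulled back form on a patch\<close>

lemma alternating_\<phi>: "alternating_form (\<phi> p)"
  using \<phi>(1) by (simp add: smooth_form_def)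

lemma alternating_local_form: "c \<in> A \<Longrightarrow> z \<in> chart_img c \<Longrightarrow> alternating_form (local_form A c \<phi> z)"
  unfolding local_form_def[abs_def]
  by (rule alternating_form_compose_linear[OF alternating_\<phi> linear_tvec]) (auto intro: chart_inv)

lemma smooth_local_form: "c \<in> A \<Longrightarrow> smooth_on (chart_img c) (\<lambda>z. local_form A c \<phi> z v)"
  using \<phi>(1) by (simp add: smooth_form_def)

lemma patch_coords:
  assumes p: "patch \<delta> W f c"
  shows "smooth_on (I\<delta> \<times> W) (coords f c)" "coords f c ` (I\<delta> \<times> W) \<subseteq> chart_img c"
    "t \<in> I\<delta> \<Longrightarrow> y \<in> W \<Longrightarrow> pullback f c (t, y) = P t (f y) * volume_density A g f y"
    "t \<in> I\<delta> \<Longrightarrow> y \<in> W \<Longrightarrow> contraction f c i (t, y) =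
      \<phi> (F t (f y)) ((\<lambda>j. mdiff A (F t) (f y) (coord_frame A f y j))(i := X (F t (f y))))"
proof -
  note D = patchD[OF p] and o = oriented_paramD[OF patchD(1)[OF p]]
  note fc = flow_coord[OF o(2,3,5) D(2), folded coords_def]
  show "smooth_on (I\<delta> \<times> W) (coords f c)" by (rule smooth_on_subset[OF fc(2) D(4)])
  show "coords f c ` (I\<delta> \<times> W) \<subseteq> chart_img c" using fc(3) D(4) by (rule order_trans[OF image_mono, rotated])
  assume ty: "t \<in> I\<delta>" "y \<in> W"
  then have m: "(t, y) \<in> I \<times> W \<inter> (\<lambda>(t, y). F t (f y)) -` fst c" using D(4) by blast
  have e: "tvec A c (F t (f y)) (frechet_derivative (coords f c) (at (t, y)) (0, axis i 1)) =
      mdiff A (F t) (f y) (coord_frame A f y i)" for i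
    using fc(5)[OF m] by (simp add: coord_frame_def)
  have "f y \<in> N0" using o(5) ty by auto
  from alternating_form_compose_linear[OF alternating_\<phi> linear_mdiff[OF mpdiff_flow[OF this I\<delta>[OF ty(1)]]]]
  have "alternating_form (\<lambda>v. \<phi> (F t (f y)) (\<lambda>i. mdiff A (F t) (f y) (v i)))" .
  from oriented_frame(2)[OF D(1) ty(2) this]
  show "pullback f c (t, y) = P t (f y) * volume_density A g f y"
    by (simp add: pullback_def local_form_def fc(4)[OF m] e P_def mult.commute)
  have "(\<lambda>j. tvec A c (F t (f y)) (((\<lambda>j. frechet_derivative (coords f c) (at (t, y)) (0, axis j 1))
      (i := frechet_derivative (coords f c) (at (t, y)) (1, 0))) j)) =
    (\<lambda>j. mdiff A (F t) (f y) (coord_frame A f y j))(i := X (F t (f y)))"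
    using e fc(6)[OF m] by (auto simp: fun_eq_iff)
  then show "contraction f c i (t, y) =
      \<phi> (F t (f y)) ((\<lambda>j. mdiff A (F t) (f y) (coord_frame A f y j))(i := X (F t (f y))))"
    by (simp add: contraction_def local_form_def fc(4)[OF m])
qed

lemma smooth_on_pullback:
  assumes p: "patch \<delta> W f c"
  shows "smooth_on (I\<delta> \<times> W) (pullback f c)" "smooth_on (I\<delta> \<times> W) (contraction f c i)"
proof -
  note D = patchD[OF p] and G = patch_coords(1,2)[OF p]
  note m = smooth_on_multilinear[where a = "local_form A c \<phi>" and G = "coords f c", OF D(3) chartD(2)[OF D(2)] G(2,1)
      smooth_local_form[OF D(2)] alternating_form_linear[OF alternating_local_form[OF D(2)]]]
  show "smooth_on (I\<delta> \<times> W) (pullback f c)"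
    unfolding pullback_def[abs_def] by (rule m) (auto intro: smooth_on_frechet_derivative G)
  have "smooth_on (I\<delta> \<times> W) (\<lambda>z. local_form A c \<phi> (coords f c z)
    (\<lambda>j. frechet_derivative (coords f c) (at z) (if j = i then (1, 0) else (0, axis j 1))))"
    by (rule m) (auto intro: smooth_on_frechet_derivative G)
  moreover have "(\<lambda>j. frechet_derivative (coords f c) (at z) (if j = i then (1, 0) else (0, axis j 1))) =
    (\<lambda>j. frechet_derivative (coords f c) (at z) (0, axis j 1))(i := frechet_derivative (coords f c) (at z) (1, 0))" for z
    by auto
  ultimately show "smooth_on (I\<delta> \<times> W) (contraction f c i)" by (simp add: contraction_def[abs_def])
qed

lemma smooth_family_P: "smooth_family P"
  unfolding smooth_family_def
proof (intro allI impI)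
  fix W f c assume p: "patch \<delta> W f c"
  have pos: "0 < volume_density A g f (snd z)" if "z \<in> I\<delta> \<times> W" for z
    using oriented_frame(1)[OF patchD(1)[OF p]] that by auto
  have "smooth_on (I\<delta> \<times> W) (\<lambda>z. pullback f c z / volume_density A g f (snd z))"
    by (intro smooth_on_divide patchD(3)[OF p] smooth_on_pullback[OF p] smooth_on_density[OF p]
        less_imp_neq[OF pos, symmetric])
  then show "smooth_on (I\<delta> \<times> W) (\<lambda>(t, y). P t (f y))"
  proof (rule smooth_on_cong[OF patchD(3)[OF p]])
    fix z assume z: "z \<in> I\<delta> \<times> W"
    then show "pullback f c z / volume_density A g f (snd z) = (case z of (t, y) \<Rightarrow> P t (f y))"
      using pos[OF z] patch_coords(3)[OF p] by (auto simp: case_prod_beta')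
  qed
qed

text \<open>Cartan's formula on the product of time and parameter, with \<open>e0 = (1, 0)\<close>
  and \<open>E i = (0, axis i 1)\<close>; the density does not depend on time and passes through the
  derivative.\<close>

lemma deriv_P_density:
  assumes p: "patch \<delta> W f c" and ty: "t \<in> I\<delta>" "y \<in> W"
  shows "deriv (\<lambda>s. P s (f y)) t * volume_density A g f y =
    (\<Sum>i\<in>UNIV. frechet_derivative (contraction f c i) (at (t, y)) (0, axis i 1))"
proof -
  note D = patchD[OF p] and G = patch_coords(1,2)[OF p]
  have S: "(t, y) \<in> I\<delta> \<times> W" using ty by simp
  have z: "coords f c (t, y) \<in> chart_img c" using G(2) S by auto
  have d: "(pullback f c has_derivative frechet_derivative (pullback f c) (at (t, y))) (at (t, y))"
    by (rule smooth_on_has_derivative[OF smooth_on_pullback(1)[OF p] S])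
  have "((\<lambda>s. (s, y)) has_derivative (\<lambda>h. (h, 0))) (at t)"
    by (intro has_derivative_Pair has_derivative_const has_derivative_ident)
  from has_derivative_compose[OF this d]
  have 1: "((\<lambda>s. pullback f c (s, y)) has_derivative (\<lambda>h. frechet_derivative (pullback f c) (at (t, y)) (h, 0))) (at t)" .
  have "((\<lambda>s. P s (f y) * volume_density A g f y) has_derivative (\<lambda>h. frechet_derivative (pullback f c) (at (t, y)) (h, 0))) (at t)"
    by (rule has_derivative_transform_within_open[OF 1 _ ty(1)]) (use patch_coords(3)[OF p _ ty(2)] in auto)
  moreover have "f y \<in> L" using oriented_paramD(4)[OF D(1)] ty by auto
  from DERIV_cmult_right[OF smooth_family_has_derivative[OF smooth_family_P ty(1) this], of "volume_density A g f y"]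
  have "((\<lambda>s. P s (f y) * volume_density A g f y) has_derivative
      (\<lambda>h. deriv (\<lambda>s. P s (f y)) t * volume_density A g f y * h)) (at t)"
    by (simp add: has_field_derivative_def)
  ultimately have "deriv (\<lambda>s. P s (f y)) t * volume_density A g f y * 1 = frechet_derivative (pullback f c) (at (t, y)) (1, 0)"
    using has_derivative_unique by metis
  also have "\<dots> = (\<Sum>i\<in>UNIV. frechet_derivative (contraction f c i) (at (t, y)) (0, axis i 1))"
    unfolding pullback_def[abs_def] contraction_def[abs_def]
  proof (rule closed_form_pullback_derivative[where a = "local_form A c \<phi>", OF D(3) S chartD(2)[OF D(2)] G(2,1)
        smooth_local_form[OF D(2)] alternating_local_form[OF D(2)]])
    fix v w
    \<comment> \<open>\<open>case_option w v\<close> puts \<open>w\<close> into the distinguished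
      slot \<open>None\<close> of the exterior derivative and \<open>v\<close> into the
      others.\<close>
    have "ext_deriv A c \<phi> (coords f c (t, y)) (case_option w v) = 0"
      using \<phi>(2) D(2) z by (simp add: closed_form_def)
    then show "frechet_derivative (\<lambda>z. local_form A c \<phi> z v) (at (coords f c (t, y))) w =
        (\<Sum>i\<in>UNIV. frechet_derivative (\<lambda>z. local_form A c \<phi> z (v(i := w))) (at (coords f c (t, y))) (v i))"
      by (simp add: ext_deriv_def)
  qed
  finally show ?thesis by simp
qed

text \<open>Only the trace of \<open>C\<close> on \<open>L\<close> has to lie in the patch, since
  \<open>f\<close> parametrizes a piece of \<open>L\<close> and not an open set of the
  manifold.\<close>

definition bump_patch :: "(real^'k) set \<Rightarrow> (real^'k \<Rightarrow> 'm) \<Rightarrow> ('m, 'b) chart \<Rightarrow> ('m \<Rightarrow> real) \<Rightarrow> 'm set \<Rightarrow> bool" where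
  "bump_patch W f c \<beta> C \<longleftrightarrow> patch \<delta> W f c \<and> C1 \<beta> \<and> (\<forall>x. 0 \<le> \<beta> x) \<and> closed C \<and> L \<inter> C \<subseteq> f ` W \<and>
     (\<forall>x. x \<notin> C \<longrightarrow> \<beta> x = 0)"

lemma bump_patches:
  obtains n :: nat and W f c \<beta> C where "\<And>i. i < n \<Longrightarrow> bump_patch (W i) (f i) (c i) (\<beta> i) (C i)"
    "\<And>x. x \<in> L \<Longrightarrow> 0 < (\<Sum>i<n. \<beta> i x)"
proof -
  define Q where "Q = (\<lambda>(W, f, c, \<beta>, C). bump_patch W f c \<beta> C)"
  define im :: "(real^'k) set \<times> (real^'k \<Rightarrow> 'm) \<times> ('m, 'b) chart \<times> ('m \<Rightarrow> real) \<times> 'm set \<Rightarrow> 'm set"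
    where "im = (\<lambda>(W, f, c, \<beta>, C). L \<inter> \<beta> -` {0<..})"
  have cov: "\<exists>z. Q z \<and> openin (top_of_set L) (im z) \<and> p \<in> im z" if p: "p \<in> L" for p
  proof -
    obtain W f c where pa: "patch \<delta> W f c" "p \<in> f ` W" using patches[OF p] by blast
    note D = local_paramD[OF oriented_paramD(1)[OF patchD(1)[OF pa(1)]]]
    obtain V where V: "open V" "f ` W = L \<inter> V" using D(5) by (auto simp: openin_open)
    then have "p \<in> V" using pa(2) by auto
    from bump[OF V(1) this] obtain \<beta> C where b: "C1 \<beta>" "\<And>x. 0 \<le> \<beta> x" "0 < \<beta> p" "closed C" "C \<subseteq> V"
      "\<And>x. x \<notin> C \<Longrightarrow> \<beta> x = 0" by metis
    have "bump_patch W f c \<beta> C" using b V pa(1) by (auto simp: bump_patch_def)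
    moreover have "openin (top_of_set L) (L \<inter> \<beta> -` {0<..})"
      using continuous_on_open_vimage[OF open_UNIV, of \<beta>] C1_isCont[OF b(1)] by (intro openin_open_Int) auto
    ultimately show ?thesis using p b(3) by (intro exI[of _ "(W, f, c, \<beta>, C)"]) (simp add: Q_def im_def)
  qed
  obtain n :: nat and z where z: "\<And>i. i < n \<Longrightarrow> Q (z i)" "L = (\<Union>i<n. im (z i))"
    using compact_finite_openin_cover[of L Q im, OF compact_L cov] by metis
  define W f c \<beta> C where "W i = fst (z i)" and "f i = fst (snd (z i))" and "c i = fst (snd (snd (z i)))"
    and "\<beta> i = fst (snd (snd (snd (z i))))" and "C i = snd (snd (snd (snd (z i))))" for i
  have b: "bump_patch (W i) (f i) (c i) (\<beta> i) (C i)" if "i < n" for i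
    using z(1)[OF that] by (simp add: Q_def W_def f_def c_def \<beta>_def C_def case_prod_beta')
  have "0 < (\<Sum>i<n. \<beta> i x)" if x: "x \<in> L" for x
  proof -
    have "x \<in> (\<Union>i<n. im (z i))" using x z(2) by blast
    then obtain i where i: "i < n" "x \<in> im (z i)" by blast
    then have "0 < \<beta> i x" by (auto simp: im_def \<beta>_def case_prod_beta')
    then show ?thesis using i(1) b by (intro sum_pos2[of _ i]) (auto simp: bump_patch_def)
  qed
  with b show thesis using that by blast
qed

text \<open>
  The integrand below is the coordinate divergence of the contraction of the pulled back form with
  \<open>X\<close>, cut off by \<open>\<beta> / B\<close>. Both summands are expressed through the orthonormal frame \<open>\<xi>\<close>, so that
  it is a function on \<open>L\<close> that does not refer to the patch.
\<close>

lemma integral_divergence_patch: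
  assumes bp: "bump_patch W f c \<beta> C" and t: "t \<in> I\<delta>"
    and B: "C1 B" "\<And>x. x \<in> L \<Longrightarrow> 0 < B x"
  defines "h \<equiv> \<lambda>x. \<beta> x / B x * deriv (\<lambda>s. P s x) t + (\<Sum>i\<in>UNIV.
      (mderiv \<beta> x (\<xi> x i) * B x - \<beta> x * mderiv B x (\<xi> x i)) / (B x)\<^sup>2 *
      \<phi> (F t x) ((\<lambda>j. mdiff A (F t) x (\<xi> x j))(i := X (F t x))))"
  shows "integrable \<mu> (\<lambda>x. indicator L x * h x)" "(\<integral>x. indicator L x * h x \<partial>\<mu>) = 0"
proof -
  have p: "patch \<delta> W f c" and \<beta>: "C1 \<beta>" "closed C" "L \<inter> C \<subseteq> f ` W" "\<And>x. x \<notin> C \<Longrightarrow> \<beta> x = 0"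
    using bp by (auto simp: bump_patch_def)
  note D = patchD[OF p] and o = oriented_paramD[OF patchD(1)[OF p]]
  note lp = local_paramD[OF o(1)]
  define \<rho> where "\<rho> y = \<beta> (f y) * inverse (B (f y))" for y
  define u where "u i y = \<rho> y * contraction f c i (t, y)" for i y
  \<comment> \<open>The part of the parameter domain over \<open>C\<close>: compact as a continuous
    image of \<open>L \<inter> C\<close>, and \<open>\<rho>\<close> vanishes outside it.\<close>
  define K where "K = inv_into W f ` (L \<inter> C)"
  have BW: "0 < B (f y)" if "y \<in> W" for y using B(2) o(4) that by auto
  have \<rho>C: "Ck_on 1 W \<rho>"
    unfolding \<rho>_def
    by (intro bounded_bilinear.Ck_on[OF bounded_bilinear_mult] Ck_on_inverse C1_compose(1)[OF \<beta>(1) o(2,3)]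
        C1_compose(1)[OF B(1) o(2,3)] o(3) less_imp_neq[OF BW, symmetric])
  have emb: "((\<lambda>y. (t, y)) has_derivative (\<lambda>v. (0, v))) (at y)" for y :: "real^'k"
    by (intro has_derivative_Pair has_derivative_const has_derivative_ident)
  have cS: "smooth_on W (\<lambda>y. contraction f c i (t, y))" for i
    by (rule smooth_on_compose[OF o(3) D(3) _ _ smooth_on_pullback(2)[OF p]])
      (use t in \<open>auto intro!: smooth_on_Pair smooth_on_const smooth_on_ident o(3)\<close>)
  have uC: "Ck_on 1 W (u i)" for i
    unfolding u_def
    by (intro bounded_bilinear.Ck_on[OF bounded_bilinear_mult] \<rho>C smooth_onD[OF cS] o(3))
  have K: "compact K" "K \<subseteq> W"
  proof -
    have "compact (L \<inter> C)" by (rule compact_Int_closed[OF compact_L \<beta>(2)])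
    then show "compact K" unfolding K_def
      by (rule compact_continuous_image[OF continuous_on_subset[OF lp(9) \<beta>(3)]])
    show "K \<subseteq> W" unfolding K_def using \<beta>(3) by (auto intro: inv_into_into)
  qed
  have supp: "f y \<notin> C" if "y \<in> W" "y \<notin> K" for y
    using that lp(6) o(4) unfolding K_def by (metis IntI image_eqI image_subset_iff inv_into_f_f)
  have u0: "u i y = 0" if "y \<in> W" "y \<notin> K" for i y
    using \<beta>(4)[OF supp[OF that]] by (simp add: u_def \<rho>_def)
  note div = integral_derivative_compact_support[OF o(3) uC K u0]
  have main: "(\<Sum>i\<in>UNIV. frechet_derivative (u i) (at y) (axis i 1)) = volume_density A g f y * h (f y)"
    if y: "y \<in> W" for y
  proof -
    have fL: "f y \<in> L" "f y \<in> N0" using o(4,5) y by auto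
    let ?x = "f y"
    let ?l = "\<lambda>w. (mderiv \<beta> ?x w * B ?x - \<beta> ?x * mderiv B ?x w) / (B ?x)\<^sup>2"
    let ?M = "mdiff A (F t) ?x"
    have \<rho>d: "(\<rho> has_derivative (\<lambda>v. ?l (diff_into A f y v))) (at y)"
    proof -
      have "((\<lambda>y. \<beta> (f y) * inverse (B (f y))) has_derivative
        (\<lambda>v. \<beta> ?x * - (inverse (B ?x) * mderiv B ?x (diff_into A f y v) * inverse (B ?x)) +
           mderiv \<beta> ?x (diff_into A f y v) * inverse (B ?x))) (at y)"
        by (rule has_derivative_mult[OF C1_compose(2)[OF \<beta>(1) o(2,3) y]
              Deriv.has_derivative_inverse[OF less_imp_neq[OF BW[OF y], symmetric] C1_compose(2)[OF B(1) o(2,3) y]]])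
      then show ?thesis unfolding \<rho>_def
        by (rule has_derivative_eq_rhs) (use BW[OF y] in \<open>auto simp: field_simps power2_eq_square\<close>)
    qed
    have cd: "((\<lambda>y. contraction f c i (t, y)) has_derivative
        (\<lambda>v. frechet_derivative (contraction f c i) (at (t, y)) (0, v))) (at y)" for i
      by (rule has_derivative_compose[OF emb smooth_on_has_derivative[OF smooth_on_pullback(2)[OF p]]]) (use t y in auto)
    have ud: "frechet_derivative (u i) (at y) (axis i 1) =
        \<rho> y * frechet_derivative (contraction f c i) (at (t, y)) (0, axis i 1) +
        ?l (coord_frame A f y i) * contraction f c i (t, y)" for i
      using frechet_derivative_eqI[OF has_derivative_mult[OF \<rho>d cd[of i]]]
      by (simp add: u_def[abs_def] coord_frame_def)
    have lM: "linear ?M" by (rule linear_mdiff[OF mpdiff_flow[OF fL(2) I\<delta>[OF t]]])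
    \<comment> \<open>Writing \<open>X (F t x)\<close> as \<open>?M w\<close> makes the contraction
      an alternating form in the frame at \<open>x\<close> itself. Then
      \<open>alternating_form_contract\<close> and \<open>oriented_frame\<close> turn the sum over
      the coordinate frame into the sum over \<open>\<xi>\<close>.\<close>
    have "inj ?M" using mdiff_flow_inverse[OF fL(2) I\<delta>[OF t] flow_N0[OF t fL(1)]] by (metis injI)
    then have "surj ?M" using lM linear_injective_imp_surjective by blast
    then obtain w where w: "?M w = X (F t ?x)" by (metis surjD)
    have M: "(\<lambda>j. ?M ((v(i := w)) j)) = (\<lambda>j. ?M (v j))(i := X (F t ?x))" for v :: "'k \<Rightarrow> 'b" and i
      using w by auto
    have ll: "linear ?l"
      by (rule linearI) (simp_all add: linear_add[OF linear_mderiv] linear_cmul[OF linear_mderiv] \<beta>(1) B(1)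
          add_divide_distrib[symmetric] algebra_simps)
    have "alternating_form (\<lambda>v. \<Sum>i\<in>UNIV. ?l (v i) * \<phi> (F t ?x) (\<lambda>j. ?M ((v(i := w)) j)))"
      by (rule alternating_form_contract[OF alternating_form_compose_linear[OF alternating_\<phi> lM] ll])
    from oriented_frame(2)[OF D(1) y this]
    have "(\<Sum>i\<in>UNIV. ?l (coord_frame A f y i) * contraction f c i (t, y)) =
      volume_density A g f y * (\<Sum>i\<in>UNIV. ?l (\<xi> ?x i) * \<phi> (F t ?x) ((\<lambda>j. ?M (\<xi> ?x j))(i := X (F t ?x))))"
      unfolding M patch_coords(4)[OF p t y] by simp
    then show ?thesis
      unfolding ud sum.distrib sum_distrib_left[symmetric] deriv_P_density[OF p t y, symmetric] h_def
      by (simp add: \<rho>_def divide_inverse algebra_simps)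
  qed
  have hW: "continuous_on (f ` W) h"
  proof -
    have d0: "volume_density A g f y \<noteq> 0" if "y \<in> W" for y using oriented_frame(1)[OF D(1) that] by simp
    have "continuous_on W (\<lambda>y. frechet_derivative (u i) (at y) (axis i 1))" for i
      using uC[of i] by simp
    then have "continuous_on W (\<lambda>y. (\<Sum>i\<in>UNIV. frechet_derivative (u i) (at y) (axis i 1)) / volume_density A g f y)"
      by (intro continuous_on_divide continuous_on_sum continuous_volume_density[OF o(2,3)])
        (use d0 in auto)
    then have "continuous_on W (\<lambda>y. h (f y))"
      by (rule continuous_on_eq) (simp add: main d0)
    then have "continuous_on (f ` W) (\<lambda>x. h (f (inv_into W f x)))"
      by (rule continuous_on_compose2[OF _ lp(9)]) (auto intro: inv_into_into)
    then show ?thesis by (rule continuous_on_eq) (auto simp: lp(6))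
  qed
  have h0: "h x = 0" if "x \<notin> C" for x
    using \<beta>(4)[OF that] mderiv_zero[OF \<beta>(1,2,4) that] by (simp add: h_def)
  \<comment> \<open>Continuity is glued from two relatively open sets: the image of
    \<open>W\<close>, where \<open>main\<close> expresses \<open>h\<close> in coordinates, and the
    complement of \<open>C\<close>, where \<open>h\<close> vanishes.\<close>
  have "L = f ` W \<union> (L - C)" using \<beta>(3) o(4) by auto
  moreover have "openin (top_of_set L) (L - C)"
    using openin_open_Int[of "- C" L] \<beta>(2) by (simp add: Diff_eq open_Compl)
  moreover have "continuous_on (L - C) h"
    by (rule continuous_on_eq[OF continuous_on_const[of _ 0]]) (simp add: h0)
  ultimately have hL: "continuous_on L h"
    using continuous_on_Un_local_open[of "f ` W" "L - C" h] lp(5) hW by simp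
  note ci = continuous_integrable[OF hL]
  show "integrable \<mu> (\<lambda>x. indicator L x * h x)" by (rule ci(2))
  have "(\<integral>x. indicator L x * h x \<partial>\<mu>) =
      (\<integral>y. indicator W y * volume_density A g f y * (indicator L (f y) * h (f y)) \<partial>lborel)"
    by (rule integral_riemannian_volume[OF compact_L volume_L o(1) ci(1)])
      (use h0 \<beta>(3) oriented_frame(1)[OF D(1)] in \<open>auto simp: indicator_def intro: less_imp_le\<close>)
  also have "\<dots> = (\<integral>y. (\<Sum>i\<in>UNIV. indicator W y * frechet_derivative (u i) (at y) (axis i 1)) \<partial>lborel)"
  proof (rule Bochner_Integration.integral_cong[OF refl])
    fix y
    show "indicator W y * volume_density A g f y * (indicator L (f y) * h (f y)) =
        (\<Sum>i\<in>UNIV. indicator W y * frechet_derivative (u i) (at y) (axis i 1))"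
    proof (cases "y \<in> W")
      case True
      moreover from True have "f y \<in> L" using o(4) by auto
      ultimately show ?thesis using main[OF True] by simp
    qed simp
  qed
  also have "\<dots> = (\<Sum>i\<in>UNIV. \<integral>y. indicator W y * frechet_derivative (u i) (at y) (axis i 1) \<partial>lborel)"
    by (rule Bochner_Integration.integral_sum) (rule div(1))
  also have "\<dots> = 0" by (rule sum.neutral, rule ballI, rule div(2))
  finally show "(\<integral>x. indicator L x * h x \<partial>\<mu>) = 0" .
qed

lemma C1_sum: "(\<And>i. i \<in> S \<Longrightarrow> C1 (\<beta> i)) \<Longrightarrow> C1 (\<lambda>x. \<Sum>i\<in>S. \<beta> i x)"
  unfolding C1_def by (intro ballI Ck_on_sum chartD(2)) blast+

text \<open>The quotients \<open>\<beta> m / B\<close> are a partition of unity along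
  \<open>L\<close>. Each weighted divergence integrates to zero; in their sum the derivatives of the
  weights cancel, and the time derivative of \<open>P\<close> remains.\<close>

lemma integral_deriv_P:
  assumes t: "t \<in> I\<delta>"
  shows "(\<integral>x. indicator L x * deriv (\<lambda>s. P s x) t \<partial>\<mu>) = 0"
proof -
  obtain n :: nat and W f c \<beta> C where b: "\<And>i. i < n \<Longrightarrow> bump_patch (W i) (f i) (c i) (\<beta> i) (C i)"
    "\<And>x. x \<in> L \<Longrightarrow> 0 < (\<Sum>i<n. \<beta> i x)" using bump_patches by blast
  have C1\<beta>: "C1 (\<beta> m)" if "m < n" for m using b(1)[OF that] by (simp add: bump_patch_def)
  define B where "B x = (\<Sum>m<n. \<beta> m x)" for x
  have C1B: "C1 B" unfolding B_def using C1\<beta> by (intro C1_sum) auto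
  have dB: "mderiv B x w = (\<Sum>m<n. mderiv (\<beta> m) x w)" for x w
  proof -
    have "((\<lambda>z. \<Sum>m<n. \<beta> m (chart_inv (chart_at A x) z)) has_derivative (\<lambda>w. \<Sum>m<n. mderiv (\<beta> m) x w)) (at (snd (chart_at A x) x))"
      by (intro has_derivative_sum mderiv_has_derivative C1\<beta>) simp
    from has_derivative_unique[OF mderiv_has_derivative[OF C1B, unfolded B_def] this] show ?thesis
      unfolding B_def by metis
  qed
  define h where "h m x = \<beta> m x / B x * deriv (\<lambda>s. P s x) t + (\<Sum>i\<in>UNIV.
      (mderiv (\<beta> m) x (\<xi> x i) * B x - \<beta> m x * mderiv B x (\<xi> x i)) / (B x)\<^sup>2 *
      \<phi> (F t x) ((\<lambda>j. mdiff A (F t) x (\<xi> x j))(i := X (F t x))))" for m x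
  have h: "integrable \<mu> (\<lambda>x. indicator L x * h m x)" "(\<integral>x. indicator L x * h m x \<partial>\<mu>) = 0" if "m < n" for m
    using integral_divergence_patch[OF b(1)[OF that] t C1B] b(2) unfolding h_def B_def by blast+
  have "indicator L x * deriv (\<lambda>s. P s x) t = (\<Sum>m<n. indicator L x * h m x)" for x
  proof (cases "x \<in> L")
    case True
    then have B0: "B x \<noteq> 0" using b(2)[of x] by (simp add: B_def)
    have "(\<Sum>m<n. \<Sum>i\<in>UNIV. (mderiv (\<beta> m) x (\<xi> x i) * B x - \<beta> m x * mderiv B x (\<xi> x i)) / (B x)\<^sup>2 *
        \<phi> (F t x) ((\<lambda>j. mdiff A (F t) x (\<xi> x j))(i := X (F t x)))) =
      (\<Sum>i\<in>UNIV. \<Sum>m<n. (mderiv (\<beta> m) x (\<xi> x i) * B x - \<beta> m x * mderiv B x (\<xi> x i)) / (B x)\<^sup>2 *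
        \<phi> (F t x) ((\<lambda>j. mdiff A (F t) x (\<xi> x j))(i := X (F t x))))"
      by (rule sum.swap)
    also have "\<dots> = 0"
    proof (rule sum.neutral, rule ballI)
      fix i
      \<comment> \<open>The weights add up to \<open>1\<close>, so the numerators from the quotient
        rule add up to \<open>B' B - B B' = 0\<close>.\<close>
      have "(\<Sum>m<n. mderiv (\<beta> m) x (\<xi> x i) * B x - \<beta> m x * mderiv B x (\<xi> x i)) = 0"
        unfolding sum_subtractf sum_distrib_right[symmetric] dB[symmetric] by (simp add: B_def mult.commute)
      then show "(\<Sum>m<n. (mderiv (\<beta> m) x (\<xi> x i) * B x - \<beta> m x * mderiv B x (\<xi> x i)) / (B x)\<^sup>2 *
          \<phi> (F t x) ((\<lambda>j. mdiff A (F t) x (\<xi> x j))(i := X (F t x)))) = 0"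
        unfolding sum_distrib_right[symmetric] sum_divide_distrib[symmetric] by simp
    qed
    finally have "(\<Sum>m<n. h m x) = (\<Sum>m<n. \<beta> m x / B x * deriv (\<lambda>s. P s x) t)"
      unfolding h_def sum.distrib by simp
    also have "\<dots> = deriv (\<lambda>s. P s x) t"
      unfolding sum_distrib_right[symmetric] sum_divide_distrib[symmetric] B_def[symmetric] using B0 by simp
    finally show ?thesis using True by simp
  qed simp
  then have "(\<integral>x. indicator L x * deriv (\<lambda>s. P s x) t \<partial>\<mu>) = (\<integral>x. (\<Sum>m<n. indicator L x * h m x) \<partial>\<mu>)"
    by simp
  also have "\<dots> = (\<Sum>m<n. \<integral>x. indicator L x * h m x \<partial>\<mu>)"
    by (rule Bochner_Integration.integral_sum) (use h(1) in simp)
  also have "\<dots> = 0" using h(2) by simp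
  finally show ?thesis .
qed

end

section \<open>Second variation\<close>

text \<open>The hypotheses on \<open>nabla x\<close> concern smooth sections along the curve, and
  this provides one. In a chart and a trivialization near the value at time \<open>t0\<close> it is
  a multilinear expression evaluated at the partial derivatives \<open>w i t\<close> of the
  flow.\<close>

lemma (in flow) smooth_section_along_flow:
  fixes T :: "('m, 'e::euclidean_space) trivialization set" and \<Psi> :: "'m \<Rightarrow> ('k::finite \<Rightarrow> 'b) \<Rightarrow> 'e"
  assumes T: "vector_bundle A T" and \<Psi>: "smooth_bundle_form A T \<Psi>" and x: "x \<in> N0"
  shows "smooth_section_along T I (\<lambda>t. F t x) (\<lambda>t. \<Psi> (F t x) (\<lambda>i. mdiff A (F t) x (v i)))"
  unfolding smooth_section_along_def
proof
  fix \<tau> assume \<tau>: "\<tau> \<in> T"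
  have \<tau>o: "open (fst \<tau>)" and \<tau>l: "\<And>p. p \<in> fst \<tau> \<Longrightarrow> linear (snd \<tau> p)"
    using T \<tau> by (auto simp: vector_bundle_def)
  let ?c = "chart_at A x"
  note c = chart_at[of x]
  let ?W = "snd ?c ` (fst ?c \<inter> N0)" and ?f = "chart_inv ?c" and ?y = "snd ?c x"
  have W: "open ?W" by (rule open_chart_image[OF c(1) flowD(2)])
  have f: "smooth_into A ?W ?f"
    by (rule smooth_into_subset[OF smooth_into_chart_inv[OF c(1)]]) (auto simp: chart_img_def)
  have fN0: "?f ` ?W \<subseteq> N0" using chart_inv(1)[OF c(1)] by auto
  have y: "?y \<in> ?W" "?f ?y = x" using c x chart_inv(1)[OF c] by auto
  have cF: "continuous_on I (\<lambda>t. F t x)"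
  proof -
    have "continuous_on I (\<lambda>t. (\<lambda>(t, x). F t x) (t, x))"
      by (rule continuous_on_compose2[OF continuous_on_flow]) (use x in \<open>auto intro!: continuous_intros\<close>)
    then show ?thesis by simp
  qed
  show "smooth_on (I \<inter> (\<lambda>t. F t x) -` fst \<tau>) (\<lambda>t. snd \<tau> (F t x) (\<Psi> (F t x) (\<lambda>i. mdiff A (F t) x (v i))))"
  proof (rule smooth_on_local)
    fix t0 assume t0: "t0 \<in> I \<inter> (\<lambda>t. F t x) -` fst \<tau>"
    let ?d = "chart_at A (F t0 x)"
    note d = chart_at[of "F t0 x"]
    let ?S = "I \<inter> (\<lambda>t. F t x) -` (fst \<tau> \<inter> fst ?d)"
    define G where "G = (\<lambda>(t, y). snd ?d (F t (?f y)))"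
    let ?U = "I \<times> ?W \<inter> (\<lambda>(t, y). F t (?f y)) -` fst ?d"
    note fc = flow_coord[OF f W fN0 d(1), folded G_def]
    have S: "open ?S" by (rule continuous_open_preimage[OF cF]) (auto intro!: \<tau>o chartD(1)[OF d(1)])
    have SU: "(\<lambda>t. (t, ?y)) ` ?S \<subseteq> ?U" using y by auto
    have emb: "smooth_on ?S (\<lambda>t. (t, ?y))"
      by (intro smooth_on_Pair S smooth_on_ident smooth_on_const)
    let ?Z = "snd ?d ` (fst ?d \<inter> fst \<tau>)"
    define a where "a z w = snd \<tau> (chart_inv ?d z) (local_form A ?d \<Psi> z w)" for z and w :: "'k \<Rightarrow> 'b"
    define w where "w i t = frechet_derivative G (at (t, ?y)) (0, tcoord A ?c x (v i))" for i t
    have "smooth_on ?S (\<lambda>t. a (G (t, ?y)) (\<lambda>i. w i t))"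
    proof (rule smooth_on_multilinear[where a = a and w = w, OF S open_chart_image[OF d(1) \<tau>o]])
      show "(\<lambda>t. G (t, ?y)) ` ?S \<subseteq> ?Z" using y(2) by (auto simp: G_def)
      show "smooth_on ?S (\<lambda>t. G (t, ?y))" by (rule smooth_on_compose[OF S fc(1) SU emb fc(2)])
      show "smooth_on ?Z (\<lambda>z. a z w)" for w
        using \<Psi> \<tau> d(1) unfolding smooth_bundle_form_def a_def by blast
      show "linear (\<lambda>u. a z (w(i := u)))" if "z \<in> ?Z" for z w i
      proof -
        have z: "z \<in> chart_img ?d" "chart_inv ?d z \<in> fst \<tau>" "chart_inv ?d z \<in> fst ?d"
          using that chart_inv[OF d(1)] by (auto simp: chart_img_def)
        have "alternating_form (\<Psi> (chart_inv ?d z))" using \<Psi> by (simp add: smooth_bundle_form_def)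
        from alternating_form_linear[OF alternating_form_compose_linear[OF this linear_tvec[OF d(1) z(3)]]]
        have "linear (\<lambda>u. local_form A ?d \<Psi> z (w(i := u)))" by (simp add: local_form_def)
        from linear_compose[OF this \<tau>l[OF z(2)]] show ?thesis by (simp add: a_def o_def)
      qed
      show "smooth_on ?S (w i)" for i
        unfolding w_def
        by (rule smooth_on_compose[OF S fc(1) SU emb smooth_on_frechet_derivative[OF fc(2)]])
    qed
    then have "smooth_on ?S (\<lambda>t. snd \<tau> (F t x) (\<Psi> (F t x) (\<lambda>i. mdiff A (F t) x (v i))))"
    proof (rule smooth_on_cong[OF S])
      fix t assume "t \<in> ?S"
      then have m: "(t, ?y) \<in> ?U" using SU by blast
      have "tvec A ?d (F t x) (w i t) = mdiff A (F t) x (v i)" for i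
        using fc(5)[OF m, of "tcoord A ?c x (v i)"]
        unfolding w_def y(2) pdiff_chart_inv(2)[OF c] tvec_tcoord[OF c] .
      then show "a (G (t, ?y)) (\<lambda>i. w i t) = snd \<tau> (F t x) (\<Psi> (F t x) (\<lambda>i. mdiff A (F t) x (v i)))"
        using fc(4)[OF m] by (simp add: a_def local_form_def y(2))
    qed
    with S t0 d show "\<exists>U. open U \<and> t0 \<in> U \<and>
        smooth_on U (\<lambda>t. snd \<tau> (F t x) (\<Psi> (F t x) (\<lambda>i. mdiff A (F t) x (v i))))"
      by blast
  qed
qed

text \<open>At \<open>0\<close> the first derivative of the identity gives
  \<open>J1 0 = P1 0\<close>, because \<open>\<psi>1 0 = 0\<close>. In the second derivative the
  squares of these cancel, which leaves \<open>2 * J2 = 2 * P2 + \<psi>2\<close>.\<close>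

lemma second_derivative_of_norm:
  fixes J P \<psi> :: "real \<Rightarrow> real"
  assumes \<delta>: "0 < \<delta>" and eq: "\<And>t. \<bar>t\<bar> < \<delta> \<Longrightarrow> (J t)\<^sup>2 = (P t)\<^sup>2 + \<psi> t"
    and J: "\<And>t. \<bar>t\<bar> < \<delta> \<Longrightarrow> (J has_real_derivative J1 t) (at t)" "(J1 has_real_derivative J2) (at 0)"
    and P: "\<And>t. \<bar>t\<bar> < \<delta> \<Longrightarrow> (P has_real_derivative P1 t) (at t)" "(P1 has_real_derivative P2) (at 0)"
    and \<psi>: "\<And>t. \<bar>t\<bar> < \<delta> \<Longrightarrow> (\<psi> has_real_derivative \<psi>1 t) (at t)" "(\<psi>1 has_real_derivative \<psi>2) (at 0)"
    and 0: "J 0 = 1" "P 0 = 1" "\<psi>1 0 = 0"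
  shows "J2 = P2 + \<psi>2 / 2"
proof -
  have o: "open {-\<delta><..<\<delta>}" "0 \<in> {-\<delta><..<\<delta>}" using \<delta> by auto
  have e1: "2 * J t * J1 t = 2 * P t * P1 t + \<psi>1 t" if t: "\<bar>t\<bar> < \<delta>" for t
  proof -
    have "((\<lambda>t. (J t)\<^sup>2) has_real_derivative 2 * J t * J1 t) (at t)"
      using J(1)[OF t] by (auto intro!: derivative_eq_intros)
    then have "((\<lambda>t. (P t)\<^sup>2 + \<psi> t) has_real_derivative 2 * J t * J1 t) (at t)"
      by (rule has_field_derivative_transform_within_open[OF _ o(1)]) (use t eq in \<open>auto simp: abs_less_iff\<close>)
    moreover have "((\<lambda>t. (P t)\<^sup>2 + \<psi> t) has_real_derivative 2 * P t * P1 t + \<psi>1 t) (at t)"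
      using P(1)[OF t] \<psi>(1)[OF t] by (auto intro!: derivative_eq_intros)
    ultimately show ?thesis by (rule DERIV_unique)
  qed
  have "J1 0 = P1 0" using e1[of 0] \<delta> 0 by simp
  have "((\<lambda>t. 2 * J t * J1 t) has_real_derivative 2 * J1 0 * J1 0 + J2 * (2 * J 0)) (at 0)"
    using J(1)[of 0] J(2) \<delta> by (auto intro!: derivative_eq_intros)
  then have "((\<lambda>t. 2 * P t * P1 t + \<psi>1 t) has_real_derivative 2 * J1 0 * J1 0 + J2 * (2 * J 0)) (at 0)"
    by (rule has_field_derivative_transform_within_open[OF _ o]) (use e1 in \<open>auto simp: abs_less_iff\<close>)
  moreover have "((\<lambda>t. 2 * P t * P1 t + \<psi>1 t) has_real_derivative 2 * P1 0 * P1 0 + P2 * (2 * P 0) + \<psi>2) (at 0)"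
    using P(1)[of 0] P(2) \<psi>(2) \<delta> by (auto intro!: derivative_eq_intros)
  ultimately have "2 * J1 0 * J1 0 + J2 * (2 * J 0) = 2 * P1 0 * P1 0 + P2 * (2 * P 0) + \<psi>2"
    by (rule DERIV_unique)
  then show ?thesis using \<open>J1 0 = P1 0\<close> 0 by simp
qed

text \<open>\<open>calibrated\<close> speaks of tuples tangent to \<open>L\<close>; the vectors of
  \<open>\<xi> x\<close> are tangent because they are combinations of a coordinate frame. Membership
  in \<open>Or x\<close> then selects the positive sign of the volume form.\<close>

lemma (in oriented_flow) calibrated_frame:
  assumes "calibrated A g \<phi> L Or" and x: "x \<in> L"
  shows "\<phi> x (\<xi> x) = 1"
proof -
  obtain W f where f: "oriented_param W f" "x \<in> f ` W" using oriented_param_exists[OF x] by blast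
  then obtain y where y: "y \<in> W" "x = f y" by auto
  have u: "\<xi> x \<in> Or x" "kvec_norm (g x) (\<xi> x) = 1"
    using unit x by (auto simp: unit_kvector_def intro: kvec_norm_orthonormal)
  then obtain B :: "real^'k^'k" where B: "\<xi> x = frame_mult B (coord_frame A f y)"
    using f(1) y by (auto simp: oriented_param_def)
  note o = oriented_paramD[OF f(1)]
  note l = linear_diff_into[OF smooth_into_pdiff[OF o(2,3) y(1)]]
  have "\<xi> x i = diff_into A f y (\<Sum>j\<in>UNIV. B $ i $ j *\<^sub>R axis j 1)" for i
    unfolding B frame_mult_def coord_frame_def by (simp add: linear_sum[OF l] linear_cmul[OF l])
  then have "\<xi> x i \<in> tangent_space TYPE('k) A L x" for i
    using o(1) y unfolding tangent_space_def by blast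
  then have "\<phi> x (\<xi> x) = volume_form g Or x (\<xi> x)"
    using assms unfolding calibrated_def by blast
  then show ?thesis using u by (simp add: volume_form_def)
qed

theorem theorem1p3:
  fixes A :: "('m::{t2_space, second_countable_topology}, 'b::euclidean_space) chart set"
    and g :: "'m \<Rightarrow> 'b \<Rightarrow> 'b \<Rightarrow> real"
    and \<phi> :: "'m \<Rightarrow> ('k::finite \<Rightarrow> 'b) \<Rightarrow> real"
    and T :: "('m, 'e::euclidean_space) trivialization set"
    and h :: "'m \<Rightarrow> 'e \<Rightarrow> 'e \<Rightarrow> real"
    and \<Psi> :: "'m \<Rightarrow> ('k \<Rightarrow> 'b) \<Rightarrow> 'e"
    and L :: "'m set"
    and Or :: "'m \<Rightarrow> ('k \<Rightarrow> 'b) set"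
    and \<xi> :: "'m \<Rightarrow> ('k \<Rightarrow> 'b)"
    and V X :: "'m \<Rightarrow> 'b"
    and N N0 :: "'m set"
    and F :: "real \<Rightarrow> 'm \<Rightarrow> 'm"
    and \<epsilon> :: real
    and nabla :: "'m \<Rightarrow> (real \<Rightarrow> 'e) \<Rightarrow> real \<Rightarrow> 'e"
  assumes "smooth_manifold A"
    and "riemannian_metric A g"
    and "calibration A g \<phi>"
    and "vector_bundle A T"
    and "bundle_metric A T h"
    and "smooth_bundle_form A T \<Psi>"
    and "harvey_lawson_identity g h \<phi> \<Psi>"
    and "compact_oriented_submanifold A L Or"
    and "calibrated A g \<phi> L Or"
    and "\<forall>x\<in>L. unit_kvector g Or x (\<xi> x)"
    and "normal_vector_field TYPE('k) A g L V"
    and "open N" and "L \<subseteq> N0"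
    and "smooth_vector_field A N X"
    and "\<forall>x\<in>L. X x = V x"
    and "local_flow A N X N0 \<epsilon> F"
    and "\<forall>x\<in>L. covariant_derivative_along T {-\<epsilon><..<\<epsilon>} (\<lambda>t. F t x) (nabla x)"
    and "\<forall>x\<in>L. preserves_metric_along T h {-\<epsilon><..<\<epsilon>} (\<lambda>t. F t x) (nabla x)"
  defines "\<sigma> \<equiv> \<lambda>x. nabla x (\<lambda>t. \<Psi> (F t x) (\<lambda>i. mdiff A (F t) x (\<xi> x i))) 0"
  shows "set_integrable (riemannian_volume TYPE('k) A g L) L (\<lambda>x. h x (\<sigma> x) (\<sigma> x)) \<and>
    has_second_derivative (\<lambda>t. submanifold_volume TYPE('k) A g (F t ` L))
      (LINT x:L|riemannian_volume TYPE('k) A g L. h x (\<sigma> x) (\<sigma> x)) 0"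
proof -
  have flow: "flow A N N0 X \<epsilon> F"
    using assms(1,16) by (simp add: flow_def flow_axioms_def manifold_def)
  have "oriented_flow A N N0 X \<epsilon> F g L Or \<xi>"
    using flow assms(1,2,8,10,13)
    by (simp add: oriented_flow_def oriented_flow_axioms_def riemannian_def riemannian_axioms_def manifold_def)
  then interpret oriented_flow A N N0 X \<epsilon> F g L Or \<xi> .
  obtain \<delta> where \<delta>: "0 < \<delta>" "\<delta> \<le> \<epsilon>" "\<forall>t\<in>{-\<delta><..<\<delta>}. \<forall>x\<in>L. F t x \<in> N0"
    "\<forall>p\<in>L. \<exists>W f c. patch \<delta> W f c \<and> p \<in> f ` W"
    using patches_exist by blast
  define \<mu> where "\<mu> = riemannian_volume TYPE('k) A g L"
  interpret closed_form_flow A N N0 X \<epsilon> F g L Or \<xi> \<delta> \<mu> \<phi>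
    by unfold_locales (use \<delta> \<mu>_def assms(3) in \<open>auto simp: calibration_def\<close>)
  define J1 where "J1 = (\<lambda>t x. deriv (\<lambda>s. J s x) t)"
  define J2 where "J2 = (\<lambda>t x. deriv (\<lambda>s. J1 s x) t)"
  define P1 where "P1 = (\<lambda>t x. deriv (\<lambda>s. P s x) t)"
  define P2 where "P2 = (\<lambda>t x. deriv (\<lambda>s. P1 s x) t)"
  have smooth: "smooth_family J1" "smooth_family J2" "smooth_family P1" "smooth_family P2"
    unfolding J2_def P2_def unfolding J1_def P1_def
    by (intro smooth_family_deriv smooth_family_J smooth_family_P)+
  have zero: "0 \<in> I\<delta>" using \<delta>(1) by simp
  have inner: "inner_product (h p)" for p using assms(5) by (simp add: bundle_metric_def)
  have pointwise: "J2 0 x = P2 0 x + h x (\<sigma> x) (\<sigma> x)" if x: "x \<in> L" for x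
  proof -
    define s where "s = (\<lambda>t. \<Psi> (F t x) (\<lambda>i. mdiff A (F t) x (\<xi> x i)))"
    define D where "D = nabla x"
    define \<psi> where "\<psi> t = h (F t x) (s t) (s t)" for t
    have xN0: "x \<in> N0" using x LN0 by auto
    have F0: "F 0 x = x" by (rule flowD(3)[OF xN0])
    have s: "smooth_section_along T I (\<lambda>t. F t x) s"
      unfolding s_def by (rule smooth_section_along_flow[OF assms(4,6) xN0])
    then have Ds: "smooth_section_along T I (\<lambda>t. F t x) (D s)"
      using assms(17) x by (simp add: covariant_derivative_along_def D_def)
    have metric: "((\<lambda>r. h (F r x) (u r) (w r)) has_real_derivative h (F t x) (D u t) (w t) + h (F t x) (u t) (D w t)) (at t)"
      if "smooth_section_along T I (\<lambda>t. F t x) u" "smooth_section_along T I (\<lambda>t. F t x) w" "t \<in> I" for u w t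
      using assms(18) x that by (simp add: preserves_metric_along_def D_def)
    have frame0: "(\<lambda>i. mdiff A (F 0) x (\<xi> x i)) = \<xi> x" using mdiff_flow_0[OF xN0] by auto
    have HL: "(J t x)\<^sup>2 = (P t x)\<^sup>2 + \<psi> t" for t
      using assms(7) by (simp add: harvey_lawson_identity_def J_def P_def \<psi>_def s_def)
    have P0: "P 0 x = 1" using calibrated_frame[OF assms(9) x] by (simp add: P_def F0 frame0)
    \<comment> \<open>\<open>J\<close> and \<open>P\<close> both equal \<open>1\<close> at time
      \<open>0\<close>, so the identity forces the norm of \<open>s 0\<close> to vanish;
      definiteness of \<open>h x\<close> then gives \<open>s 0 = 0\<close>.\<close>
    have "h x (s 0) (s 0) = 0" using HL[of 0] J_0[OF x] P0 by (simp add: \<psi>_def F0)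
    then have s0: "s 0 = 0" using inner[of x] unfolding inner_product_def by (metis less_irrefl)
    have bil: "bilinear (h x)" using inner[of x] by (simp add: inner_product_def)
    define \<psi>1 where "\<psi>1 t = 2 * h (F t x) (D s t) (s t)" for t
    have "J2 0 x = P2 0 x + (2 * h x (D s 0) (D s 0)) / 2"
    proof (rule second_derivative_of_norm[OF \<delta>(1) HL])
      fix t assume "\<bar>t\<bar> < \<delta>"
      then have t: "t \<in> I\<delta>" by auto
      show "((\<lambda>t. J t x) has_real_derivative J1 t x) (at t)"
        unfolding J1_def by (rule smooth_family_has_derivative[OF smooth_family_J t x])
      show "((\<lambda>t. P t x) has_real_derivative P1 t x) (at t)"
        unfolding P1_def by (rule smooth_family_has_derivative[OF smooth_family_P t x])
      have "h (F t x) (s t) (D s t) = h (F t x) (D s t) (s t)"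
        using inner[of "F t x"] unfolding inner_product_def by blast
      then show "(\<psi> has_real_derivative \<psi>1 t) (at t)"
        using metric[OF s s I\<delta>[OF t]] unfolding \<psi>_def[abs_def] \<psi>1_def by simp
    next
      show "((\<lambda>t. J1 t x) has_real_derivative J2 0 x) (at 0)"
        unfolding J2_def by (rule smooth_family_has_derivative[OF smooth(1) zero x])
      show "((\<lambda>t. P1 t x) has_real_derivative P2 0 x) (at 0)"
        unfolding P2_def by (rule smooth_family_has_derivative[OF smooth(3) zero x])
      \<comment> \<open>The second covariant derivative occurs only paired with
        \<open>s 0 = 0\<close>, so the squared norm of \<open>D s 0\<close> is all that
        survives.\<close>
      have "(\<psi>1 has_real_derivative 2 * (h x (D (D s) 0) (s 0) + h x (D s 0) (D s 0))) (at 0)"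
        using DERIV_cmult[OF metric[OF Ds s I\<delta>[OF zero]], of 2] unfolding \<psi>1_def[abs_def] F0 .
      then show "(\<psi>1 has_real_derivative 2 * h x (D s 0) (D s 0)) (at 0)"
        using bilinear_rzero[OF bil] by (simp add: s0)
      show "\<psi>1 0 = 0" using bilinear_rzero[OF bil] by (simp add: \<psi>1_def F0 s0)
    qed (use J_0[OF x] P0 in auto)
    then show ?thesis by (simp add: \<sigma>_def D_def s_def)
  qed
  \<comment> \<open>On \<open>L\<close> the integrand is a difference of two continuous functions;
    measurability and integrability come from here, \<open>nabla\<close> being given curve by
    curve.\<close>
  have eq: "indicator L x * h x (\<sigma> x) (\<sigma> x) = indicator L x * J2 0 x - indicator L x * P2 0 x" for x
    using pointwise[of x] by (auto simp: indicator_def)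
  note int = continuous_integrable(2)[OF smooth_family_continuous_slice[OF _ zero]]
  have vol: "((\<lambda>t. submanifold_volume TYPE('k) A g (F t ` L)) has_real_derivative (\<integral>x. indicator L x * J1 t x \<partial>\<mu>)) (at t)"
    if t: "t \<in> I\<delta>" for t
    by (rule has_field_derivative_transform_within_open[OF
          smooth_family_integral[OF smooth_family_J t, folded J1_def[THEN fun_cong, THEN fun_cong]] _ t])
      (auto simp: volume_flow)
  have "((\<lambda>t. \<integral>x. indicator L x * P1 t x \<partial>\<mu>) has_real_derivative (\<integral>x. indicator L x * P2 0 x \<partial>\<mu>)) (at 0)"
    unfolding P2_def by (rule smooth_family_integral[OF smooth(3) zero])
  \<comment> \<open>By \<open>integral_deriv_P\<close> the integral of \<open>P1 t\<close> is zero
    for every \<open>t\<close> in \<open>I\<delta>\<close>, so its derivative at \<open>0\<close> is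
    zero too.\<close>
  then have "((\<lambda>t. 0) has_real_derivative (\<integral>x. indicator L x * P2 0 x \<partial>\<mu>)) (at 0)"
    by (rule has_field_derivative_transform_within_open[of _ _ _ I\<delta>])
      (use zero integral_deriv_P in \<open>auto simp: P1_def\<close>)
  from DERIV_unique[OF this DERIV_const] have P2: "(\<integral>x. indicator L x * P2 0 x \<partial>\<mu>) = 0" .
  have "((\<lambda>t. \<integral>x. indicator L x * J1 t x \<partial>\<mu>) has_real_derivative (\<integral>x. indicator L x * J2 0 x \<partial>\<mu>)) (at 0)"
    unfolding J2_def by (rule smooth_family_integral[OF smooth(1) zero])
  moreover have "(\<integral>x. indicator L x * J2 0 x \<partial>\<mu>) = (LINT x:L|\<mu>. h x (\<sigma> x) (\<sigma> x))"
    unfolding set_lebesgue_integral_def real_scaleR_def eq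
      Bochner_Integration.integral_diff[OF int[OF smooth(2)] int[OF smooth(4)]] P2 by simp
  moreover have "\<forall>\<^sub>F t in nhds 0. ((\<lambda>t. submanifold_volume TYPE('k) A g (F t ` L)) has_real_derivative
      (\<integral>x. indicator L x * J1 t x \<partial>\<mu>)) (at t)"
    using vol zero by (intro eventually_nhds[THEN iffD2] exI[of _ I\<delta>]) auto
  ultimately have "has_second_derivative (\<lambda>t. submanifold_volume TYPE('k) A g (F t ` L))
      (LINT x:L|\<mu>. h x (\<sigma> x) (\<sigma> x)) 0"
    unfolding has_second_derivative_def by auto
  moreover have "set_integrable \<mu> L (\<lambda>x. h x (\<sigma> x) (\<sigma> x))"
    unfolding set_integrable_def real_scaleR_def eq
    by (intro Bochner_Integration.integrable_diff int smooth)
  ultimately show ?thesis unfolding \<mu>_def by blast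
qed

end
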